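(* There is a universal constant $\varepsilon_0>0$ and a randomized algorithm that, given query access to an $n$-point metric $w$ with positive integer entries together with an arbitrary minimum spanning tree of the complete graph $G_w$ (including its edge weights), performs $\tilde O(n^{1.5})$ distance queries and with high probability outputs a value $X$ with $\mathsf{TSP}(w)\le X\le(2-\varepsilon_0)\,\mathsf{TSP}(w)$.
   Context: Query access means that the algorithm may query any entry $w(u,v)$ of the $n\times n$ distance matrix. $G_w$ is the complete graph on the $n$ points with edge weights $w$; $\mathsf{TSP}(w)$ is the minimum weight of a Hamiltonian cycle in $G_w$. $\tilde O$ hides polylogarithmic factors in $n$. *)

theory Defs
  imports "HOL-Probability.Probability_Mass_Function"
begin

text \<open>Points are 0,...,n-1. A distance function is w :: nat => nat => nat.\<close>

definition is_metric :: "nat \<Rightarrow> (nat \<Rightarrow> nat \<Rightarrow> nat) \<Rightarrow> bool" where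
  "is_metric n w \<longleftrightarrow>
     (\<forall>u<n. w u u = 0) \<and>
     (\<forall>u<n. \<forall>v<n. u \<noteq> v \<longrightarrow> w u v \<ge> 1) \<and>
     (\<forall>u<n. \<forall>v<n. w u v = w v u) \<and>
     (\<forall>u<n. \<forall>v<n. \<forall>x<n. w u v \<le> w u x + w x v)"

text \<open>Cost of the Hamiltonian cycle visiting the distinct vertices xs in order.\<close>
definition tour_cost :: "(nat \<Rightarrow> nat \<Rightarrow> nat) \<Rightarrow> nat list \<Rightarrow> nat" where
  "tour_cost w xs =
     (\<Sum>i<length xs. w (xs ! i) (xs ! ((i + 1) mod length xs)))"

definition TSP :: "nat \<Rightarrow> (nat \<Rightarrow> nat \<Rightarrow> nat) \<Rightarrow> nat" where
  "TSP n w = Min {tour_cost w xs | xs. distinct xs \<and> set xs = {0..<n}}"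

text \<open>Edges of the complete graph on {0..<n} are pairs (u,v) with u < v.\<close>
definition is_spanning_tree :: "nat \<Rightarrow> (nat \<times> nat) set \<Rightarrow> bool" where
  "is_spanning_tree n T \<longleftrightarrow>
     T \<subseteq> {(u, v). u < v \<and> v < n} \<and> card T = n - 1 \<and>
     (\<forall>u<n. \<forall>v<n. (u, v) \<in> (T \<union> T\<inverse>)\<^sup>*)"

definition tree_weight :: "(nat \<Rightarrow> nat \<Rightarrow> nat) \<Rightarrow> (nat \<times> nat) set \<Rightarrow> nat" where
  "tree_weight w T = (\<Sum>e\<in>T. w (fst e) (snd e))"

definition is_MST :: "nat \<Rightarrow> (nat \<Rightarrow> nat \<Rightarrow> nat) \<Rightarrow> (nat \<times> nat) set \<Rightarrow> bool" where
  "is_MST n w T \<longleftrightarrow> is_spanning_tree n T \<and>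
     (\<forall>T'. is_spanning_tree n T' \<longrightarrow> tree_weight w T \<le> tree_weight w T')"

text \<open>Deterministic adaptive query algorithms (decision trees): either output a
  value, or query the distance w u v and continue depending on the answer.\<close>
datatype qalg = Output real | Query nat nat "nat \<Rightarrow> qalg"

text \<open>Running a query algorithm against oracle w: (output, number of queries).\<close>
primrec run :: "(nat \<Rightarrow> nat \<Rightarrow> nat) \<Rightarrow> qalg \<Rightarrow> real \<times> nat" where
  "run w (Output x) = (x, 0)"
| "run w (Query u v k) = (case run w (k (w u v)) of (x, q) \<Rightarrow> (x, Suc q))"

text \<open>A randomized query algorithm is, for each n and each given tree with its
  edge weights, a probability distribution over deterministic query algorithms.\<close>
type_synonym rand_alg = "nat \<Rightarrow> (nat \<times> nat) set \<Rightarrow> (nat \<times> nat \<Rightarrow> nat) \<Rightarrow> qalg pmf"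

definition tree_weights :: "(nat \<Rightarrow> nat \<Rightarrow> nat) \<Rightarrow> (nat \<times> nat) set \<Rightarrow> nat \<times> nat \<Rightarrow> nat" where
  "tree_weights w T = (\<lambda>e. if e \<in> T then w (fst e) (snd e) else 0)"

end

theory Submission
  imports Defs "HOL-Probability.Product_PMF" "HOL-Library.Multiset"
begin

text \<open>
  Let \<open>M\<close> be the weight of the given tree \<open>T\<close>; then \<open>M \<le> TSP \<le> 2M\<close>. It suffices to certify
  \<open>TSP \<le> (2 - \<epsilon>) M\<close> whenever \<open>TSP \<le> 1.01 M\<close>.

  Upper bounds. For a set \<open>F\<close> of extra edges, the multigraph consisting of \<open>T\<close>, \<open>F\<close> and a second copy of
  every tree edge that is crossed an even number of times by \<open>F\<close> is connected and Eulerian, so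
  \<open>TSP \<le> 2M - (w(tree edges crossed oddly) - w(F))\<close>. If each link is chosen at random with a small
  probability, a tree edge is crossed oddly with probability close to its expected coverage, hence a
  fractional set of links whose coverage outweighs its cost yields an improvement.

  Local search. Such a fractional solution is grown by doubling: at level \<open>i\<close> every link that still covers
  enough unsaturated tree weight gets additional weight \<open>2^i / N\<close>, and a tree edge saturates once its
  coverage reaches a constant. Following the level tests of Kapralov, Mitrovic, Norouzi-Fard and
  Tardos for matchings, whether a tree edge is unsaturated is simulated recursively with fresh
  randomness; stopping a test as soon as its accumulated coverage reaches the threshold gives a
  deterministic bound on the number of queries.

  Completeness. Links are considered at geometric scales \<open>s\<close>, between representatives of clusters of
  tree diameter \<open>s / 100\<close>, and only cover tree edges within distance \<open>100 s\<close> of their ends. In the end no valid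
  link covers much unsaturated weight. A short tour crosses every tree edge at least twice. The
  unsaturated weight crossed near an end of a tour link is at most about half the tour; an edge crossed
  only far away sits on top of a vertical segment of the tree with a small unsaturated fraction, and such
  segments can be chosen disjoint. Hence a short tour forces a constant fraction of \<open>M\<close> to be saturated,
  which is detected by sampling tree edges.
\<close>

section \<open>Randomised query programs\<close>

text \<open>No state can be kept: whether a tree edge is saturated is recomputed by an independent
  recursion at every use. So each level is analysed through the probability \<open>X i e\<close>
  that a test still reports the edge as unsaturated and the probability \<open>Y i f\<close> that a
  link passes the checks of levels 1 to i. These are fixed numbers determined by the input, and the
  fractional solution is defined from them. Soundness rests on two facts about the load of an edge,
  its coverage weighted by the probability of being unsaturated when that coverage arrives. The
  probability of being declared saturated is at most a constant times the load, so saturation by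
  mere chance is paid for as well; and the load is at most 11, so after scaling by a constant the
  loss from repeated crossings is negligible. A test at level j costs about 2^j, and j need only
  reach the logarithm of N to base 1.99 for N candidate links per edge: doubling, reduced by the
  error of a check. Representatives leave about n candidates per edge up to logarithmic factors, so
  the count is about \<open>n powr (5/4)\<close>, below the required 1.5.\<close>

datatype 'a prog = Ret 'a | Qry nat nat "nat \<Rightarrow> 'a prog" | Rnd nat "nat \<Rightarrow> 'a prog"

primrec bindp :: "'a prog \<Rightarrow> ('a \<Rightarrow> 'b prog) \<Rightarrow> 'b prog" where
  "bindp (Ret x) g = g x"
| "bindp (Qry u v k) g = Qry u v (\<lambda>a. bindp (k a) g)"
| "bindp (Rnd m f) g = Rnd m (\<lambda>r. bindp (f r) g)"

primrec den :: "(nat \<Rightarrow> nat \<Rightarrow> nat) \<Rightarrow> 'a prog \<Rightarrow> 'a pmf" where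
  "den w (Ret x) = return_pmf x"
| "den w (Qry u v k) = den w (k (w u v))"
| "den w (Rnd m f) = bind_pmf (pmf_of_set {..<m}) (\<lambda>r. den w (f r))"

text \<open>\<open>wp B w p P b\<close>: every run of \<open>p\<close> on \<open>w\<close> with a budget of \<open>b\<close> queries and draws ends with a result and a
  remaining budget satisfying \<open>P\<close>. Bounding the draws as well makes a finite seed sufficient.\<close>

primrec wp :: "nat \<Rightarrow> (nat \<Rightarrow> nat \<Rightarrow> nat) \<Rightarrow> 'a prog \<Rightarrow> ('a \<Rightarrow> nat \<Rightarrow> bool) \<Rightarrow> nat \<Rightarrow> bool" where
  "wp B w (Ret x) P b = P x b"
| "wp B w (Qry u v k) P b = (b > 0 \<and> wp B w (k (w u v)) P (b - 1))"
| "wp B w (Rnd m f) P b = (m \<in> {1..B} \<and> b > 0 \<and> (\<forall>r<m. wp B w (f r) P (b - 1)))"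

text \<open>Each draw consumes one seed. The value 0 for an exhausted list is never reached when the
  list is as long as a budget certified by \<open>wp\<close>.\<close>

primrec det :: "real prog \<Rightarrow> (nat \<Rightarrow> nat) list \<Rightarrow> qalg" where
  "det (Ret x) rs = Output x"
| "det (Qry u v k) rs = Query u v (\<lambda>a. det (k a) rs)"
| "det (Rnd m f) rs = (case rs of [] \<Rightarrow> Output 0 | r # rs' \<Rightarrow> det (f (r m)) rs')"

text \<open>The range of a draw may depend on earlier answers. Hence one seed holds an independent
  uniform value for every range up to B, and a draw of range m reads component m.\<close>

definition seed_pmf :: "nat \<Rightarrow> (nat \<Rightarrow> nat) pmf" where
  "seed_pmf B = Pi_pmf {1..B} 0 (\<lambda>m. pmf_of_set {..<m})"

lemma den_bindp: "den w (bindp p g) = bind_pmf (den w p) (\<lambda>x. den w (g x))"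
  by (induction p) (simp_all add: bind_return_pmf bind_assoc_pmf)

lemma wp_bindp: "wp B w (bindp p g) P b = wp B w p (\<lambda>x b'. wp B w (g x) P b') b"
  by (induction p arbitrary: b) auto

lemma wp_mono:
  "wp B w p P b \<Longrightarrow> (\<And>x b'. P x b' \<Longrightarrow> Q x (b' + d)) \<Longrightarrow> wp B w p Q (b + d)"
proof (induction p arbitrary: b)
  case (Qry u v k)
  from Qry.prems(1) obtain b1 where b: "b = Suc b1" by (cases b) auto
  have "wp B w (k (w u v)) Q (b1 + d)" using Qry.prems b by (intro Qry.IH) auto
  then show ?case by (simp add: b)
next
  case (Rnd m f)
  from Rnd.prems(1) obtain b1 where b: "b = Suc b1" by (cases b) auto
  have "wp B w (f r) Q (b1 + d)" if "r < m" for r using Rnd.prems b that by (intro Rnd.IH) auto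
  then show ?case using Rnd.prems(1) by (simp add: b)
qed auto

lemma seed_component: "m \<in> {1..B} \<Longrightarrow> map_pmf (\<lambda>r. r m) (seed_pmf B) = pmf_of_set {..<m}"
  unfolding seed_pmf_def by (subst Pi_pmf_component) auto

lemma seed_range: "r \<in> set_pmf (seed_pmf B) \<Longrightarrow> m \<in> {1..B} \<Longrightarrow> r m < m"
proof -
  assume r: "r \<in> set_pmf (seed_pmf B)" and m: "m \<in> {1..B}"
  have "r m \<in> set_pmf (map_pmf (\<lambda>r. r m) (seed_pmf B))" using r by auto
  then have "r m \<in> set_pmf (pmf_of_set {..<m})" using seed_component[OF m] by simp
  then show "r m < m" using m by (subst (asm) set_pmf_of_set) (auto simp: lessThan_empty_iff)
qed

lemma run_det_queries:
  assumes "wp B w p (\<lambda>_ _. True) b" "rs \<in> set_pmf (replicate_pmf b (seed_pmf B))"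
  shows "snd (run w (det p rs)) \<le> b"
proof -
  \<comment> \<open>Generalised to lists of any length, since a query lowers the budget without
    consuming a seed.\<close>
  have "snd (run w (det p rs)) \<le> b"
    if "wp B w p (\<lambda>_ _. True) b" "set rs \<subseteq> set_pmf (seed_pmf B)" for b rs
    using that
  proof (induction p arbitrary: b rs)
    case (Qry u v k)
    then obtain b1 where "b = Suc b1" by (cases b) auto
    with Qry.prems Qry.IH[of "k (w u v)" b1 rs] show ?case
      by (auto simp: case_prod_beta)
  next
    case (Rnd m f)
    show ?case
    proof (cases rs)
      case (Cons r rs')
      with Rnd.prems have "r m < m" by (intro seed_range) auto
      then have "snd (run w (det (f (r m)) rs')) \<le> b - 1"
        using Rnd.prems Cons by (intro Rnd.IH) auto
      then show ?thesis using Cons by simp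
    qed simp
  qed simp
  then show ?thesis using assms by (auto simp: set_replicate_pmf lists_eq_set)
qed

lemma run_det_distr:
  assumes "wp B w p (\<lambda>_ _. True) b"
  shows "map_pmf (\<lambda>rs. fst (run w (det p rs))) (replicate_pmf b (seed_pmf B)) = den w p"
  using assms
proof (induction p arbitrary: b)
  case (Ret x)
  then show ?case by simp
next
  case (Qry u v k)
  \<comment> \<open>A query uses budget but no seed. Giving the unit back keeps the budget equal to
    the number of seeds; surplus seeds do no harm.\<close>
  have m: "wp B w (k (w u v)) (\<lambda>_ _. True) b" 
    using wp_mono[of B w "k (w u v)" "\<lambda>_ _. True" "b - 1" "\<lambda>_ _. True" 1] Qry.prems by auto
  show ?case using Qry.IH[OF rangeI m]
    by (simp add: case_prod_beta)
next
  case (Rnd m f)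
  then obtain b1 where b: "b = Suc b1" and mB: "m \<in> {1..B}" by (cases b) auto
  have ne: "{..<m} \<noteq> {}" using mB by (auto simp: lessThan_empty_iff)
  have "map_pmf (\<lambda>rs. fst (run w (det (Rnd m f) rs))) (replicate_pmf b (seed_pmf B))
      = bind_pmf (seed_pmf B) (\<lambda>r. map_pmf (\<lambda>rs. fst (run w (det (f (r m)) rs))) (replicate_pmf b1 (seed_pmf B)))"
    by (simp add: b map_bind_pmf map_pmf_def bind_assoc_pmf bind_return_pmf)
  also have "\<dots> = bind_pmf (seed_pmf B) (\<lambda>r. den w (f (r m)))"
    using Rnd b mB by (intro bind_pmf_cong refl Rnd.IH) (auto dest: seed_range)
  also have "\<dots> = bind_pmf (map_pmf (\<lambda>r. r m) (seed_pmf B)) (\<lambda>x. den w (f x))"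
    by (simp add: bind_map_pmf)
  finally show ?case by (simp add: seed_component[OF mB])
qed

section \<open>Sums of independent draws\<close>

abbreviation ex_pmf :: "'a pmf \<Rightarrow> ('a \<Rightarrow> real) \<Rightarrow> real" where
  "ex_pmf p f \<equiv> measure_pmf.expectation p f"

lemma ex_pmf_bind:
  assumes "finite (set_pmf p)" "\<And>x. x \<in> set_pmf p \<Longrightarrow> finite (set_pmf (f x))"
  shows "ex_pmf (bind_pmf p f) h = ex_pmf p (\<lambda>x. ex_pmf (f x) h)"
  using assms
  by (subst pmf_expectation_bind[where A = "set_pmf p"])
     (auto simp: integral_measure_pmf[where A = "set_pmf p"])

lemma ex_pmf_mono:
  assumes "finite (set_pmf p)" "\<And>x. x \<in> set_pmf p \<Longrightarrow> f x \<le> g x"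
  shows "ex_pmf p f \<le> ex_pmf p g"
  using assms by (subst (1 2) integral_measure_pmf[where A = "set_pmf p"])
    (auto intro!: sum_mono mult_left_mono)

lemma ex_pmf_cong:
  assumes "\<And>x. x \<in> set_pmf p \<Longrightarrow> f x = g x"
  shows "ex_pmf p f = ex_pmf p g"
  using assms by (intro integral_cong_AE) (auto simp: AE_measure_pmf_iff)

lemma prob_eq_ex: "measure_pmf.prob p A = ex_pmf p (indicator A)"
  by simp

primrec isum :: "nat \<Rightarrow> nat pmf \<Rightarrow> nat pmf" where
  "isum 0 \<mu> = return_pmf 0"
| "isum (Suc k) \<mu> = bind_pmf \<mu> (\<lambda>z. map_pmf (\<lambda>s. z + s) (isum k \<mu>))"

lemma finite_isum: "finite (set_pmf \<mu>) \<Longrightarrow> finite (set_pmf (isum k \<mu>))"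
  by (induction k) auto

lemma isum_power:
  assumes "finite (set_pmf \<mu>)"
  shows "ex_pmf (isum k \<mu>) (\<lambda>s. z ^ s) = ex_pmf \<mu> (\<lambda>s. z ^ s) ^ k"
proof (induction k)
  case (Suc k)
  have "ex_pmf (isum (Suc k) \<mu>) (\<lambda>s. z ^ s) = ex_pmf \<mu> (\<lambda>x. ex_pmf (isum k \<mu>) (\<lambda>s. z ^ x * z ^ s))"
    using assms by (simp add: ex_pmf_bind finite_isum power_add)
  also have "\<dots> = ex_pmf \<mu> (\<lambda>x. z ^ x * ex_pmf (isum k \<mu>) (\<lambda>s. z ^ s))"
    by simp
  finally show ?case by (simp add: Suc)
qed simp

text \<open>The centre is arbitrary because conditioning on the first draw shifts it: the induction
  hypothesis is used at \<open>a - real x\<close>.\<close>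

lemma isum_square:
  assumes "finite (set_pmf \<mu>)"
  shows "ex_pmf (isum k \<mu>) (\<lambda>s. (real s - a) ^ 2) \<le> (k * ex_pmf \<mu> real - a) ^ 2 + k * ex_pmf \<mu> (\<lambda>z. real z ^ 2)"
proof (induction k arbitrary: a)
  case (Suc k)
  let ?e = "ex_pmf \<mu> real" and ?v = "ex_pmf \<mu> (\<lambda>z. real z ^ 2)"
  have int: "integrable (measure_pmf \<mu>) f" for f :: "nat \<Rightarrow> real"
    using assms by (rule integrable_measure_pmf_finite)
  have "ex_pmf (isum (Suc k) \<mu>) (\<lambda>s. (real s - a) ^ 2)
      = ex_pmf \<mu> (\<lambda>x. ex_pmf (isum k \<mu>) (\<lambda>s. (real s - (a - real x)) ^ 2))"
    using assms by (simp add: ex_pmf_bind finite_isum algebra_simps)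
  also have "\<dots> \<le> ex_pmf \<mu> (\<lambda>x. (k * ?e - (a - real x)) ^ 2 + k * ?v)"
    using assms by (intro ex_pmf_mono Suc)
  also have "\<dots> = ex_pmf \<mu> (\<lambda>x. ((k * ?e - a) ^ 2 + k * ?v) + (2 * (k * ?e - a)) * real x + real x ^ 2)"
    by (intro ex_pmf_cong) (simp add: power2_eq_square algebra_simps)
  also have "\<dots> = ((k * ?e - a) ^ 2 + k * ?v) + (2 * (k * ?e - a)) * ?e + ?v"
    using int by simp
  also have "\<dots> \<le> (Suc k * ?e - a) ^ 2 + Suc k * ?v"
    by (simp add: power2_eq_square algebra_simps)
  finally show ?case .
qed simp

lemma isum_chebyshev:
  assumes "finite (set_pmf \<mu>)" "t > 0" "k * ex_pmf \<mu> real \<le> t / 2"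
  shows "measure_pmf.prob (isum k \<mu>) {s. t \<le> real s} \<le> 4 * k * ex_pmf \<mu> (\<lambda>z. real z ^ 2) / t ^ 2"
proof -
  let ?a = "k * ex_pmf \<mu> real"
  have "indicator {s. t \<le> real s} s \<le> (4 / t ^ 2) * (real s - ?a) ^ 2" for s
  proof (cases "t \<le> real s")
    case True
    then have "(t / 2) ^ 2 \<le> (real s - ?a) ^ 2" using assms by (intro power_mono) auto
    then show ?thesis using True assms(2) by (simp add: field_simps power2_eq_square)
  qed auto
  then have "measure_pmf.prob (isum k \<mu>) {s. t \<le> real s} \<le> ex_pmf (isum k \<mu>) (\<lambda>s. (4 / t ^ 2) * (real s - ?a) ^ 2)"
    unfolding prob_eq_ex using assms(1) by (intro ex_pmf_mono finite_isum)
  also have "\<dots> = (4 / t ^ 2) * ex_pmf (isum k \<mu>) (\<lambda>s. (real s - ?a) ^ 2)" by simp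
  also have "\<dots> \<le> (4 / t ^ 2) * (k * ex_pmf \<mu> (\<lambda>z. real z ^ 2))"
    using isum_square[OF assms(1), of k ?a] assms(2) by (intro mult_left_mono) auto
  finally show ?thesis by simp
qed

text \<open>By convexity the function lies below its chord, whose slope 1 - 1/e exceeds 6/10 in
  absolute value.\<close>

lemma exp_neg_le_chord:
  fixes u :: real assumes "0 \<le> u" "u \<le> 1"
  shows "exp (- u) \<le> 1 - 6 / 10 * u"
proof -
  have "exp ((1 - u) *\<^sub>R 0 + u *\<^sub>R (-1)) \<le> (1 - u) * exp (0::real) + u * exp (-1)"
    using assms by (intro convex_onD[where A = UNIV]) (auto intro: exp_convex)
  moreover have "exp (-1 :: real) \<le> 4/10"
  proof -
    have "(5/2::real) \<le> exp 1" using exp_lower_Taylor_quadratic[of 1] by simp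
    then have "inverse (exp (1::real)) \<le> inverse (5/2)" by (rule le_imp_inverse_le) simp
    then show ?thesis by (simp add: exp_minus)
  qed
  ultimately have "exp (- u) \<le> u * (exp (-1)) + (1 - u)" by simp
  also have "\<dots> \<le> u * (4/10) + (1 - u)" using assms \<open>exp (-1 :: real) \<le> 4/10\<close>
    by (intro add_right_mono mult_left_mono) auto
  finally show ?thesis by simp
qed

text \<open>Chernoff bound in units of the largest possible draw r, with base exp (-1/r).\<close>

lemma isum_lower_tail:
  assumes fin: "finite (set_pmf \<mu>)" and b: "\<And>z. z \<in> set_pmf \<mu> \<Longrightarrow> real z \<le> r" and r: "r > 0"
  shows "measure_pmf.prob (isum k \<mu>) {s. real s < t} \<le> exp (t / r - 6 / 10 * (k * ex_pmf \<mu> real / r))"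
proof -
  define y where "y = exp (- (1 / r))"
  have yp: "y ^ s = exp (- (real s / r))" for s
    unfolding y_def by (simp flip: exp_of_nat_mult)
  have int: "integrable (measure_pmf \<mu>) f" for f :: "nat \<Rightarrow> real"
    using fin by (rule integrable_measure_pmf_finite)
  have "measure_pmf.prob (isum k \<mu>) {s. real s < t} \<le> ex_pmf (isum k \<mu>) (\<lambda>s. exp (t / r) * y ^ s)"
    unfolding prob_eq_ex using fin r
    by (intro ex_pmf_mono finite_isum)
       (auto simp: indicator_def yp divide_right_mono simp flip: exp_add diff_divide_distrib)
  also have "\<dots> = exp (t / r) * ex_pmf \<mu> (\<lambda>s. y ^ s) ^ k" by (simp add: isum_power[OF fin])
  finally have h1: "measure_pmf.prob (isum k \<mu>) {s. real s < t} \<le> \<dots>" .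
  have "ex_pmf \<mu> (\<lambda>s. y ^ s) \<le> ex_pmf \<mu> (\<lambda>s. 1 - 6 / 10 * (real s / r))"
    using b r fin by (intro ex_pmf_mono) (simp_all only: yp, intro exp_neg_le_chord, auto simp: divide_simps)
  also have "\<dots> = 1 - 6 / 10 * (ex_pmf \<mu> real / r)"
    using int by simp
  also have "\<dots> \<le> exp (- (6 / 10 * (ex_pmf \<mu> real / r)))"
    using exp_ge_add_one_self[of "- (6 / 10 * (ex_pmf \<mu> real / r))"] by simp
  finally have h2: "ex_pmf \<mu> (\<lambda>s. y ^ s) \<le> \<dots>" .
  have "measure_pmf.prob (isum k \<mu>) {s. real s < t} \<le> exp (t / r) * exp (- (6 / 10 * (ex_pmf \<mu> real / r))) ^ k"
    by (rule order_trans[OF h1], intro mult_left_mono power_mono h2) (simp_all add: yp)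
  also have "\<dots> = exp (t / r - 6 / 10 * (k * ex_pmf \<mu> real / r))"
    by (simp add: algebra_simps flip: exp_of_nat_mult exp_add)
  finally show ?thesis .
qed

lemma bernoulli_power:
  assumes "set_pmf \<mu> \<subseteq> {0, 1::nat}"
  shows "ex_pmf \<mu> (\<lambda>s. z ^ s) = 1 + pmf \<mu> 1 * (z - 1)"
proof -
  have "pmf \<mu> 0 + pmf \<mu> 1 = 1"
    using sum_pmf_eq_1[of "{0,1}" \<mu>] assms by simp
  moreover have "ex_pmf \<mu> (\<lambda>s. z ^ s) = (\<Sum>a\<in>{0,1}. pmf \<mu> a * z ^ a)"
    using assms by (subst integral_measure_pmf[where A = "{0, 1}"]) auto
  ultimately show ?thesis by (simp add: algebra_simps)
qed

lemma isum_bernoulli_upper: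
  assumes \<mu>: "set_pmf \<mu> \<subseteq> {0, 1::nat}" and q: "pmf \<mu> 1 \<le> 11/10 * \<theta>" and t: "t \<ge> 12/10 * \<theta> * k" and "\<theta> \<ge> 0"
  shows "measure_pmf.prob (isum k \<mu>) {s. t \<le> real s} \<le> exp (- (1/1000) * \<theta> * k)"
proof -
  have fin: "finite (set_pmf \<mu>)" using \<mu> by (rule finite_subset) auto
  \<comment> \<open>Tuned to the gap between 11/10 and 12/10: y - 1 <= 5/100 gives a rate of
    55/1000, while the threshold contributes 12/10 * 475/10000 = 57/1000.\<close>
  define y :: real where "y = exp (475/10000)"
  have y: "1 \<le> y" "y \<le> 105/100"
  proof -
    show "y \<le> 105/100" using exp_bound[of "475/10000"] by (simp add: y_def power2_eq_square)
  qed (simp add: y_def)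
  have yp: "y ^ s = exp (475/10000 * real s)" for s by (simp add: y_def mult.commute flip: exp_of_nat_mult)
  have "measure_pmf.prob (isum k \<mu>) {s. t \<le> real s} \<le> ex_pmf (isum k \<mu>) (\<lambda>s. exp (- (475/10000 * t)) * y ^ s)"
    unfolding prob_eq_ex using fin
    by (intro ex_pmf_mono finite_isum) (auto simp: indicator_def yp simp flip: exp_add)
  also have "\<dots> = exp (- (475/10000 * t)) * (1 + pmf \<mu> 1 * (y - 1)) ^ k"
    by (simp add: isum_power[OF fin] bernoulli_power[OF \<mu>])
  finally have h1: "measure_pmf.prob (isum k \<mu>) {s. t \<le> real s} \<le> \<dots>" .
  have "1 + pmf \<mu> 1 * (y - 1) \<le> 1 + (11/10 * \<theta>) * (5/100)"
    using y q assms(4) by (intro add_left_mono mult_mono) auto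
  also have "\<dots> \<le> exp ((11/10 * \<theta>) * (5/100))" by (rule exp_ge_add_one_self)
  finally have h2: "1 + pmf \<mu> 1 * (y - 1) \<le> \<dots>" .
  have "measure_pmf.prob (isum k \<mu>) {s. t \<le> real s} \<le>
      exp (- (475/10000 * t)) * exp ((11/10 * \<theta>) * (5/100)) ^ k"
    using y by (intro order_trans[OF h1] mult_left_mono power_mono h2) simp_all
  also have "\<dots> = exp (55/1000 * \<theta> * k - 475/10000 * t)" by (simp add: algebra_simps flip: exp_of_nat_mult exp_add)
  also have "\<dots> \<le> exp (- (1/1000) * \<theta> * k)"
  proof -
    have "0 \<le> \<theta> * real k" using assms(4) by simp
    then have "55/1000 * \<theta> * k - 475/10000 * t \<le> - (1/1000) * \<theta> * k" using t by simp
    then show ?thesis by simp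
  qed
  finally show ?thesis .
qed

lemma isum_bernoulli_lower:
  assumes \<mu>: "set_pmf \<mu> \<subseteq> {0, 1::nat}" and q: "pmf \<mu> 1 \<ge> 13/10 * \<theta>" and t: "t \<le> 12/10 * \<theta> * k" and "\<theta> \<ge> 0"
  shows "measure_pmf.prob (isum k \<mu>) {s. real s < t} \<le> exp (- (1/1000) * \<theta> * k)"
proof -
  have fin: "finite (set_pmf \<mu>)" using \<mu> by (rule finite_subset) auto
  \<comment> \<open>Here 1 - y >= 497/10000 gives a rate of 13/10 * 497/10000 = 6461/100000, against
    12/10 * 51/1000 = 6120/100000 from the threshold.\<close>
  define y :: real where "y = exp (-(51/1000))"
  have y: "0 < y" "y \<le> 9503/10000"
  proof -
    have "exp (-(51/1000::real)) \<le> 1 / (1 + 51/1000 + (51/1000)^2/2)"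
    proof -
      have "1 + 51/1000 + (51/1000)^2/2 \<le> exp (51/1000::real)" using exp_lower_Taylor_quadratic[of "51/1000::real"] by simp
      then show ?thesis by (simp add: exp_minus inverse_eq_divide) (rule frac_le, auto simp: power2_eq_square)
    qed
    also have "\<dots> \<le> 9503/10000" by (simp add: power2_eq_square)
    finally show "y \<le> 9503/10000" by (simp add: y_def)
  qed (simp add: y_def)
  have yp: "y ^ s = exp (-(51/1000 * real s))" for s by (simp add: y_def mult.commute flip: exp_of_nat_mult)
  have "measure_pmf.prob (isum k \<mu>) {s. real s < t} \<le> ex_pmf (isum k \<mu>) (\<lambda>s. exp (51/1000 * t) * y ^ s)"
    unfolding prob_eq_ex using fin
    by (intro ex_pmf_mono finite_isum) (auto simp: indicator_def yp simp flip: exp_add)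
  also have "\<dots> = exp (51/1000 * t) * (1 + pmf \<mu> 1 * (y - 1)) ^ k"
    by (simp add: isum_power[OF fin] bernoulli_power[OF \<mu>])
  finally have h1: "measure_pmf.prob (isum k \<mu>) {s. real s < t} \<le> \<dots>" .
  have "1 + pmf \<mu> 1 * (y - 1) \<le> 1 - (13/10 * \<theta>) * (497/10000)"
  proof -
    have "(13/10 * \<theta>) * (497/10000) \<le> pmf \<mu> 1 * (1 - y)"
      using y q assms(4) by (intro mult_mono) auto
    then show ?thesis by (simp add: algebra_simps)
  qed
  also have "\<dots> \<le> exp (- ((13/10 * \<theta>) * (497/10000)))" using exp_ge_add_one_self[of "- ((13/10 * \<theta>) * (497/10000))"] by simp
  finally have h2: "1 + pmf \<mu> 1 * (y - 1) \<le> \<dots>" .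
  have "pmf \<mu> 1 * (1 - y) \<le> 1 * 1" using y pmf_le_1[of \<mu> 1] by (intro mult_mono) auto
  then have "0 \<le> 1 + pmf \<mu> 1 * (y - 1)" by (simp add: algebra_simps)
  then have "measure_pmf.prob (isum k \<mu>) {s. real s < t} \<le>
      exp (51/1000 * t) * exp (- ((13/10 * \<theta>) * (497/10000))) ^ k"
    by (intro order_trans[OF h1] mult_left_mono power_mono h2) simp_all
  also have "\<dots> = exp (51/1000 * t - 6461/100000 * \<theta> * k)" by (simp add: algebra_simps flip: exp_of_nat_mult exp_add)
  also have "\<dots> \<le> exp (- (1/1000) * \<theta> * k)"
  proof -
    have "0 \<le> \<theta> * real k" using assms(4) by simp
    then have "51/1000 * t - 6461/100000 * \<theta> * k \<le> - (1/1000) * \<theta> * k" using t by simp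
    then show ?thesis by simp
  qed
  finally show ?thesis .
qed

section \<open>Level tests\<close>

primrec repeatp :: "nat \<Rightarrow> nat prog \<Rightarrow> nat prog" where
  "repeatp 0 p = Ret 0"
| "repeatp (Suc k) p = bindp p (\<lambda>z. bindp (repeatp k p) (\<lambda>s. Ret (z + s)))"

lemma den_repeatp: "den w (repeatp k p) = isum k (den w p)"
  by (induction k) (simp_all add: den_bindp map_pmf_def)

locale level_prog =
  fixes cand :: "'e \<Rightarrow> 'f list" and toks :: "'f \<Rightarrow> 'e list" and qa qb :: "'f \<Rightarrow> nat" and sc :: "'f \<Rightarrow> real"
    and N m :: nat
begin

text \<open>Tokens \<open>e\<close> are tree edges and items \<open>f\<close> are links; \<open>toks f\<close> lists every token with its weight as
  multiplicity, so that a uniform position is a draw by weight. The accumulated coverage at level \<open>j\<close> is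
  \<open>\<sigma> / 2^j\<close>, and the saturation threshold is \<open>1 / (8 m)\<close>.\<close>

definition full :: "nat \<Rightarrow> nat \<Rightarrow> bool" where "full j \<sigma> \<longleftrightarrow> 2 ^ j \<le> 8 * m * \<sigma>"

definition probe :: "(nat \<Rightarrow> 'e \<Rightarrow> bool prog) \<Rightarrow> nat \<Rightarrow> 'f \<Rightarrow> nat prog" where
  "probe al i f = Rnd (length (toks f)) (\<lambda>t. bindp (al i (toks f ! t)) (\<lambda>b. Ret (if b then 1 else 0)))"

text \<open>An estimate of the unsaturated weight under f from m samples. The factor 12/10 lies
  between the values 11/10 and 13/10 at which the outcome is reliable.\<close>

definition check :: "(nat \<Rightarrow> 'e \<Rightarrow> bool prog) \<Rightarrow> nat \<Rightarrow> 'f \<Rightarrow> bool prog" where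
  "check al i f = bindp (repeatp m (probe al i f))
     (\<lambda>s. Ret (12/10 * sc f * real m \<le> real s * real (length (toks f))))"

primrec climb :: "(nat \<Rightarrow> 'e \<Rightarrow> bool prog) \<Rightarrow> nat \<Rightarrow> 'f \<Rightarrow> nat \<Rightarrow> nat \<Rightarrow> nat \<Rightarrow> nat prog" where
  "climb al j f 0 i \<sigma> = Ret \<sigma>"
| "climb al j f (Suc l) i \<sigma> = (if full j \<sigma> then Ret \<sigma>
     else bindp (check al i f) (\<lambda>b. if b then climb al j f l (Suc i) (\<sigma> + 2 ^ i) else Ret \<sigma>))"

text \<open>A round hits a given candidate with probability 1/N; slots past the end of the list are
  blanks that keep this rate the same for all edges. A valid link that passes the levels up to i
  adds 1 + 2 + ... + 2^i. After the 2^j rounds of a full test, \<sigma> / 2^j therefore estimates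
  the coverage from the levels below j.\<close>

primrec loop :: "(nat \<Rightarrow> 'e \<Rightarrow> bool prog) \<Rightarrow> nat \<Rightarrow> 'e \<Rightarrow> nat \<Rightarrow> nat \<Rightarrow> bool prog" where
  "loop al j e 0 \<sigma> = Ret (\<not> full j \<sigma>)"
| "loop al j e (Suc k) \<sigma> = (if full j \<sigma> then Ret False
     else Rnd N (\<lambda>r. if r < length (cand e) then
        (let f = cand e ! r in Qry (qa f) (qb f) (\<lambda>d. if real d \<le> sc f
           then bindp (climb al j f (j - 1) 1 (\<sigma> + 1)) (\<lambda>\<sigma>'. loop al j e k \<sigma>')
           else loop al j e k \<sigma>))
      else loop al j e k \<sigma>))"

text \<open>A test at level \<open>j\<close> refers to tests at all lower levels, hence the table.\<close>

primrec tab :: "nat \<Rightarrow> nat \<Rightarrow> 'e \<Rightarrow> bool prog" where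
  "tab 0 = (\<lambda>i e. Ret True)"
| "tab (Suc j) = (\<lambda>i. if i \<le> j then tab j i
     else (\<lambda>e. bindp (tab j j e) (\<lambda>b. if b then loop (tab j) (Suc j) e (2 ^ Suc j) 0 else Ret False)))"

definition alive :: "nat \<Rightarrow> 'e \<Rightarrow> bool prog" where "alive i = tab i i"

lemma tab_eq_alive: "i \<le> j \<Longrightarrow> tab j i = alive i"
  by (induction j) (auto simp: alive_def le_Suc_eq)

lemma alive_0: "alive 0 e = Ret True"
  by (simp add: alive_def)

lemma climb_cong:
  "(\<And>k. k < i + l \<Longrightarrow> al k = al' k) \<Longrightarrow> climb al j f l i \<sigma> = climb al' j f l i \<sigma>"
proof (induction l arbitrary: i \<sigma>)
  case (Suc l)
  have "check al i f = check al' i f" using Suc.prems by (simp add: check_def probe_def)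
  moreover have "climb al j f l (Suc i) \<sigma>' = climb al' j f l (Suc i) \<sigma>'" for \<sigma>'
    using Suc.prems by (intro Suc.IH) auto
  ultimately show ?case by (simp cong: if_cong)
qed simp

lemma loop_cong:
  "0 < j \<Longrightarrow> (\<And>k. k < j \<Longrightarrow> al k = al' k) \<Longrightarrow> loop al j e k \<sigma> = loop al' j e k \<sigma>"
proof (induction k arbitrary: \<sigma>)
  case (Suc k)
  have "climb al j f (j - 1) 1 \<sigma>' = climb al' j f (j - 1) 1 \<sigma>'" for f \<sigma>'
    using Suc.prems by (intro climb_cong) auto
  then show ?case using Suc by (simp cong: if_cong add: Let_def)
qed simp

lemma alive_Suc:
  "alive (Suc j) e = bindp (alive j e) (\<lambda>b. if b then loop alive (Suc j) e (2 ^ Suc j) 0 else Ret False)"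
proof -
  have "loop (tab j) (Suc j) e (2 ^ Suc j) 0 = loop alive (Suc j) e (2 ^ Suc j) 0"
    by (rule loop_cong) (auto simp: tab_eq_alive)
  then show ?thesis by (simp add: alive_def cong: if_cong)
qed

end

section \<open>Exact law of a level test\<close>

locale level_test = level_prog cand toks qa qb sc N m
  for cand :: "'e \<Rightarrow> 'f list" and toks :: "'f \<Rightarrow> 'e list" and qa qb sc N m +
  fixes w :: "nat \<Rightarrow> nat \<Rightarrow> nat"
  assumes dist_cand: "distinct (cand e)" and len_cand: "length (cand e) \<le> N"
    and toks_ne: "f \<in> set (cand e) \<Longrightarrow> toks f \<noteq> []"
    and N_pos: "N > 0" and m_pos: "m > 0"
begin

abbreviation valid :: "'f \<Rightarrow> bool" where "valid f \<equiv> real (w (qa f) (qb f)) \<le> sc f"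

definition cv :: "'e \<Rightarrow> 'f set" where
  "cv e = {f \<in> set (cand e). valid f}"

definition X :: "nat \<Rightarrow> 'e \<Rightarrow> real" where "X i e = pmf (den w (alive i e)) True"
definition y :: "nat \<Rightarrow> 'f \<Rightarrow> real" where "y i f = pmf (den w (check alive i f)) True"
definition Y :: "nat \<Rightarrow> 'f \<Rightarrow> real" where "Y i f = (\<Prod>l = 1..i. y l f)"
definition q :: "nat \<Rightarrow> 'f \<Rightarrow> real" where
  "q i f = (\<Sum>e\<leftarrow>toks f. X i e) / length (toks f)"

definition a :: "nat \<Rightarrow> 'e \<Rightarrow> real" where "a i e = 2 ^ i / N * (\<Sum>f\<in>cv e. Y i f)"
definition A :: "nat \<Rightarrow> 'e \<Rightarrow> real" where "A j e = (\<Sum>i<j. a i e)"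

text \<open>The increment of a climb without early stopping; unlike \<open>climb\<close>, its law
  does not depend on the coverage collected before.\<close>

primrec incr :: "'f \<Rightarrow> nat \<Rightarrow> nat \<Rightarrow> nat pmf" where
  "incr f 0 i = return_pmf 0"
| "incr f (Suc l) i = bind_pmf (den w (check alive i f))
     (\<lambda>b. if b then map_pmf (\<lambda>z. 2 ^ i + z) (incr f l (Suc i)) else return_pmf 0)"

definition draw :: "nat \<Rightarrow> 'e \<Rightarrow> nat pmf" where
  "draw j e = bind_pmf (pmf_of_set {..<N}) (\<lambda>r. if r < length (cand e) \<and> valid (cand e ! r)
      then map_pmf Suc (incr (cand e ! r) (j - 1) 1) else return_pmf 0)"

definition x :: "nat \<Rightarrow> 'e \<Rightarrow> real" where
  "x j e = measure_pmf.prob (isum (2 ^ j) (draw j e)) {s. \<not> full j s}"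

lemma full_mono: "full j \<sigma> \<Longrightarrow> \<sigma> \<le> \<sigma>' \<Longrightarrow> full j \<sigma>'"
  unfolding full_def by (meson le_trans mult_le_mono2)

text \<open>Stopping early does not change the outcome, because the accumulated coverage only grows.\<close>

lemma climb_incr:
  assumes "\<And>\<sigma>. full j \<sigma> \<Longrightarrow> g \<sigma> = c"
  shows "bind_pmf (den w (climb alive j f l i \<sigma>)) g = bind_pmf (incr f l i) (\<lambda>z. g (\<sigma> + z))"
proof (induction l arbitrary: i \<sigma>)
  case 0
  then show ?case by (simp add: bind_return_pmf)
next
  case (Suc l)
  show ?case
  proof (cases "full j \<sigma>")
    case True
    then have "g (\<sigma> + z) = c" for z using assms full_mono by (metis le_add1)
    then show ?thesis using True assms by (simp add: bind_return_pmf bind_pmf_const)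
  next
    case False
    have e: "bind_pmf (den w (if b then climb alive j f l (Suc i) (\<sigma> + 2 ^ i) else Ret \<sigma>)) g =
       bind_pmf (if b then map_pmf (\<lambda>z. 2 ^ i + z) (incr f l (Suc i)) else return_pmf 0) (\<lambda>z. g (\<sigma> + z))" for b
      using Suc.IH[of "Suc i" "\<sigma> + 2 ^ i"] by (cases b) (simp_all add: bind_return_pmf bind_map_pmf add.assoc)
    show ?thesis using False by (simp add: den_bindp bind_assoc_pmf e cong: if_cong)
  qed
qed

lemma den_loop:
  "den w (loop alive j e k \<sigma>) = map_pmf (\<lambda>s. \<not> full j (\<sigma> + s)) (isum k (draw j e))"
proof (induction k arbitrary: \<sigma>)
  case (Suc k)
  show ?case
  proof (cases "full j \<sigma>")
    case True
    then have "full j (\<sigma> + s)" for s using full_mono by (metis le_add1)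
    then show ?thesis using True by simp
  next
    case False
    let ?v = "\<lambda>r. r < length (cand e) \<and> valid (cand e ! r)"
    let ?g = "\<lambda>\<sigma>. map_pmf (\<lambda>s. \<not> full j (\<sigma> + s)) (isum k (draw j e))"
    have g: "?g \<sigma> = return_pmf False" if "full j \<sigma>" for \<sigma>
    proof -
      have "full j (\<sigma> + s)" for s using full_mono that by (metis le_add1)
      then show ?thesis by simp
    qed
    have "den w (loop alive j e (Suc k) \<sigma>) = bind_pmf (pmf_of_set {..<N}) (\<lambda>r. if ?v r
       then bind_pmf (den w (climb alive j (cand e ! r) (j - 1) 1 (\<sigma> + 1))) ?g else ?g \<sigma>)"
      using False by (auto simp: Let_def den_bindp Suc intro!: bind_pmf_cong)
    also have "\<dots> = bind_pmf (pmf_of_set {..<N}) (\<lambda>r. if ?v r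
       then bind_pmf (incr (cand e ! r) (j - 1) 1) (\<lambda>z. ?g (\<sigma> + 1 + z)) else ?g \<sigma>)"
      by (subst climb_incr[OF g]) auto
    also have "\<dots> = bind_pmf (draw j e) (\<lambda>z. ?g (\<sigma> + z))"
      unfolding draw_def bind_assoc_pmf
      by (intro bind_pmf_cong refl) (auto simp: bind_map_pmf bind_return_pmf)
    also have "\<dots> = map_pmf (\<lambda>s. \<not> full j (\<sigma> + s)) (isum (Suc k) (draw j e))"
      by (simp add: map_bind_pmf pmf.map_comp o_def add.assoc)
    finally show ?thesis .
  qed
qed simp

lemma X_0: "X 0 e = 1"
  by (simp add: X_def alive_0)

text \<open>The level below is rerun with fresh randomness, so the two outcomes are independent and
  survival multiplies.\<close>

lemma X_Suc: "X (Suc j) e = X j e * x (Suc j) e"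
proof -
  let ?S = "isum (2 ^ Suc j) (draw (Suc j) e)"
  have t: "pmf (map_pmf (\<lambda>s. \<not> full (Suc j) s) ?S) True = x (Suc j) e"
    by (simp only: x_def pmf_map vimage_def) (simp del: isum.simps)
  have "den w (alive (Suc j) e) = bind_pmf (den w (alive j e))
     (\<lambda>b. if b then map_pmf (\<lambda>s. \<not> full (Suc j) s) ?S else return_pmf False)"
    unfolding alive_Suc den_bindp
    by (intro bind_pmf_cong refl) (simp only: den_loop den.simps add_0 split: if_split, simp)
  then have "X (Suc j) e = ex_pmf (den w (alive j e)) (\<lambda>b. if b then x (Suc j) e else 0)"
    unfolding X_def by (simp only: pmf_bind) (intro ex_pmf_cong, simp add: t del: power_Suc isum.simps)
  also have "\<dots> = X j e * x (Suc j) e"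
    by (simp add: X_def integral_measure_pmf[where A = UNIV] UNIV_bool)
  finally show ?thesis .
qed

lemma x_bounds: "0 \<le> x j e" "x j e \<le> 1"
  by (auto simp: x_def)

lemma y_bounds: "0 \<le> y j e" "y j e \<le> 1"
  by (auto simp: y_def pmf_le_1)

lemma X_bounds: "0 \<le> X j e" "X j e \<le> 1"
  by (auto simp: X_def pmf_le_1)

lemma X_antimono: "i \<le> j \<Longrightarrow> X j e \<le> X i e"
proof (induction j)
  case (Suc j)
  have "X (Suc j) e \<le> X j e" using X_Suc[of j e] X_bounds x_bounds by (simp add: mult_left_le)
  then show ?case using Suc by (cases "i = Suc j") auto
qed simp

lemma Y_bounds: "0 \<le> Y j f" "Y j f \<le> 1"
  unfolding Y_def by (auto intro!: prod_nonneg prod_le_1 simp: y_bounds)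

lemma Y_Suc: "Y (Suc j) f = Y j f * y (Suc j) f"
  by (simp add: Y_def mult.commute)

lemma Y_0: "Y 0 f = 1" by (simp add: Y_def)

lemma a_nonneg: "0 \<le> a i e"
  unfolding a_def by (intro mult_nonneg_nonneg sum_nonneg) (auto simp: Y_bounds)

lemma a_Suc: "a (Suc i) e \<le> 2 * a i e"
proof -
  have "(\<Sum>f\<in>cv e. Y (Suc i) f) \<le> (\<Sum>f\<in>cv e. Y i f)"
    by (intro sum_mono) (simp add: Y_Suc mult_left_le Y_bounds y_bounds)
  then show ?thesis unfolding a_def by (simp add: divide_simps mult_left_mono)
qed

lemma finite_cv: "finite (cv e)" by (simp add: cv_def)

lemma a_0: "a 0 e \<le> 1"
proof -
  have "card (cv e) \<le> card (set (cand e))" by (intro card_mono) (auto simp: cv_def)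
  also have "\<dots> \<le> N" using len_cand card_length le_trans by blast
  finally show ?thesis using N_pos by (simp add: a_def Y_0)
qed

section \<open>First and second moments of a single draw\<close>

lemma finite_incr: "finite (set_pmf (incr f l i))"
  by (induction l arbitrary: i) auto

lemma finite_draw: "finite (set_pmf (draw j e))"
  using N_pos by (auto simp: draw_def finite_incr set_pmf_of_set lessThan_empty_iff)

lemma incr_le: "z \<in> set_pmf (incr f l i) \<Longrightarrow> 2 ^ i + z \<le> 2 ^ (i + l)"
proof (induction l arbitrary: i z)
  case (Suc l)
  then consider "z = 0" | z' where "z = 2 ^ i + z'" "z' \<in> set_pmf (incr f l (Suc i))"
    by (auto split: if_splits)
  then show ?case
  proof cases
    case 1
    then show ?thesis by (simp add: power_increasing del: power_Suc)
  next
    case 2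
    then show ?thesis using Suc.IH[of z' "Suc i"] by simp
  qed
qed simp

lemma ex_check: "ex_pmf (den w (check alive i f)) g = y i f * g True + (1 - y i f) * g False"
proof -
  have "y i f + pmf (den w (check alive i f)) False = 1"
    using sum_pmf_eq_1[OF finite subset_UNIV, of "den w (check alive i f)"] by (simp add: UNIV_bool y_def)
  then have "pmf (den w (check alive i f)) False = 1 - y i f" by simp
  then show ?thesis
    by (simp add: integral_measure_pmf[where A = UNIV] UNIV_bool y_def)
qed

lemma ex_incr: "ex_pmf (incr f l i) real = (\<Sum>k<l. 2 ^ (i + k) * (\<Prod>l' = i..i + k. y l' f))"
proof (induction l arbitrary: i)
  case (Suc l)
  have int: "integrable (measure_pmf (incr f l (Suc i))) g" for g :: "nat \<Rightarrow> real"
    by (rule integrable_measure_pmf_finite[OF finite_incr])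
  have "ex_pmf (incr f (Suc l) i) real = y i f * (2 ^ i + ex_pmf (incr f l (Suc i)) real)"
    by (simp add: ex_pmf_bind finite_incr ex_check int)
  also have "\<dots> = y i f * 2 ^ i + (\<Sum>k<l. 2 ^ (i + Suc k) * (y i f * (\<Prod>l' = Suc i..i + Suc k. y l' f)))"
    by (simp add: Suc algebra_simps sum_distrib_left)
  also have "\<dots> = y i f * 2 ^ i + (\<Sum>k<l. 2 ^ (i + Suc k) * (\<Prod>l' = i..i + Suc k. y l' f))"
    by (intro arg_cong2[where f = "(+)"] sum.cong refl arg_cong2[where f = "(*)"] prod.atLeast_Suc_atMost[symmetric]) auto
  finally show ?case by (subst sum.lessThan_Suc_shift) simp
qed simp

text \<open>A climb that arrives at level i has collected 1 + 2 + ... + 2^(i - 1) = 2^i - 1 before.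
  Squaring the whole sum makes the statement inductive: passing level i merely replaces this offset
  by 2^(i + 1) - 1.\<close>

lemma ex_incr_square:
  "i > 0 \<Longrightarrow> ex_pmf (incr f l i) (\<lambda>z. (2 ^ i - 1 + real z) ^ 2) \<le> 4 ^ i + (\<Sum>k<l. 4 * 4 ^ (i + k) * (\<Prod>l' = i..i + k. y l' f))"
proof (induction l arbitrary: i)
  case 0
  have "((2::real) ^ i - 1) ^ 2 \<le> (2 ^ i) ^ 2" by (intro power_mono) auto
  also have "\<dots> = 4 ^ i" by (simp add: power2_eq_square flip: power_mult_distrib)
  finally show ?case by simp
next
  case (Suc l)
  have sq: "((2::real) ^ i - 1) ^ 2 \<le> 4 ^ i"
  proof -
    have "((2::real) ^ i - 1) ^ 2 \<le> (2 ^ i) ^ 2" by (intro power_mono) auto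
    also have "\<dots> = 4 ^ i" by (simp add: power2_eq_square flip: power_mult_distrib)
    finally show ?thesis .
  qed
  have "ex_pmf (incr f (Suc l) i) (\<lambda>z. (2 ^ i - 1 + real z) ^ 2)
     = y i f * ex_pmf (incr f l (Suc i)) (\<lambda>z. (2 ^ Suc i - 1 + real z) ^ 2) + (1 - y i f) * (2 ^ i - 1) ^ 2"
    by (simp add: ex_pmf_bind finite_incr ex_check algebra_simps)
  also have "\<dots> \<le> y i f * (4 ^ Suc i + (\<Sum>k<l. 4 * 4 ^ (Suc i + k) * (\<Prod>l' = Suc i..Suc i + k. y l' f))) + 1 * 4 ^ i"
    using y_bounds[of i f] sq by (intro add_mono mult_left_mono mult_mono Suc.IH) auto
  also have "\<dots> = 4 ^ i + y i f * 4 ^ Suc i + (\<Sum>k<l. 4 * 4 ^ (i + Suc k) * (y i f * (\<Prod>l' = Suc i..i + Suc k. y l' f)))"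
    by (simp add: algebra_simps sum_distrib_left)
  also have "\<dots> = 4 ^ i + (4 * 4 ^ i * y i f + (\<Sum>k<l. 4 * 4 ^ (i + Suc k) * (\<Prod>l' = i..i + Suc k. y l' f)))"
  proof -
    have "(\<Prod>l' = i..i + Suc k. y l' f) = y i f * (\<Prod>l' = Suc i..i + Suc k. y l' f)" for k
      by (rule prod.atLeast_Suc_atMost) auto
    then show ?thesis by (simp only: power_Suc mult_ac add_ac)
  qed
  finally show ?case by (subst sum.lessThan_Suc_shift) simp
qed

lemma ex_draw:
  fixes g :: "nat \<Rightarrow> real"
  shows "ex_pmf (draw j e) g = ((\<Sum>f\<in>cv e. ex_pmf (incr f (j - 1) 1) (\<lambda>z. g (Suc z))) + (N - card (cv e)) * g 0) / N"
proof -
  let ?h = "\<lambda>f. if valid f then ex_pmf (incr f (j - 1) 1) (\<lambda>z. g (Suc z)) else g 0"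
  have ne: "{..<N} \<noteq> {}" using N_pos by (auto simp: lessThan_empty_iff)
  have "ex_pmf (draw j e) g = (\<Sum>r<N. if r < length (cand e) then ?h (cand e ! r) else g 0) / N"
  proof -
    let ?v = "\<lambda>r. r < length (cand e) \<and> valid (cand e ! r)"
    let ?p = "\<lambda>r. if ?v r then map_pmf Suc (incr (cand e ! r) (j - 1) 1) else return_pmf 0"
    have "ex_pmf (draw j e) g = ex_pmf (pmf_of_set {..<N}) (\<lambda>r. ex_pmf (?p r) g)"
      unfolding draw_def by (rule ex_pmf_bind) (use ne in \<open>simp_all add: finite_incr\<close>)
    also have "\<dots> = (\<Sum>r<N. ex_pmf (?p r) g) / N"
      by (subst integral_pmf_of_set[OF ne]) simp_all
    also have "(\<Sum>r<N. ex_pmf (?p r) g) = (\<Sum>r<N. if r < length (cand e) then ?h (cand e ! r) else g 0)"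
      by (intro sum.cong refl) simp
    finally show ?thesis .
  qed
  also have "(\<Sum>r<N. if r < length (cand e) then ?h (cand e ! r) else g 0)
     = (\<Sum>r<length (cand e). ?h (cand e ! r)) + (N - length (cand e)) * g 0"
  proof -
    have U: "{..<N} = {..<length (cand e)} \<union> {length (cand e)..<N}" using len_cand[of e] by auto
    have "(\<Sum>r<N. if r < length (cand e) then ?h (cand e ! r) else g 0) =
      (\<Sum>r<length (cand e). if r < length (cand e) then ?h (cand e ! r) else g 0)
      + (\<Sum>r\<in>{length (cand e)..<N}. if r < length (cand e) then ?h (cand e ! r) else g 0)"
      unfolding U by (rule sum.union_disjoint) auto
    then show ?thesis by simp
  qed
  also have "(\<Sum>r<length (cand e). ?h (cand e ! r)) = (\<Sum>f\<in>set (cand e). ?h f)"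
    using sum_list_sum_nth[of "map ?h (cand e)"] sum_list_distinct_conv_sum_set[OF dist_cand, of ?h e]
    by (simp add: atLeast0LessThan)
  also have "\<dots> = (\<Sum>f\<in>cv e. ex_pmf (incr f (j - 1) 1) (\<lambda>z. g (Suc z))) + card (set (cand e) - cv e) * g 0"
  proof -
    have "(\<Sum>f\<in>set (cand e). ?h f) = (\<Sum>f\<in>set (cand e) - cv e. ?h f) + (\<Sum>f\<in>cv e. ?h f)"
      by (rule sum.subset_diff) (auto simp: cv_def)
    moreover have "(\<Sum>f\<in>set (cand e) - cv e. ?h f) = (\<Sum>f\<in>set (cand e) - cv e. g 0)"
      by (rule sum.cong) (auto simp: cv_def)
    moreover have "(\<Sum>f\<in>cv e. ?h f) = (\<Sum>f\<in>cv e. ex_pmf (incr f (j - 1) 1) (\<lambda>z. g (Suc z)))"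
      by (rule sum.cong) (auto simp: cv_def)
    ultimately show ?thesis by (simp add: add.commute)
  qed
  finally have *: "ex_pmf (draw j e) g = ((\<Sum>f\<in>cv e. ex_pmf (incr f (j - 1) 1) (\<lambda>z. g (Suc z)))
      + card (set (cand e) - cv e) * g 0 + (N - length (cand e)) * g 0) / N" .
  have "card (set (cand e) - cv e) = length (cand e) - card (cv e)"
    by (subst card_Diff_subset) (auto simp: cv_def distinct_card[OF dist_cand])
  moreover have "card (cv e) \<le> length (cand e)"
    using card_mono[of "set (cand e)" "cv e"] by (auto simp: cv_def distinct_card[OF dist_cand])
  ultimately have "real (card (set (cand e) - cv e)) + real (N - length (cand e)) = real (N - card (cv e))"
    using len_cand[of e] by simp
  then have "card (set (cand e) - cv e) * g 0 + (N - length (cand e)) * g 0 = (N - card (cv e)) * g 0"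
    by (simp only: flip: distrib_right)
  then show ?thesis using * by (simp only: add.assoc)
qed

lemma ex_draw_real: "ex_pmf (draw (Suc l) e) real = A (Suc l) e"
proof -
  have int: "integrable (measure_pmf (incr f l 1)) g" for f and g :: "nat \<Rightarrow> real"
    by (rule integrable_measure_pmf_finite[OF finite_incr])
  have "ex_pmf (incr f l 1) (\<lambda>z. real (Suc z)) = (\<Sum>i<Suc l. 2 ^ i * Y i f)" for f
  proof -
    have "ex_pmf (incr f l 1) (\<lambda>z. real (Suc z)) = 1 + ex_pmf (incr f l 1) real"
      using int by simp
    then show ?thesis by (subst sum.lessThan_Suc_shift) (simp add: ex_incr Y_def)
  qed
  then show ?thesis
    unfolding ex_draw A_def a_def
    by (simp del: sum.lessThan_Suc add: sum_distrib_left sum_divide_distrib) (subst sum.swap, simp)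
qed

lemma ex_draw_square: "ex_pmf (draw (Suc l) e) (\<lambda>z. real z ^ 2) \<le> 4 * (\<Sum>i<Suc l. 2 ^ i * a i e)"
proof -
  have sq: "ex_pmf (incr f l 1) (\<lambda>z. real (Suc z) ^ 2) \<le> (\<Sum>i<Suc l. 4 * 4 ^ i * Y i f)" for f
    using ex_incr_square[of 1 f l] by (subst sum.lessThan_Suc_shift) (simp add: Y_def algebra_simps)
  have "ex_pmf (draw (Suc l) e) (\<lambda>z. real z ^ 2) = (\<Sum>f\<in>cv e. ex_pmf (incr f l 1) (\<lambda>z. real (Suc z) ^ 2)) / N"
    by (subst ex_draw) simp
  also have "\<dots> \<le> (\<Sum>f\<in>cv e. \<Sum>i<Suc l. 4 * 4 ^ i * Y i f) / N"
    by (intro divide_right_mono sum_mono sq) simp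
  also have "\<dots> = 4 * (\<Sum>i<Suc l. 2 ^ i * a i e)"
  proof -
    have "(4::real) ^ i = 2 ^ i * 2 ^ i" for i by (simp flip: power_mult_distrib)
    then show ?thesis unfolding a_def
      by (subst sum.swap) (simp add: sum_distrib_left sum_divide_distrib mult_ac del: sum.lessThan_Suc)
  qed
  finally show ?thesis .
qed

lemma draw_le: "z \<in> set_pmf (draw (Suc l) e) \<Longrightarrow> z \<le> 2 ^ Suc l"
proof -
  assume "z \<in> set_pmf (draw (Suc l) e)"
  then have "z = 0 \<or> (\<exists>f z'. z = Suc z' \<and> z' \<in> set_pmf (incr f l 1))"
    by (auto simp: draw_def split: if_splits)
  then show ?thesis using incr_le[of _ _ l 1] by fastforce
qed

section \<open>Tail bounds for survival and for checks\<close>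

lemma not_full_iff: "\<not> full j s \<longleftrightarrow> real s < 2 ^ j / (8 * m)"
proof -
  have "\<not> full j s \<longleftrightarrow> real (8 * m * s) < real (2 ^ j)" unfolding full_def by (simp only: of_nat_less_iff not_le)
  then show ?thesis using m_pos by (simp add: field_simps)
qed

text \<open>One draw adds at most 2^(l + 1). In this unit the threshold is 1/(8 m) <= 1 and the
  expected sum of all draws is \<open>A (Suc l) e\<close>.\<close>

lemma x_upper: "x (Suc l) e \<le> exp (1 - 6 / 10 * A (Suc l) e)"
proof -
  have "x (Suc l) e \<le> exp ((2 ^ Suc l / (8 * m)) / 2 ^ Suc l - 6 / 10 * (real (2 ^ Suc l) * ex_pmf (draw (Suc l) e) real / 2 ^ Suc l))"
    unfolding x_def not_full_iff
    by (rule isum_lower_tail) (auto simp: finite_draw dest: draw_le simp del: power_Suc isum.simps)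
  also have "\<dots> \<le> exp (1 - 6 / 10 * A (Suc l) e)"
    using m_pos by (simp add: ex_draw_real)
  finally show ?thesis .
qed

text \<open>Chebyshev applies because the mean is at most half the threshold. Level i enters with
  the factor 2^i / 2^(l + 1): coverage from an early level consists of many small increments and
  rarely fluctuates up to the threshold. This geometric discount makes the failures of all levels
  summable.\<close>

lemma x_lower:
  assumes "A (Suc l) e \<le> 1 / (16 * real m)"
  shows "1 - x (Suc l) e \<le> 16 * (8 * real m) ^ 2 * (\<Sum>i<Suc l. 2 ^ i * a i e) / 2 ^ Suc l"
proof -
  let ?S = "isum (2 ^ Suc l) (draw (Suc l) e)"
  have "1 - x (Suc l) e = measure_pmf.prob ?S (UNIV - {s. \<not> full (Suc l) s})"
    unfolding x_def by (subst measure_pmf.prob_compl[symmetric]) auto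
  also have "UNIV - {s. \<not> full (Suc l) s} = {s. 2 ^ Suc l / (8 * m) \<le> real s}"
    by (auto simp: not_full_iff simp del: power_Suc)
  also have "measure_pmf.prob ?S \<dots> \<le> 4 * (2 ^ Suc l) * ex_pmf (draw (Suc l) e) (\<lambda>z. real z ^ 2) / (2 ^ Suc l / (8 * m)) ^ 2"
    using isum_chebyshev[OF finite_draw, of "2 ^ Suc l / (8 * m)" "2 ^ Suc l" "Suc l" e] assms m_pos
    by (simp add: ex_draw_real field_simps del: isum.simps)
  also have "\<dots> \<le> 4 * (2 ^ Suc l) * (4 * (\<Sum>i<Suc l. 2 ^ i * a i e)) / (2 ^ Suc l / (8 * m)) ^ 2"
    by (intro divide_right_mono mult_left_mono ex_draw_square) auto
  also have "\<dots> = 16 * (8 * real m) ^ 2 * (\<Sum>i<Suc l. 2 ^ i * a i e) / 2 ^ Suc l"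
    using m_pos by (simp add: field_simps power2_eq_square del: sum.lessThan_Suc)
  finally show ?thesis .
qed

lemma probe_bernoulli:
  assumes "toks f \<noteq> []"
  shows "set_pmf (den w (probe alive i f)) \<subseteq> {0, 1}" "pmf (den w (probe alive i f)) 1 = q i f"
proof -
  have ne: "{..<length (toks f)} \<noteq> {}" using assms by (auto simp: lessThan_empty_iff)
  have d: "den w (probe alive i f) = bind_pmf (pmf_of_set {..<length (toks f)})
    (\<lambda>t. map_pmf (\<lambda>b. if b then 1 else 0) (den w (alive i (toks f ! t))))"
    by (auto simp: probe_def den_bindp map_pmf_def if_distrib[where f = "\<lambda>p. den w p"] if_distrib[where f = return_pmf] intro!: bind_pmf_cong)
  show "set_pmf (den w (probe alive i f)) \<subseteq> {0, 1}" unfolding d by auto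
  have v: "(\<lambda>b. if b then 1 else 0) -` {1::nat} = {True}" by (auto split: if_splits)
  have "pmf (den w (probe alive i f)) 1 = (\<Sum>t<length (toks f). X i (toks f ! t)) / length (toks f)"
    unfolding d by (simp only: pmf_bind pmf_map v) (simp add: integral_pmf_of_set ne X_def measure_pmf_single)
  also have "(\<Sum>t<length (toks f). X i (toks f ! t)) = (\<Sum>e\<leftarrow>toks f. X i e)"
    by (simp add: sum_list_sum_nth atLeast0LessThan)
  finally show "pmf (den w (probe alive i f)) 1 = q i f" by (simp add: q_def)
qed

lemma y_eq: "toks f \<noteq> [] \<Longrightarrow> y i f = measure_pmf.prob (isum m (den w (probe alive i f)))
   {s. 12/10 * (sc f / length (toks f)) * m \<le> real s}"
proof -
  assume "toks f \<noteq> []"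
  then have "real (length (toks f)) > 0" by simp
  then have v: "(\<lambda>s. 12/10 * sc f * real m \<le> real s * real (length (toks f))) -` {True} = {s. 12/10 * (sc f / length (toks f)) * m \<le> real s}"
    by (auto simp: field_simps)
  have "den w (check alive i f) = map_pmf (\<lambda>s. 12/10 * sc f * real m \<le> real s * real (length (toks f))) (isum m (den w (probe alive i f)))"
    by (simp add: check_def den_bindp den_repeatp map_pmf_def)
  then show ?thesis unfolding y_def by (simp only: pmf_map v)
qed

lemma y_upper:
  assumes "toks f \<noteq> []" "q i f * length (toks f) \<le> 11/10 * sc f" "sc f \<ge> 0"
  shows "y i f \<le> exp (- (1/1000) * (sc f / length (toks f)) * m)"
  unfolding y_eq[OF assms(1)]
  using assms probe_bernoulli[OF assms(1), of i] by (intro isum_bernoulli_upper) (auto simp: field_simps)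

lemma y_lower:
  assumes "toks f \<noteq> []" "q i f * length (toks f) \<ge> 13/10 * sc f" "sc f \<ge> 0"
  shows "1 - y i f \<le> exp (- (1/1000) * (sc f / length (toks f)) * m)"
proof -
  let ?S = "isum m (den w (probe alive i f))"
  have "1 - y i f = measure_pmf.prob ?S (UNIV - {s. 12/10 * (sc f / length (toks f)) * m \<le> real s})"
    unfolding y_eq[OF assms(1)] by (subst measure_pmf.prob_compl[symmetric]) auto
  also have "UNIV - {s. 12/10 * (sc f / length (toks f)) * m \<le> real s} = {s. real s < 12/10 * (sc f / length (toks f)) * m}"
    by auto
  also have "measure_pmf.prob ?S \<dots> \<le> exp (- (1/1000) * (sc f / length (toks f)) * m)"
    using assms probe_bernoulli[OF assms(1), of i] by (intro isum_bernoulli_lower) (auto simp: field_simps)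
  finally show ?thesis .
qed

end

section \<open>Query cost and load of the level tests\<close>

text \<open>Quantifying over the remaining budget b makes costs additive under
  \<open>bindp\<close>.\<close>

definition costs :: "nat \<Rightarrow> (nat \<Rightarrow> nat \<Rightarrow> nat) \<Rightarrow> 'a prog \<Rightarrow> nat \<Rightarrow> bool" where
  "costs B w p c \<longleftrightarrow> (\<forall>b. wp B w p (\<lambda>_ b'. b \<le> b') (b + c))"

lemma wp_costs:
  assumes "costs B w p c" "c \<le> b1" "\<And>x b'. b1 - c \<le> b' \<Longrightarrow> P x b'"
  shows "wp B w p P b1"
proof -
  have "wp B w p (\<lambda>_ b'. b1 - c \<le> b') (b1 - c + c)" using assms(1) by (simp add: costs_def)
  from wp_mono[OF this, of P 0] show ?thesis using assms(2,3) by simp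
qed

lemma costs_bind:
  assumes "costs B w p c" "\<And>x. costs B w (g x) d"
  shows "costs B w (bindp p g) (c + d)"
  unfolding costs_def wp_bindp
proof
  fix b
  show "wp B w p (\<lambda>x. wp B w (g x) (\<lambda>_ b'. b \<le> b')) (b + (c + d))"
    by (rule wp_costs[OF assms(1)], simp, rule wp_costs[OF assms(2)], auto)
qed

lemma costs_Ret: "costs B w (Ret x) 0"
  by (simp add: costs_def)

lemma costs_Rnd:
  assumes "\<And>r. r < k \<Longrightarrow> costs B w (g r) c" "k \<in> {1..B}"
  shows "costs B w (Rnd k g) (Suc c)"
  using assms by (simp add: costs_def)

lemma costs_repeatp: "costs B w p c \<Longrightarrow> costs B w (repeatp k p) (k * c)"
proof (induction k)
  case (Suc k)
  have "costs B w (bindp p (\<lambda>z. bindp (repeatp k p) (\<lambda>s. Ret (z + s)))) (c + (k * c + 0))"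
    using Suc by (intro costs_bind costs_Ret) auto
  then show ?case by simp
qed (simp add: costs_Ret)

context level_test begin

lemma climb_full: "full j \<sigma> \<Longrightarrow> climb alive j f l i \<sigma> = Ret \<sigma>"
  by (cases l) auto

lemma costs_check:
  assumes al: "\<And>e. costs B w (alive i e) (8 * (2 ^ i - 1))" and f: "toks f \<noteq> []" "length (toks f) \<le> B"
  shows "costs B w (check alive i f) (m * (8 * 2 ^ i))"
proof -
  have "costs B w (probe alive i f) (Suc (8 * (2 ^ i - 1) + 0))"
    unfolding probe_def using f by (intro costs_Rnd costs_bind al costs_Ret) (auto simp: Suc_le_eq)
  then have "costs B w (bindp (repeatp m (probe alive i f)) (\<lambda>s. Ret (12/10 * sc f * real m \<le> real s * real (length (toks f)))))
      (m * Suc (8 * (2 ^ i - 1) + 0) + 0)"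
    by (intro costs_bind costs_repeatp costs_Ret)
  then have "costs B w (check alive i f) (m * Suc (8 * (2 ^ i - 1)))" by (simp add: check_def)
  moreover have "m * Suc (8 * (2 ^ i - 1)) \<le> m * (8 * 2 ^ i)"
    by (intro mult_le_mono2) (simp add: Suc_le_eq diff_mult_distrib2)
  ultimately show ?thesis unfolding costs_def[of B w _ "m * (8 * 2 ^ i)"]
    by (auto intro!: wp_costs)
qed

text \<open>Each unit of \<open>\<sigma>\<close> carries a potential of \<open>16 m\<close>: reaching level \<open>i\<close> has added \<open>2^(i-1)\<close> to \<open>\<sigma>\<close>, which
  pays for the check at level \<open>i\<close>.\<close>

lemma wp_climb:
  assumes al: "\<And>k e. k < i + l \<Longrightarrow> costs B w (alive k e) (8 * (2 ^ k - 1))"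
    and f: "toks f \<noteq> []" "length (toks f) \<le> B" and i: "0 < i"
    and nf: "\<not> full j \<sigma>"
    and b1: "b + 2 * (2 ^ j - 8 * m * \<sigma>) + 8 * m * 2 ^ i \<le> b1"
  shows "wp B w (climb alive j f l i \<sigma>) (\<lambda>\<sigma>' b'. b + 2 * (2 ^ j - 8 * m * \<sigma>') \<le> b') b1"
  using al i nf b1
proof (induction l arbitrary: i \<sigma> b1)
  case 0
  then show ?case by simp
next
  case (Suc l)
  have c: "costs B w (check alive i f) (m * (8 * 2 ^ i))"
    using Suc.prems f by (intro costs_check) auto
  have "wp B w (check alive i f) (\<lambda>b'a. wp B w (if b'a then climb alive j f l (Suc i) (\<sigma> + 2 ^ i) else Ret \<sigma>)
     (\<lambda>\<sigma>' b'. b + 2 * (2 ^ j - 8 * m * \<sigma>') \<le> b')) b1"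
  proof (rule wp_costs[OF c])
    show "m * (8 * 2 ^ i) \<le> b1" using Suc.prems(4) by simp
  next
    fix bb b'
    assume "b1 - m * (8 * 2 ^ i) \<le> b'"
    then have b': "b + 2 * (2 ^ j - 8 * m * \<sigma>) \<le> b'" using Suc.prems(4) by simp
    show "wp B w (if bb then climb alive j f l (Suc i) (\<sigma> + 2 ^ i) else Ret \<sigma>) (\<lambda>\<sigma>' b'. b + 2 * (2 ^ j - 8 * m * \<sigma>') \<le> b') b'"
    proof (cases "bb \<and> \<not> full j (\<sigma> + 2 ^ i)")
      case True
      then have "8 * m * (\<sigma> + 2 ^ i) < 2 ^ j" by (simp add: full_def)
      then have "b + 2 * (2 ^ j - 8 * m * (\<sigma> + 2 ^ i)) + 8 * m * 2 ^ Suc i \<le> b'" using b' by (simp add: algebra_simps)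
      then show ?thesis using True Suc.prems by (simp, intro Suc.IH) auto
    next
      case False
      then show ?thesis using b' by (auto simp: climb_full full_def)
    qed
  qed
  then show ?case using Suc.prems by (simp add: wp_bindp)
qed

text \<open>A round itself pays at most two units, for its draw and its query; climbs are paid by
  the decrease of the potential \<open>2 * (2 ^ j - 8 * m * \<sigma>)\<close>.\<close>

lemma wp_loop:
  assumes al: "\<And>k e. k < j \<Longrightarrow> costs B w (alive k e) (8 * (2 ^ k - 1))" and j: "0 < j"
    and B: "\<And>f. f \<in> set (cand e) \<Longrightarrow> length (toks f) \<le> B" "N \<le> B"
  shows "b + 2 * k + 2 * (2 ^ j - 8 * m * \<sigma>) \<le> b1 \<Longrightarrow> wp B w (loop alive j e k \<sigma>) (\<lambda>_ b'. b \<le> b') b1"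
proof (induction k arbitrary: \<sigma> b1)
  case (Suc k)
  show ?case
  proof (cases "full j \<sigma>")
    case False
    then have nf: "8 * m * \<sigma> < 2 ^ j" by (simp add: full_def)
    have 1: "wp B w (loop alive j e k \<sigma>) (\<lambda>_ b'. b \<le> b') (b1 - Suc 0)"
      using Suc.prems by (intro Suc.IH) simp
    have 2: "wp B w (loop alive j e k \<sigma>) (\<lambda>_ b'. b \<le> b') (b1 - Suc 0 - Suc 0)"
      using Suc.prems by (intro Suc.IH) simp
    have 3: "wp B w (climb alive j f (j - Suc 0) (Suc 0) (Suc \<sigma>))
        (\<lambda>\<sigma>'. wp B w (loop alive j e k \<sigma>') (\<lambda>_ b'. b \<le> b')) (b1 - Suc 0 - Suc 0)"
      if f: "f \<in> set (cand e)" for f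
    proof (cases "full j (Suc \<sigma>)")
      case True
      then have "wp B w (loop alive j e k (Suc \<sigma>)) (\<lambda>_ b'. b \<le> b') (b1 - Suc 0 - Suc 0)"
        using Suc.prems by (intro Suc.IH) (simp add: full_def)
      then show ?thesis using True by (simp add: climb_full)
    next
      case nf2: False
      have "wp B w (climb alive j f (j - Suc 0) (Suc 0) (Suc \<sigma>))
         (\<lambda>\<sigma>' b'. (b + 2 * k) + 2 * (2 ^ j - 8 * m * \<sigma>') \<le> b') (b1 - Suc 0 - Suc 0)"
      proof (rule wp_climb)
        show "costs B w (alive k e) (8 * (2 ^ k - 1))" if "k < Suc 0 + (j - Suc 0)" for k e
          using that j by (intro al) auto
        \<comment> \<open>Raising \<sigma> by one frees 16 m units, exactly what
          \<open>wp_climb\<close> reserves for the check at level 1.\<close>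
        show "b + 2 * k + 2 * (2 ^ j - 8 * m * Suc \<sigma>) + 8 * m * 2 ^ Suc 0 \<le> b1 - Suc 0 - Suc 0"
          using nf2 Suc.prems by (simp add: full_def algebra_simps)
      qed (use f nf2 toks_ne B in auto)
      from wp_mono[OF this, where d = 0] show ?thesis
        by (rule iffD1[OF arg_cong[where f = "wp B w _ _"], rotated]) (auto intro: Suc.IH)
    qed
    show ?thesis using False N_pos B(2) Suc.prems 1 2 3 by (auto simp: wp_bindp Let_def)
  qed (use Suc.prems in auto)
qed auto

lemma costs_alive:
  assumes B: "\<And>e f. f \<in> set (cand e) \<Longrightarrow> length (toks f) \<le> B" "N \<le> B"
  shows "costs B w (alive j e) (8 * (2 ^ j - 1))"
proof (induction j arbitrary: e rule: less_induct)
  case (less j)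
  show ?case
  proof (cases j)
    case 0
    then show ?thesis by (simp add: alive_0 costs_Ret)
  next
    case (Suc l)
    \<comment> \<open>The rounds cost 2 * 2^j and the initial potential is as large again. With the
      recursive call one level below this adds up to 8 * (2^j - 1).\<close>
    have "costs B w (loop alive j e (2 ^ j) 0) (2 * 2 ^ j + 2 * 2 ^ j)"
      unfolding costs_def using less B Suc by (auto intro!: wp_loop)
    then have t: "costs B w (if b then loop alive j e (2 ^ j) 0 else Ret False) (2 * 2 ^ j + 2 * 2 ^ j)" for b
      by (cases b) (auto simp: costs_def)
    have "costs B w (alive j e) (8 * (2 ^ l - 1) + (2 * 2 ^ j + 2 * 2 ^ j))"
      unfolding Suc alive_Suc using less[of l] Suc by (intro costs_bind t[unfolded Suc]) auto
    then show ?thesis by (simp add: Suc algebra_simps)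
  qed
qed

text \<open>The load of e. Links charge their cost to it, since a check measures only weight that is
  still unsaturated.\<close>

definition L :: "nat \<Rightarrow> 'e \<Rightarrow> real" where "L J e = (\<Sum>i<J. X i e * a i e)"

lemma L_mono: "i \<le> j \<Longrightarrow> L i e \<le> L j e"
  unfolding L_def by (intro sum_mono2) (auto simp: X_bounds a_nonneg)

text \<open>The discounted coverage P in the failure bound satisfies P (l + 1) = (P l + a l) / 2.
  Failing at level l + 1 costs at most C X P (l + 1), and keeping the same amount as potential
  spends exactly the old potential C X P l together with the new load C X a l.\<close>

lemma fail_le_L_aux:
  assumes "\<And>l. l < J \<Longrightarrow> A (Suc l) e \<le> 1 / (16 * real m)"
  shows "1 - X J e \<le> 16 * (8 * real m) ^ 2 * L J e"
proof -
  define C :: real where "C = 16 * (8 * real m) ^ 2"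
  have C: "C > 0" using m_pos by (simp add: C_def)
  define P where "P l = (\<Sum>i<l. 2 ^ i * a i e) / 2 ^ l" for l
  have P_Suc: "P (Suc l) = (P l + a l e) / 2" for l
    by (simp add: P_def field_simps)
  have P_nn: "P l \<ge> 0" for l unfolding P_def by (intro divide_nonneg_nonneg sum_nonneg) (auto simp: a_nonneg)
  have "1 - X l e + C * (X l e * P l) \<le> C * L l e" if "l \<le> J" for l
    using that
  proof (induction l)
    case 0
    then show ?case by (simp add: X_0 P_def L_def)
  next
    case (Suc l)
    have 1: "1 - x (Suc l) e \<le> C * P (Suc l)"
      using x_lower[OF assms, of l] Suc.prems by (simp add: C_def P_def)
    have "1 - X (Suc l) e = (1 - X l e) + X l e * (1 - x (Suc l) e)" by (simp add: X_Suc algebra_simps)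
    also have "\<dots> \<le> (1 - X l e) + X l e * (C * P (Suc l))"
      using 1 by (intro add_left_mono mult_left_mono) (auto simp: X_bounds)
    finally have 2: "1 - X (Suc l) e \<le> (1 - X l e) + C * (X l e * P (Suc l))" by (simp add: mult_ac)
    have 3: "C * (X (Suc l) e * P (Suc l)) \<le> C * (X l e * P (Suc l))"
      using C P_nn X_antimono[of l "Suc l"] by (intro mult_left_mono mult_right_mono) auto
    have "C * (X l e * P (Suc l)) + C * (X l e * P (Suc l)) = C * (X l e * P l) + C * (X l e * a l e)"
      by (simp add: P_Suc algebra_simps)
    then show ?case using 2 3 Suc by (simp add: L_def algebra_simps)
  qed
  from this[of J] have "1 - X J e \<le> C * L J e"
    using C P_nn X_bounds[of J e] by (smt (verit) mult_nonneg_nonneg order_refl)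
  then show ?thesis by (simp add: C_def)
qed

text \<open>Consider the first level at which the accumulated coverage exceeds half the threshold.
  Either e survives up to there with probability at least 1/2, so that the load is at least 1/(32
  m), or failure has already occurred with probability 1/2 and is charged by the previous lemma.
  Doubling its constant covers both.\<close>

lemma fail_le_L: "1 - X J e \<le> 32 * (8 * real m) ^ 2 * L J e"
proof (cases "\<forall>l<J. A (Suc l) e \<le> 1 / (16 * real m)")
  case True
  have "L J e \<ge> 0" unfolding L_def by (intro sum_nonneg) (auto simp: X_bounds a_nonneg)
  then have "16 * (8 * real m) ^ 2 * L J e \<le> 32 * (8 * real m) ^ 2 * L J e" by (intro mult_right_mono) auto
  then show ?thesis using fail_le_L_aux[of J e] True by simp
next
  case False
  define l where "l = (LEAST l. l < J \<and> \<not> A (Suc l) e \<le> 1 / (16 * real m))"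
  have l: "l < J" "A (Suc l) e > 1 / (16 * real m)"
    using LeastI_ex[of "\<lambda>l. l < J \<and> \<not> A (Suc l) e \<le> 1 / (16 * real m)"] False unfolding l_def by auto
  have "A (Suc k) e \<le> 1 / (16 * real m)" if "k < l" for k
    using not_less_Least[of k "\<lambda>l. l < J \<and> \<not> A (Suc l) e \<le> 1 / (16 * real m)"] that l(1) unfolding l_def by auto
  then have 1: "1 - X l e \<le> 16 * (8 * real m) ^ 2 * L l e" by (rule fail_le_L_aux)
  have "1 \<le> 32 * (8 * real m) ^ 2 * L J e"
  proof (cases "X l e \<ge> 1 / 2")
    case True
    have "1 / 2 * (1 / (16 * real m)) \<le> X l e * A (Suc l) e" using True l(2) by (intro mult_mono) auto
    also have "\<dots> \<le> L (Suc l) e" unfolding L_def A_def sum_distrib_left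
      by (intro sum_mono mult_right_mono X_antimono) (auto simp: a_nonneg)
    also have "\<dots> \<le> L J e" using l(1) by (intro L_mono) auto
    finally have "32 * (8 * real m) ^ 2 * (1 / 2 * (1 / (16 * real m))) \<le> 32 * (8 * real m) ^ 2 * L J e"
      by (intro mult_left_mono) auto
    moreover have "1 \<le> 32 * (8 * real m) ^ 2 * (1 / 2 * (1 / (16 * real m)))"
      using m_pos by (simp add: power2_eq_square)
    ultimately show ?thesis by linarith
  next
    case False
    have "1 / 2 \<le> 16 * (8 * real m) ^ 2 * L l e" using 1 False by linarith
    also have "\<dots> \<le> 16 * (8 * real m) ^ 2 * L J e" using l(1) by (intro mult_left_mono L_mono) auto
    finally show ?thesis by simp
  qed
  then show ?thesis using X_bounds[of J e] by linarith
qed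

text \<open>Survival decays like exp (-6/10 A), so the load is bounded like the integral of this
  function over A. The coefficient is 10 = 3 * 2 / (6/10), where 3 bounds e and 2 bounds the growth
  of \<open>a\<close> from one level to the next.\<close>

lemma L_le: "L (Suc J) e \<le> 1 + 10 * (1 - exp (- (6/10) * A J e))"
proof (induction J)
  case 0
  then show ?case using a_0[of e] by (simp add: L_def A_def X_0)
next
  case (Suc J)
  let ?E = "\<lambda>j. exp (- (6/10) * A j e)"
  have AS: "A (Suc J) e = A J e + a J e" by (simp add: A_def)
  have "X (Suc J) e \<le> x (Suc J) e" using X_bounds x_bounds by (simp add: X_Suc mult_left_le_one_le)
  also have "\<dots> \<le> exp 1 * ?E (Suc J)" using x_upper[of J e] by (simp flip: exp_add)
  also have "\<dots> \<le> 3 * ?E (Suc J)" using exp_le by (intro mult_right_mono) auto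
  finally have "X (Suc J) e * a (Suc J) e \<le> (3 * ?E (Suc J)) * (2 * a J e)"
    using a_Suc[of J e] a_nonneg by (intro mult_mono) auto
  also have "\<dots> = 10 * (?E (Suc J) * (6 / 10 * a J e))" by simp
  also have "6 / 10 * a J e \<le> exp (6 / 10 * a J e) - 1"
    using exp_ge_add_one_self[of "6 / 10 * a J e"] by linarith
  also have "10 * (?E (Suc J) * (exp (6 / 10 * a J e) - 1)) = 10 * (?E J - ?E (Suc J))" by (simp add: AS algebra_simps flip: exp_add)
  finally show ?case using Suc by (simp add: L_def mult_left_mono)
qed

lemma L_bound: "L J e \<le> 11"
proof -
  have "L J e \<le> L (Suc J) e" by (rule L_mono) simp
  also have "\<dots> \<le> 1 + 10 * (1 - exp (- (6/10) * A J e))" by (rule L_le)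
  also have "\<dots> \<le> 11" by simp
  finally show ?thesis .
qed

end

section \<open>From saturated tokens to cheap covers\<close>

text \<open>Conditional expectations. The product of the factors 1 - 2 p is the expected sign
  (-1)^c, where c counts the chosen links that cross e; \<open>\<sigma> e\<close> carries the sign
  fixed by links already decided.\<close>

lemma parity_rounding:
  fixes p c :: "'f \<Rightarrow> real" and W :: "'e \<Rightarrow> real" and \<sigma> :: "'e \<Rightarrow> real"
  assumes "finite I" "\<And>f. f \<in> I \<Longrightarrow> 0 \<le> p f \<and> p f \<le> 1"
  shows "\<exists>F\<subseteq>I. (\<Sum>e\<in>E. W e * (1 - \<sigma> e * (\<Prod>f\<in>I. if e \<in> pth f then 1 - 2 * p f else 1)) / 2) - (\<Sum>f\<in>I. p f * c f)
     \<le> (\<Sum>e\<in>E. W e * (1 - \<sigma> e * (\<Prod>f\<in>F. if e \<in> pth f then -1 else 1)) / 2) - (\<Sum>f\<in>F. c f)"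
  using assms
proof (induction I arbitrary: \<sigma> rule: finite_induct)
  case (insert f I)
  let ?P = "\<lambda>I e. \<Prod>f\<in>I. if e \<in> pth f then 1 - 2 * p f else 1"
  define V where "V \<sigma> = (\<Sum>e\<in>E. W e * (1 - \<sigma> e * ?P I e) / 2) - (\<Sum>f\<in>I. p f * c f)" for \<sigma>
  define U where "U \<sigma> F = (\<Sum>e\<in>E. W e * (1 - \<sigma> e * (\<Prod>f\<in>F. if e \<in> pth f then -1 else 1)) / 2) - (\<Sum>f\<in>F. c f)" for \<sigma> F
  define \<sigma>' where "\<sigma>' = (\<lambda>e. \<sigma> e * (if e \<in> pth f then -1 else 1))"
  have IH: "\<exists>F\<subseteq>I. V \<tau> \<le> U \<tau> F" for \<tau>
    unfolding V_def U_def using insert.prems by (intro insert.IH) auto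
  have p: "0 \<le> p f" "p f \<le> 1" using insert.prems by auto
  have "(\<Sum>e\<in>E. W e * (1 - \<sigma> e * ?P (insert f I) e) / 2)
      = (\<Sum>e\<in>E. (1 - p f) * (W e * (1 - \<sigma> e * ?P I e) / 2)
        + p f * (W e * (1 - \<sigma>' e * ?P I e) / 2))"
    using insert.hyps by (intro sum.cong refl) (auto simp: \<sigma>'_def field_simps)
  also have "\<dots> = (1 - p f) * (\<Sum>e\<in>E. W e * (1 - \<sigma> e * ?P I e) / 2)
        + p f * (\<Sum>e\<in>E. W e * (1 - \<sigma>' e * ?P I e) / 2)"
    by (simp only: sum.distrib sum_distrib_left)
  finally have lhs: "(\<Sum>e\<in>E. W e * (1 - \<sigma> e * ?P (insert f I) e) / 2) - (\<Sum>f\<in>insert f I. p f * c f)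
     = (1 - p f) * V \<sigma> + p f * (V \<sigma>' - c f)"
    using insert.hyps unfolding V_def by (simp only: sum.insert) (simp add: algebra_simps)
  obtain F1 where F1: "F1 \<subseteq> I" "V \<sigma> \<le> U \<sigma> F1" using IH by blast
  obtain F2 where F2: "F2 \<subseteq> I" "V \<sigma>' \<le> U \<sigma>' F2" using IH by blast
  have "finite F2" "f \<notin> F2" using F2 insert.hyps by (auto intro: finite_subset)
  then have U2: "U \<sigma> (insert f F2) = U \<sigma>' F2 - c f"
    unfolding U_def \<sigma>'_def by (simp add: mult.assoc)
  show ?case
  proof (cases "V \<sigma> \<ge> V \<sigma>' - c f")
    case True
    have "p f * (V \<sigma>' - c f) \<le> p f * V \<sigma>" using True p by (intro mult_left_mono) auto
    then have "(1 - p f) * V \<sigma> + p f * (V \<sigma>' - c f) \<le> U \<sigma> F1" using F1(2) by (simp add: algebra_simps)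
    then show ?thesis unfolding lhs U_def using F1(1) by (intro exI[of _ F1]) auto
  next
    case False
    have "(1 - p f) * V \<sigma> \<le> (1 - p f) * (V \<sigma>' - c f)" using False p by (intro mult_left_mono) auto
    then have "(1 - p f) * V \<sigma> + p f * (V \<sigma>' - c f) \<le> U \<sigma> (insert f F2)" using F2(2) U2 by (simp add: algebra_simps)
    then show ?thesis unfolding lhs U_def using F2(1) by (intro exI[of _ "insert f F2"]) auto
  qed
qed (auto intro!: exI[of _ "{}"])

text \<open>Multiplying the right-hand side by the quadratic lower bound of exp t leaves 1 + t^4 /
  4.\<close>

lemma exp_neg_le_quadratic:
  fixes t :: real assumes "0 \<le> t" shows "exp (- t) \<le> 1 - t + t ^ 2 / 2"
proof -
  have "1 + t + t ^ 2 / 2 \<le> exp t" using exp_lower_Taylor_quadratic assms by blast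
  moreover have p: "0 < 1 - t + t ^ 2 / 2" using zero_le_power2[of "t - 1"] by (simp add: power2_eq_square algebra_simps)
  ultimately have "(1 + t + t ^ 2 / 2) * (1 - t + t ^ 2 / 2) \<le> exp t * (1 - t + t ^ 2 / 2)"
    by (intro mult_right_mono) auto
  moreover have "(1 + t + t ^ 2 / 2) * (1 - t + t ^ 2 / 2) = 1 + (t ^ 2 / 2) ^ 2"
    by (simp add: power2_eq_square algebra_simps)
  ultimately have "1 \<le> exp t * (1 - t + t ^ 2 / 2)" using zero_le_power2[of "t ^ 2 / 2"] by linarith
  then show ?thesis by (simp add: exp_minus field_simps)
qed

text \<open>A link covers at least 12/10 of its scale, so the unchecked level 0 pays for itself, and
  at most 200 times its scale, so a hit has probability at least 1/200 at the relevant density and m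
  samples reduce the error of a check to 1/200.\<close>

locale level_cover = level_test cand toks qa qb sc N m w
  for cand :: "'e \<Rightarrow> 'f list" and toks :: "'f \<Rightarrow> 'e list" and qa qb sc N m w +
  fixes E :: "'e set" and W :: "'e \<Rightarrow> nat" and tok :: "'f \<Rightarrow> 'e set" and I :: "'f set"
  assumes finE: "finite E" and finI: "finite I" and tok_sub: "f \<in> I \<Longrightarrow> tok f \<subseteq> E"
    and toks_sum: "f \<in> I \<Longrightarrow> (\<Sum>e\<leftarrow>toks f. g e) = (\<Sum>e\<in>tok f. real (W e) * g e)"
    and cand_set: "e \<in> E \<Longrightarrow> set (cand e) = {f \<in> I. e \<in> tok f}"
    and sc_pos: "f \<in> I \<Longrightarrow> 0 < sc f" and sc_le: "f \<in> I \<Longrightarrow> 12/10 * sc f \<le> length (toks f)"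
    and len_le: "f \<in> I \<Longrightarrow> length (toks f) \<le> 200 * sc f"
    and m_large: "exp (- real m / 200000) \<le> 1 / 200"
begin

definition IV :: "'f set" where "IV = {f \<in> I. valid f}"
definition z :: "nat \<Rightarrow> 'f \<Rightarrow> real" where "z J f = (\<Sum>i<J. 2 ^ i / N * Y i f)"
definition g :: "nat \<Rightarrow> 'f \<Rightarrow> real" where "g i f = (\<Sum>e\<in>tok f. W e * X i e)"

lemma finite_IV: "finite IV" using finI by (simp add: IV_def)

lemma cv_eq: "e \<in> E \<Longrightarrow> cv e = {f \<in> IV. e \<in> tok f}"
  by (auto simp: cv_def cand_set IV_def)

lemma toks_nonempty: "f \<in> I \<Longrightarrow> toks f \<noteq> []"
  using sc_pos[of f] sc_le[of f] by auto

lemma q_eq: "f \<in> I \<Longrightarrow> q i f * length (toks f) = g i f"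
  using toks_nonempty[of f] by (simp add: q_def toks_sum g_def)

lemma error_small: "f \<in> I \<Longrightarrow> exp (- (1/1000) * (sc f / length (toks f)) * m) \<le> 1 / 200"
proof -
  assume f: "f \<in> I"
  have "1 / 200 \<le> sc f / length (toks f)" using len_le[OF f] toks_nonempty[OF f] by (simp add: field_simps)
  then have "1 / 200 * real m \<le> sc f / length (toks f) * real m" by (intro mult_right_mono) auto
  then have "- (1/1000) * (sc f / length (toks f)) * m \<le> - real m / 200000" by (simp add: mult_ac)
  then have "exp (- (1/1000) * (sc f / length (toks f)) * m) \<le> exp (- real m / 200000)" by (simp only: exp_le_cancel_iff)
  then show ?thesis using m_large by linarith
qed

lemma y_bad: "f \<in> I \<Longrightarrow> g i f \<le> 11/10 * sc f \<Longrightarrow> y i f \<le> 1 / 200"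
  using y_upper[OF toks_nonempty, of f i] q_eq[of f i] sc_pos[of f] error_small[of f] by simp

lemma y_good: "f \<in> I \<Longrightarrow> g i f \<ge> 13/10 * sc f \<Longrightarrow> y i f \<ge> 199 / 200"
  using y_lower[OF toks_nonempty, of f i] q_eq[of f i] sc_pos[of f] error_small[of f] by simp

lemma g_0: "f \<in> I \<Longrightarrow> g 0 f = length (toks f)"
  using toks_sum[of f "\<lambda>_. 1"] by (simp add: g_def X_0 sum_list_triv)

lemma g_antimono: "i \<le> j \<Longrightarrow> g j f \<le> g i f"
  unfolding g_def by (intro sum_mono mult_left_mono X_antimono) auto

lemma g_nonneg: "0 \<le> g i f"
  unfolding g_def by (intro sum_nonneg mult_nonneg_nonneg) (auto simp: X_bounds)

text \<open>Where the unsaturated weight is at least 11/10 of the scale, new weight pays for itself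
  and for a reserve of 1/99. Where it is less, the check passes with probability at most 1/200; even
  after doubling, the new weight is at most 1/100 of the previous one, whose reserve pays for it.
  The factor is 1000/1089 = (100/99) / (11/10), below 92/100.\<close>

lemma item_cost:
  assumes "f \<in> I"
  shows "sc f * (\<Sum>i<J. 2 ^ i * Y i f) \<le> 92/100 * (\<Sum>i<J. 2 ^ i * Y i f * g i f)"
proof (cases J)
  case (Suc J')
  have s: "sc f > 0" using sc_pos assms by blast
  have "sc f * (\<Sum>i<Suc j. 2 ^ i * Y i f) + sc f * (2 ^ j * Y j f) / 99 \<le> 1000/1089 * (\<Sum>i<Suc j. 2 ^ i * Y i f * g i f)" for j
  proof (induction j)
    case 0
    then show ?case using sc_le[OF assms] g_0[OF assms] by (simp add: Y_0)
  next
    case (Suc j)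
    let ?u = "2 ^ j * Y j f" and ?v = "2 ^ Suc j * Y (Suc j) f"
    have u: "0 \<le> ?u" "0 \<le> ?v" by (auto simp: Y_bounds)
    have "sc f * ?v + sc f * ?v / 99 - sc f * ?u / 99 \<le> 1000/1089 * (?v * g (Suc j) f)"
    proof (cases "g (Suc j) f \<le> 11/10 * sc f")
      case True
      have "?v = 2 * ?u * y (Suc j) f" by (simp add: Y_Suc)
      also have "\<dots> \<le> 2 * ?u * (1 / 200)" using u y_bad[OF assms True] by (intro mult_left_mono) auto
      finally have "sc f * (100 * ?v) \<le> sc f * ?u" using s by (intro mult_left_mono) auto
      then have "sc f * ?v + sc f * ?v / 99 - sc f * ?u / 99 \<le> 0" by simp
      also have "0 \<le> 1000/1089 * (?v * g (Suc j) f)" using g_nonneg by (intro mult_nonneg_nonneg) (auto simp: Y_bounds)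
      finally show ?thesis .
    next
      case False
      have gen: "s * v + s * v / 99 - s * u / 99 \<le> 1000/1089 * (v * G)"
        if "0 \<le> s * u" "0 \<le> v" "11/10 * s \<le> G" for s u v G :: real
        using mult_left_mono[OF that(3,2)] that(1) by (simp add: algebra_simps)
      have "0 \<le> sc f * ?u" "11/10 * sc f \<le> g (Suc j) f" using False u(1) s by (simp_all only: mult_nonneg_nonneg less_imp_le not_le)
      with u(2) show ?thesis by (intro gen)
    qed
    then show ?case using Suc by (simp add: algebra_simps)
  qed
  from this[of J'] have "sc f * (\<Sum>i<J. 2 ^ i * Y i f) + sc f * (2 ^ J' * Y J' f) / 99 \<le> 1000/1089 * (\<Sum>i<J. 2 ^ i * Y i f * g i f)"
    by (simp add: Suc)
  moreover have "0 \<le> sc f * (2 ^ J' * Y J' f)" using s by (simp add: Y_bounds)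
  moreover have "0 \<le> (\<Sum>i<J. 2 ^ i * Y i f * g i f)" by (intro sum_nonneg mult_nonneg_nonneg) (auto simp: Y_bounds g_nonneg)
  ultimately show ?thesis by simp
qed simp

lemma total_cost: "(\<Sum>f\<in>IV. sc f * z J f) \<le> 92/100 * (\<Sum>e\<in>E. W e * L J e)"
proof -
  let ?t = "\<lambda>e i f. if e \<in> tok f then W e * X i e * 2 ^ i * Y i f else 0"
  have "(\<Sum>f\<in>IV. sc f * z J f) = (\<Sum>f\<in>IV. sc f * (\<Sum>i<J. 2 ^ i * Y i f)) / N"
    by (simp add: z_def sum_divide_distrib sum_distrib_left)
  also have "\<dots> \<le> (\<Sum>f\<in>IV. 92/100 * (\<Sum>i<J. 2 ^ i * Y i f * g i f)) / N"
    by (intro divide_right_mono sum_mono item_cost) (auto simp: IV_def)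
  also have "\<dots> = 92/100 * ((\<Sum>f\<in>IV. \<Sum>i<J. \<Sum>e\<in>E. ?t e i f) / N)"
  proof -
    have "(\<Sum>i<J. 2 ^ i * Y i f * g i f) = (\<Sum>i<J. \<Sum>e\<in>E. ?t e i f)" if "f \<in> IV" for f
    proof (intro sum.cong refl)
      fix i
      have "tok f = {e \<in> E. e \<in> tok f}" using tok_sub that by (auto simp: IV_def)
      then show "2 ^ i * Y i f * g i f = (\<Sum>e\<in>E. ?t e i f)"
        unfolding g_def sum_distrib_left using finE by (subst sum.inter_filter[symmetric]) (auto intro!: sum.cong simp: mult_ac)
    qed
    then have "(\<Sum>f\<in>IV. 92/100 * (\<Sum>i<J. 2 ^ i * Y i f * g i f)) = (\<Sum>f\<in>IV. 92/100 * (\<Sum>i<J. \<Sum>e\<in>E. ?t e i f))"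
      by (intro sum.cong) auto
    then show ?thesis by (simp add: sum_distrib_left)
  qed
  also have "(\<Sum>f\<in>IV. \<Sum>i<J. \<Sum>e\<in>E. ?t e i f)
     = (\<Sum>e\<in>E. \<Sum>i<J. \<Sum>f\<in>IV. ?t e i f)"
    by (subst sum.swap, subst (2) sum.swap, subst (1) sum.swap) simp
  also have "\<dots> / N = (\<Sum>e\<in>E. W e * L J e)"
    unfolding L_def sum_divide_distrib sum_distrib_left
  proof (intro sum.cong refl)
    fix e i assume e: "e \<in> E"
    have "(\<Sum>f\<in>IV. ?t e i f) = (\<Sum>f\<in>cv e. W e * X i e * 2 ^ i * Y i f)"
      unfolding cv_eq[OF e] using finite_IV by (subst sum.inter_filter) auto
    then show "(\<Sum>f\<in>IV. ?t e i f / N) = W e * (X i e * a i e)"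
      by (simp add: a_def sum_distrib_left mult_ac flip: sum_divide_distrib)
  qed
  finally show ?thesis .
qed

text \<open>Otherwise the link passes each check up to J with probability at least 199/200, so its
  weight reaches (199/100)^J / N >= 1000. Its tokens then survive with probability at most exp
  (-599), and the unsaturated weight left under it is at most the scale.\<close>

lemma valid_item_saturated:
  assumes f: "f \<in> IV" and J: "1000 * real N \<le> (199/100) ^ J"
  shows "g (Suc J) f \<le> 13/10 * sc f"
proof (rule ccontr)
  assume neg: "\<not> ?thesis"
  have fI: "f \<in> I" using f by (simp add: IV_def)
  have "y l f \<ge> 199/200" if "l \<le> J" for l
    using neg g_antimono[of l "Suc J" f] that by (intro y_good fI) auto
  then have "(199/200) ^ J \<le> Y J f"
    unfolding Y_def using prod_mono[of "{1..J}" "\<lambda>_. 199/200" "\<lambda>l. y l f"] by auto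
  then have "2 ^ J * (199/200) ^ J \<le> 2 ^ J * Y J f" by (intro mult_left_mono) auto
  then have Yb: "1000 * real N \<le> 2 ^ J * Y J f" using J by (simp flip: power_mult_distrib)
  have "X (Suc J) e \<le> 1 / 200" if e: "e \<in> tok f" for e
  proof -
    have eE: "e \<in> E" using e tok_sub fI by blast
    have "Y J f \<le> (\<Sum>f\<in>cv e. Y J f)" using cv_eq[OF eE] e f
      by (intro member_le_sum) (auto simp: Y_bounds finite_IV)
    then have "2 ^ J * Y J f \<le> 2 ^ J * (\<Sum>f\<in>cv e. Y J f)" by (intro mult_left_mono) auto
    then have "1000 * real N \<le> 2 ^ J * (\<Sum>f\<in>cv e. Y J f)" using Yb by linarith
    then have "1000 \<le> a J e" using N_pos by (simp add: a_def field_simps)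
    also have "\<dots> \<le> A (Suc J) e" unfolding A_def by (simp add: sum_nonneg a_nonneg)
    finally have A: "1000 \<le> A (Suc J) e" .
    have "X (Suc J) e \<le> x (Suc J) e" using X_bounds x_bounds by (simp add: X_Suc mult_left_le_one_le)
    also have "\<dots> \<le> exp (1 - 6/10 * A (Suc J) e)" by (rule x_upper)
    also have "\<dots> \<le> exp (- 599)" using A by simp
    also have "\<dots> \<le> 1 / 200" using exp_ge_add_one_self[of 599] by (simp add: exp_minus field_simps)
    finally show ?thesis .
  qed
  then have "g (Suc J) f \<le> (\<Sum>e\<in>tok f. W e * (1 / 200))"
    unfolding g_def by (intro sum_mono mult_left_mono) auto
  also have "\<dots> = length (toks f) / 200" using toks_sum[OF fI, of "\<lambda>_. 1"] by (simp add: sum_list_triv flip: sum_divide_distrib)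
  also have "\<dots> \<le> sc f" using len_le[OF fI] by simp
  finally show False using neg sc_pos[OF fI] by simp
qed

text \<open>A chosen link flips parity on the whole path \<open>pth f\<close>, while only
  \<open>tok f\<close> was credited. This is harmless: on the other path edges it contributes a
  factor in [0, 1], which only lowers the expected sign.\<close>

lemma rounding:
  assumes pth: "\<And>f. f \<in> IV \<Longrightarrow> tok f \<subseteq> pth f" and c: "\<And>f. f \<in> IV \<Longrightarrow> c f \<le> sc f"
  shows "\<exists>F\<subseteq>IV. 1 / 6875 * (\<Sum>e\<in>E. W e * L J e)
     \<le> (\<Sum>e\<in>E. W e * (1 - (\<Prod>f\<in>F. if e \<in> pth f then (-1::real) else 1)) / 2) - (\<Sum>f\<in>F. c f)"
proof -
  \<comment> \<open>The load is at most 11, so the quadratic loss is a fraction 11/275 = 4/100 of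
    the gain. Of the remaining 96/100 the links cost 92/100, which leaves 4/100 * 1/275 =
    1/6875.\<close>
  define k :: real where "k = 1 / 275"
  \<comment> \<open>The cap keeps 1 - 2 p nonnegative. A capped link has factor 0, which is below
    any exponential.\<close>
  define p where "p f = min (1 / 2) (k * z J f)" for f
  have z: "0 \<le> z J f" for f unfolding z_def by (intro sum_nonneg mult_nonneg_nonneg) (auto simp: Y_bounds)
  have p: "0 \<le> p f" "p f \<le> 1/2" "p f \<le> k * z J f" for f using z[of f] by (auto simp: p_def k_def)
  have L0: "0 \<le> L J e" for e unfolding L_def by (intro sum_nonneg) (auto simp: X_bounds a_nonneg)
  have *: "k * L J e - (k * L J e) ^ 2 \<le> (1 - 1 * (\<Prod>f\<in>IV. if e \<in> pth f then 1 - 2 * p f else 1)) / 2" if e: "e \<in> E" for e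
  proof -
    have "(\<Prod>f\<in>IV. if e \<in> pth f then 1 - 2 * p f else 1) \<le> (\<Prod>f\<in>IV. if e \<in> tok f then exp (- 2 * k * z J f) else 1)"
    proof (intro prod_mono conjI)
      fix f assume f: "f \<in> IV"
      show "0 \<le> (if e \<in> pth f then 1 - 2 * p f else 1)" using p[of f] by auto
      have "1 - 2 * p f \<le> exp (- 2 * k * z J f)"
      proof (cases "k * z J f \<le> 1 / 2")
        case True
        then show ?thesis using exp_ge_add_one_self[of "- 2 * k * z J f"] by (simp add: p_def)
      next
        case False
        then show ?thesis by (simp add: p_def)
      qed
      then show "(if e \<in> pth f then 1 - 2 * p f else 1) \<le> (if e \<in> tok f then exp (- 2 * k * z J f) else 1)"
        using pth[OF f] p[of f] by auto
    qed
    also have "\<dots> = (\<Prod>f\<in>cv e. exp (- 2 * k * z J f))"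
      unfolding cv_eq[OF e] using finite_IV by (subst prod.inter_filter) auto
    also have "\<dots> = exp (- 2 * k * (\<Sum>f\<in>cv e. z J f))"
      by (simp add: exp_sum[OF finite_cv] sum_distrib_left)
    also have "(\<Sum>f\<in>cv e. z J f) = A J e"
      unfolding A_def a_def z_def by (subst sum.swap) (simp add: sum_distrib_left)
    also have "exp (- 2 * k * A J e) \<le> exp (- (2 * (k * L J e)))"
    proof -
      have "L J e \<le> A J e" unfolding L_def A_def by (intro sum_mono) (auto simp: X_bounds a_nonneg mult_left_le_one_le)
      then show ?thesis by (simp add: k_def)
    qed
    also have "\<dots> \<le> 1 - 2 * (k * L J e) + (2 * (k * L J e)) ^ 2 / 2"
      by (rule exp_neg_le_quadratic) (simp add: k_def L0)
    finally show ?thesis by (simp add: power2_eq_square algebra_simps)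
  qed
  have **: "4/100 * k * L J e + 92/100 * k * L J e \<le> k * L J e - (k * L J e) ^ 2" for e
  proof -
    have "(k * L J e) * (k * L J e) \<le> (k * L J e) * (k * 11)"
      using L0 by (intro mult_left_mono L_bound) (auto simp: k_def)
    then show ?thesis by (simp add: k_def power2_eq_square)
  qed
  have "4/100 * k * (\<Sum>e\<in>E. W e * L J e) + k * (92/100 * (\<Sum>e\<in>E. W e * L J e))
     = (\<Sum>e\<in>E. W e * (4/100 * k * L J e + 92/100 * k * L J e))"
  proof -
    have "(\<Sum>e\<in>E. W e * (4/100 * k * L J e + 92/100 * k * L J e)) = (\<Sum>e\<in>E. (96/100 * k) * (W e * L J e))"
      by (intro sum.cong refl) (simp add: algebra_simps)
    also have "\<dots> = (96/100 * k) * (\<Sum>e\<in>E. W e * L J e)" by (rule sum_distrib_left[symmetric])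
    finally show ?thesis by simp
  qed
  also have "\<dots> \<le> (\<Sum>e\<in>E. W e * (1 - 1 * (\<Prod>f\<in>IV. if e \<in> pth f then 1 - 2 * p f else 1)) / 2)"
    unfolding times_divide_eq_right[symmetric] by (intro sum_mono mult_left_mono order_trans[OF ** *]) auto
  finally have 1: "4/100 * k * (\<Sum>e\<in>E. W e * L J e) + k * (92/100 * (\<Sum>e\<in>E. W e * L J e)) \<le> \<dots>" .
  have "(\<Sum>f\<in>IV. p f * c f) \<le> (\<Sum>f\<in>IV. k * (sc f * z J f))"
  proof (intro sum_mono)
    fix f assume f: "f \<in> IV"
    have "p f * c f \<le> p f * sc f" using c[OF f] p by (intro mult_left_mono) auto
    also have "\<dots> \<le> (k * z J f) * sc f" using p(3)[of f] sc_pos[of f] f by (intro mult_right_mono) (auto simp: IV_def)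
    finally show "p f * c f \<le> k * (sc f * z J f)" by (simp add: mult_ac)
  qed
  also have "\<dots> \<le> k * (92/100 * (\<Sum>e\<in>E. W e * L J e))"
    unfolding sum_distrib_left[symmetric] using total_cost[of J] by (intro mult_left_mono) (auto simp: k_def)
  finally have 2: "(\<Sum>f\<in>IV. p f * c f) \<le> \<dots>" .
  let ?V = "\<lambda>F. (\<Sum>e\<in>E. W e * (1 - 1 * (\<Prod>f\<in>F. if e \<in> pth f then (-1::real) else 1)) / 2) - (\<Sum>f\<in>F. c f)"
  have "\<exists>F\<subseteq>IV. (\<Sum>e\<in>E. W e * (1 - 1 * (\<Prod>f\<in>IV. if e \<in> pth f then 1 - 2 * p f else 1)) / 2) - (\<Sum>f\<in>IV. p f * c f) \<le> ?V F"
    by (rule parity_rounding[OF finite_IV, where \<sigma> = "\<lambda>_. 1"]) (use p in \<open>smt (verit) divide_le_eq_1\<close>)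
  then obtain F where F: "F \<subseteq> IV" "(\<Sum>e\<in>E. W e * (1 - 1 * (\<Prod>f\<in>IV. if e \<in> pth f then 1 - 2 * p f else 1)) / 2) - (\<Sum>f\<in>IV. p f * c f) \<le> ?V F"
    by (elim exE conjE) (rule that)
  have "4/100 * k * (\<Sum>e\<in>E. W e * L J e) = 1 / 6875 * (\<Sum>e\<in>E. W e * L J e)" by (simp add: k_def)
  with 1 2 F(2) have "1 / 6875 * (\<Sum>e\<in>E. W e * L J e) \<le> ?V F" by linarith
  then show ?thesis using F(1) by (intro exI[of _ F]) simp
qed

end

section \<open>Closed walks and tours\<close>

definition nrm :: "nat \<Rightarrow> nat \<Rightarrow> nat \<times> nat" where "nrm a b = (min a b, max a b)"

definition deg :: "(nat \<times> nat) multiset \<Rightarrow> nat \<Rightarrow> nat" where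
  "deg G v = (\<Sum>e\<in>#G. of_bool (fst e = v) + of_bool (snd e = v))"

fun wl :: "nat list \<Rightarrow> (nat \<times> nat) list" where
  "wl (x # y # xs) = nrm x y # wl (y # xs)"
| "wl _ = []"

fun pl :: "(nat \<Rightarrow> nat \<Rightarrow> nat) \<Rightarrow> nat list \<Rightarrow> nat" where
  "pl w (x # y # xs) = w x y + pl w (y # xs)"
| "pl w _ = 0"

lemma deg_add: "deg (A + B) v = deg A v + deg B v" by (simp add: deg_def)
lemma deg_nrm: "deg {#nrm x y#} v = of_bool (x = v) + of_bool (y = v)"
  by (auto simp: deg_def nrm_def min_def max_def)
lemma deg_add_mset: "deg (add_mset e G) v = deg {#e#} v + deg G v" by (simp add: deg_def)

lemma deg_pos: "deg G v > 0 \<Longrightarrow> \<exists>e\<in>#G. fst e = v \<or> snd e = v"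
  unfolding deg_def by (induction G) (auto split: if_splits simp: of_bool_def)

lemma wl_append: "xs \<noteq> [] \<Longrightarrow> wl (xs @ [y]) = wl xs @ [nrm (last xs) y]"
  by (induction xs rule: wl.induct) auto

lemma wl_append2: "wl (xs @ v # ys) = wl (xs @ [v]) @ wl (v # ys)"
  by (induction xs rule: wl.induct) auto

lemma pl_append: "xs \<noteq> [] \<Longrightarrow> pl w (xs @ [y]) = pl w xs + w (last xs) y"
  by (induction xs rule: wl.induct) auto

lemma wl_length: "length (wl xs) = length xs - 1"
  by (induction xs rule: wl.induct) auto

lemma wl_set: "e \<in> set (wl xs) \<Longrightarrow> fst e \<in> set xs \<and> snd e \<in> set xs"
  by (induction xs rule: wl.induct) (auto simp: nrm_def min_def max_def split: if_splits)

lemma wl_cover: "v \<in> set xs \<Longrightarrow> v = hd xs \<or> (\<exists>e\<in>set (wl xs). fst e = v \<or> snd e = v)"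
proof (induction xs rule: wl.induct)
  case (1 x y xs)
  have "fst (nrm x y) = y \<or> snd (nrm x y) = y" by (auto simp: nrm_def)
  then show ?case using 1 by auto
qed auto

lemma deg_wl: "xs \<noteq> [] \<Longrightarrow> even (deg (mset (wl xs)) v + of_bool (hd xs = v) + of_bool (last xs = v))"
proof (induction xs rule: wl.induct)
  case (1 x y xs)
  then have "even (deg (mset (wl (y # xs))) v + of_bool (y = v) + of_bool (last (y # xs) = v))" by simp
  moreover have "deg (mset (wl (x # y # xs))) v + of_bool (hd (x # y # xs) = v) + of_bool (last (x # y # xs) = v)
     = 2 * of_bool (x = v) + (deg (mset (wl (y # xs))) v + of_bool (y = v) + of_bool (last (y # xs) = v))"
    by (simp add: deg_add_mset[of "nrm x y"] deg_nrm)
  ultimately show ?case by (simp only: even_add even_mult_iff even_numeral simp_thms)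
qed (auto simp: deg_def)

lemma nrm_edge: "fst e \<le> snd e \<Longrightarrow> fst e = z \<or> snd e = z \<Longrightarrow> \<exists>u. nrm z u = e"
  by (intro exI[of _ "if fst e = z then snd e else fst e"], cases e) (auto simp: nrm_def)

lemma ex_longest:
  assumes "P x" "\<And>xs. P xs \<Longrightarrow> length xs \<le> b"
  shows "\<exists>xs. P xs \<and> (\<forall>ys. P ys \<longrightarrow> length ys \<le> length xs)"
proof -
  have "\<exists>xs. P xs \<and> \<not> (\<exists>ys. P ys \<and> length xs < length ys)"
  proof (rule ccontr)
    assume *: "\<not> ?thesis"
    have "\<exists>xs. P xs \<and> k \<le> length xs" for k
    proof (induction k)
      case (Suc k)
      then obtain xs where "P xs" "k \<le> length xs" by blast
      with * obtain ys where "P ys" "length xs < length ys" by blast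
      then show ?case using \<open>k \<le> length xs\<close> by (auto intro!: exI[of _ ys])
    qed (use assms(1) in auto)
    from this[of "Suc b"] assms(2) show False by fastforce
  qed
  then show ?thesis by (auto simp: not_less)
qed

lemma trail_length: "mset (wl xs) \<subseteq># G \<Longrightarrow> length xs \<le> Suc (size G)"
  using size_mset_mono[of "mset (wl xs)" G] wl_length[of xs] by simp

lemma ex_closed_trail:
  assumes ev: "\<And>v. even (deg G v)" and nr: "\<And>e. e \<in># G \<Longrightarrow> fst e \<le> snd e" and v: "deg G v > 0"
  shows "\<exists>ys. hd (v # ys) = last (v # ys) \<and> ys \<noteq> [] \<and> mset (wl (v # ys)) \<subseteq># G"
proof -
  let ?P = "\<lambda>ys. mset (wl (v # ys)) \<subseteq># G"
  obtain e where e: "e \<in># G" "fst e = v \<or> snd e = v" using deg_pos[OF v] by blast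
  then obtain u where u: "nrm v u = e" using nr nrm_edge by blast
  have P1: "?P [u]" using e u by simp
  obtain ys where ys: "?P ys" "\<And>zs. ?P zs \<Longrightarrow> length zs \<le> length ys"
    using ex_longest[of ?P "[u]" "size G"] P1 trail_length[of "v # _" G] by auto
  have "ys \<noteq> []" using ys(2)[OF P1] by auto
  moreover have "last (v # ys) = v"
  proof (rule ccontr)
    let ?z = "last (v # ys)"
    assume ne: "?z \<noteq> v"
    have "even (deg (mset (wl (v # ys))) ?z + of_bool (hd (v # ys) = ?z) + of_bool (last (v # ys) = ?z))"
      by (rule deg_wl) simp
    then have "odd (deg (mset (wl (v # ys))) ?z)" using ne by auto
    moreover have "deg G ?z = deg (mset (wl (v # ys))) ?z + deg (G - mset (wl (v # ys))) ?z"
      using ys(1) by (metis deg_add subset_mset.add_diff_inverse)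
    ultimately have "odd (deg (G - mset (wl (v # ys))) ?z)" using ev[of ?z] by auto
    then obtain e where e: "e \<in># G - mset (wl (v # ys))" "fst e = ?z \<or> snd e = ?z" using deg_pos by (metis odd_pos)
    then obtain u where u: "nrm ?z u = e" using nr nrm_edge by (metis in_diffD)
    have "mset (wl ((v # ys) @ [u])) = mset (wl (v # ys)) + {#e#}" by (subst wl_append, simp, simp only: u mset_append mset.simps)
    moreover have "mset (wl (v # ys)) + {#e#} \<subseteq># G"
    proof -
      have "{#e#} \<subseteq># G - mset (wl (v # ys))" using e(1) by simp
      then have "mset (wl (v # ys)) + {#e#} \<subseteq># mset (wl (v # ys)) + (G - mset (wl (v # ys)))" by (rule subset_mset.add_left_mono)
      then show ?thesis using ys(1) by (simp only: subset_mset.add_diff_inverse)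
    qed
    ultimately have "?P (ys @ [u])" by simp
    from ys(2)[OF this] show False by simp
  qed
  ultimately show ?thesis using ys(1) by (intro exI[of _ ys]) auto
qed

lemma euler_walk:
  assumes ev: "\<And>v. even (deg G v)" and nr: "\<And>e. e \<in># G \<Longrightarrow> fst e \<le> snd e"
    and conn: "\<And>v. v \<in> V \<Longrightarrow> (r, v) \<in> (set_mset G \<union> (set_mset G)\<inverse>)\<^sup>*"
  shows "\<exists>ys. last (r # ys) = r \<and> mset (wl (r # ys)) \<subseteq># G \<and> V \<subseteq> set (r # ys)"
proof -
  let ?P = "\<lambda>ys. last (r # ys) = r \<and> mset (wl (r # ys)) \<subseteq># G"
  obtain ys where ys: "?P ys" "\<And>zs. ?P zs \<Longrightarrow> length zs \<le> length ys"
    using ex_longest[of ?P "[]" "size G"] trail_length[of "r # _" G] by auto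
  let ?R = "G - mset (wl (r # ys))"
  have G: "G = mset (wl (r # ys)) + ?R" using ys(1) by (simp add: subset_mset.add_diff_inverse)
  have evR: "even (deg ?R v)" for v
  proof -
    have "even (deg (mset (wl (r # ys))) v + of_bool (hd (r # ys) = v) + of_bool (last (r # ys) = v))" by (rule deg_wl) simp
    then have "even (deg (mset (wl (r # ys))) v)" using ys(1) by auto
    moreover have "deg G v = deg (mset (wl (r # ys))) v + deg ?R v" by (metis G deg_add)
    ultimately show ?thesis using ev[of v] by simp
  qed
  have zero: "deg ?R v = 0" if v: "v \<in> set (r # ys)" for v
  proof (rule ccontr)
    assume "deg ?R v \<noteq> 0"
    then have pos: "0 < deg ?R v" by simp
    have nrR: "fst e \<le> snd e" if "e \<in># ?R" for e using nr in_diffD[OF that] by blast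
    obtain zs where zs0: "hd (v # zs) = last (v # zs)" and zs2: "zs \<noteq> []" "mset (wl (v # zs)) \<subseteq># ?R"
      using ex_closed_trail[OF evR nrR pos] by blast
    have zs: "v = last (v # zs)" "zs \<noteq> []" "mset (wl (v # zs)) \<subseteq># ?R" using zs0 zs2 by simp_all
    obtain as bs where ab: "r # ys = as @ v # bs" using split_list[OF v] by blast
    have zs': "zs = butlast zs @ [v]" using zs by (metis append_butlast_last_id last_ConsR)
    define new where "new = as @ v # zs @ bs"
    have hd: "new = r # tl new" using ab by (cases as) (auto simp: new_def)
    have last: "last new = r"
    proof (cases "bs = []")
      case True
      then have "last (r # ys) = v" using ab by simp
      then show ?thesis using True zs(1,2) ys(1) by (simp add: new_def)
    next
      case False
      have "last (r # ys) = last bs" using ab False by simp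
      then show ?thesis using False ys(1) by (simp add: new_def)
    qed
    have "new = (as @ v # butlast zs) @ v # bs" using zs' by (simp add: new_def)
    then have "wl new = wl ((as @ v # butlast zs) @ [v]) @ wl (v # bs)" by (elim ssubst) (rule wl_append2)
    also have "(as @ v # butlast zs) @ [v] = as @ v # zs" using zs' by simp
    also have "wl (as @ v # zs) = wl (as @ [v]) @ wl (v # zs)" by (rule wl_append2)
    finally have "mset (wl new) = mset (wl (r # ys)) + mset (wl (v # zs))"
      unfolding ab wl_append2[of as v bs] by simp
    also have "\<dots> \<subseteq># G" using zs(3) G by (metis subset_mset.add_left_mono)
    finally have "?P (tl new)" using hd last by metis
    from ys(2)[OF this] have "length new \<le> Suc (length ys)" using hd by (metis length_Cons Suc_le_mono)
    moreover have "length new = Suc (length ys) + length zs"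
      using arg_cong[OF ab, of length] by (simp add: new_def)
    ultimately show False using zs(2) by simp
  qed
  have step: "b \<in> set (r # ys)" if "a \<in> set (r # ys)" "(a, b) \<in> set_mset G \<union> (set_mset G)\<inverse>" for a b
  proof -
    have "(a, b) \<in># G \<or> (b, a) \<in># G" using that(2) by auto
    then obtain e where e: "e \<in># G" "e = (a, b) \<or> e = (b, a)" by blast
    have "e \<notin># ?R"
    proof
      assume "e \<in># ?R"
      then have "deg ?R a > 0" using e(2) by (auto simp: deg_def dest!: multi_member_split)
      then show False using zero[OF that(1)] by simp
    qed
    then have "e \<in> set (wl (r # ys))" using e(1) G by (metis set_mset_mset union_iff)
    then show ?thesis using wl_set e(2) by fastforce
  qed
  have "v \<in> set (r # ys)" if "(r, v) \<in> (set_mset G \<union> (set_mset G)\<inverse>)\<^sup>*" for v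
    using that by induction (auto intro: step simp del: set_simps, simp)
  then show ?thesis using ys(1) conn by (intro exI[of _ ys]) blast
qed

section \<open>Optimal tours and shortcutting\<close>

lemma finite_tours: "finite (tour_cost w ` {xs. distinct xs \<and> set xs = {0..<n}})"
proof -
  have "finite {xs. set xs \<subseteq> {0..<n} \<and> length xs \<le> n}" by (intro finite_lists_length_le) auto
  then show ?thesis by (intro finite_imageI) (rule finite_subset[rotated], auto dest: distinct_card)
qed

lemma TSP_eq: "TSP n w = Min (tour_cost w ` {xs. distinct xs \<and> set xs = {0..<n}})"
  unfolding TSP_def by (rule arg_cong[where f = Min]) auto

lemma TSP_le_tour:
  assumes "distinct xs" "set xs = {0..<n}"
  shows "TSP n w \<le> tour_cost w xs"
  unfolding TSP_eq using assms by (intro Min_le finite_tours) auto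

lemma TSP_attained: "\<exists>xs. distinct xs \<and> set xs = {0..<n} \<and> tour_cost w xs = TSP n w"
proof -
  have "[0..<n] \<in> {xs. distinct xs \<and> set xs = {0..<n}}" by simp
  then have "TSP n w \<in> tour_cost w ` {xs. distinct xs \<and> set xs = {0..<n}}"
    unfolding TSP_eq by (intro Min_in finite_tours) blast
  then show ?thesis by auto
qed

lemma tour_cost_pl: "xs \<noteq> [] \<Longrightarrow> tour_cost w xs = pl w xs + w (last xs) (hd xs)"
proof -
  assume ne: "xs \<noteq> []"
  have pl: "pl w xs = (\<Sum>i<length xs - 1. w (xs ! i) (xs ! Suc i))" for xs
  proof (induction xs rule: wl.induct)
    case (1 x y xs)
    then show ?case by (simp add: sum.lessThan_Suc_shift del: sum.lessThan_Suc)
  qed auto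
  obtain k where k: "length xs = Suc k" using ne by (cases xs) auto
  have "tour_cost w xs = (\<Sum>i<k. w (xs ! i) (xs ! (Suc i mod Suc k))) + w (xs ! k) (xs ! 0)"
    by (simp add: tour_cost_def k)
  also have "(\<Sum>i<k. w (xs ! i) (xs ! (Suc i mod Suc k))) = pl w xs"
    by (simp add: pl k)
  finally show ?thesis using k ne by (simp add: last_conv_nth hd_conv_nth)
qed

text \<open>Quantifying over the next vertex z makes dropping a repeated vertex an instance of the
  triangle inequality, whatever follows.\<close>

lemma shortcut:
  assumes m: "is_metric n w"
  shows "xs \<noteq> [] \<Longrightarrow> set xs \<subseteq> {0..<n} \<Longrightarrow> \<exists>ys. ys \<noteq> [] \<and> distinct ys \<and> set ys = set xs \<and> hd ys = hd xs
     \<and> (\<forall>z<n. pl w ys + w (last ys) z \<le> pl w xs + w (last xs) z)"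
proof (induction xs rule: rev_induct)
  case (snoc x xs)
  show ?case
  proof (cases "xs = []")
    case True
    then show ?thesis by (intro exI[of _ "[x]"]) auto
  next
    case False
    then obtain ys where ys: "ys \<noteq> []" "distinct ys" "set ys = set xs" "hd ys = hd xs"
      "\<And>z. z < n \<Longrightarrow> pl w ys + w (last ys) z \<le> pl w xs + w (last xs) z" using snoc by auto
    have xn: "x < n" "last xs < n" using snoc.prems False by (auto dest: last_in_set)
    show ?thesis
    proof (cases "x \<in> set xs")
      case True
      have "pl w ys + w (last ys) z \<le> pl w (xs @ [x]) + w (last (xs @ [x])) z" if "z < n" for z
      proof -
        have "w (last xs) z \<le> w (last xs) x + w x z" using m xn that unfolding is_metric_def by blast
        then show ?thesis using ys(5)[OF that] False by (simp add: pl_append)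
      qed
      then show ?thesis using ys True False by (intro exI[of _ ys]) auto
    next
      case nin: False
      have "pl w (ys @ [x]) + w x z \<le> pl w (xs @ [x]) + w (last (xs @ [x])) z" for z
        using ys(5)[OF xn(1)] ys(1) False by (simp add: pl_append)
      then show ?thesis using ys nin False by (intro exI[of _ "ys @ [x]"]) auto
    qed
  qed
qed simp

lemma euler_TSP:
  assumes m: "is_metric n w" and n: "n > 0" and ev: "\<And>v. even (deg G v)"
    and nr: "\<And>e. e \<in># G \<Longrightarrow> fst e \<le> snd e \<and> snd e < n"
    and conn: "\<And>v. v < n \<Longrightarrow> (0, v) \<in> (set_mset G \<union> (set_mset G)\<inverse>)\<^sup>*"
  shows "TSP n w \<le> (\<Sum>e\<in>#G. w (fst e) (snd e))"
proof -
  obtain ys where ys: "last (0 # ys) = 0" "mset (wl (0 # ys)) \<subseteq># G" "{0..<n} \<subseteq> set (0 # ys)"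
    using euler_walk[of G "{0..<n}" 0] ev nr conn by auto
  define xs where "xs = 0 # ys"
  have sub: "set xs \<subseteq> {0..<n}"
  proof -
    have "v \<in> {0..<n}" if vx: "v \<in> set xs" for v
    proof -
      consider "v = 0" | e where "e \<in> set (wl xs)" "fst e = v \<or> snd e = v"
        using wl_cover[OF vx] unfolding xs_def by auto
      then show ?thesis
      proof cases
        case (2 e)
        then have "e \<in># G" using ys(2) unfolding xs_def by (metis mset_subset_eqD set_mset_mset)
        then have "fst e \<le> snd e" "snd e < n" using nr by auto
        then show ?thesis using 2(2) by auto
      qed (use n in simp)
    qed
    then show ?thesis by blast
  qed
  have pl: "pl w zs = (\<Sum>e\<in>#mset (wl zs). w (fst e) (snd e))" if "set zs \<subseteq> {0..<n}" for zs
    using that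
  proof (induction zs rule: wl.induct)
    case (1 x y zs)
    have "w x y = w (min x y) (max x y)" using 1(2) m by (auto simp: is_metric_def min_def max_def)
    then show ?case using 1 by (simp add: nrm_def)
  qed auto
  obtain zs where zs: "zs \<noteq> []" "distinct zs" "set zs = set xs" "hd zs = hd xs"
     "\<And>z. z < n \<Longrightarrow> pl w zs + w (last zs) z \<le> pl w xs + w (last xs) z"
    using shortcut[OF m, of xs] sub by (auto simp: xs_def)
  have "TSP n w \<le> tour_cost w zs" using zs ys(3) sub by (intro TSP_le_tour) (auto simp: xs_def)
  also have "\<dots> = pl w zs + w (last zs) 0" using zs by (simp add: tour_cost_pl xs_def)
  also have "\<dots> \<le> pl w xs + w (last xs) 0" using zs(5) n by blast
  also have "\<dots> = pl w xs" using ys(1) n m by (auto simp: xs_def is_metric_def)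
  also have "\<dots> = (\<Sum>e\<in>#mset (wl xs). w (fst e) (snd e))" by (rule pl[OF sub])
  also have "\<dots> \<le> (\<Sum>e\<in>#G. w (fst e) (snd e))"
    using ys(2) unfolding xs_def by (auto simp: mset_subset_eq_exists_conv)
  finally show ?thesis .
qed

section \<open>Rooted spanning trees\<close>

locale rooted_tree =
  fixes n :: nat and par dep W :: "nat \<Rightarrow> nat"
  assumes n2: "2 \<le> n" and par_less: "0 < v \<Longrightarrow> v < n \<Longrightarrow> par v < n"
    and dep_par: "0 < v \<Longrightarrow> v < n \<Longrightarrow> dep (par v) < dep v"
    and W_pos: "0 < v \<Longrightarrow> v < n \<Longrightarrow> 1 \<le> W v"
begin

text \<open>A non-root vertex also stands for the edge to its parent. So this is the edge set of the
  path from v to the root 0, and \<open>sd x y\<close> is the edge set of the tree path between x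
  and y.\<close>

definition anc :: "nat \<Rightarrow> nat set" where
  "anc v = {u. (v, u) \<in> {(v, par v) | v. 0 < v \<and> v < n}\<^sup>* \<and> 0 < u \<and> u < n}"

definition M :: nat where "M = (\<Sum>e\<in>{1..<n}. W e)"
definition h :: "nat \<Rightarrow> nat" where "h x = (\<Sum>e\<in>anc x. W e)"
definition sd :: "nat \<Rightarrow> nat \<Rightarrow> nat set" where "sd x y = (anc x - anc y) \<union> (anc y - anc x)"
definition dT :: "nat \<Rightarrow> nat \<Rightarrow> nat" where "dT x y = (\<Sum>e\<in>sd x y. W e)"

lemma anc_0: "anc 0 = {}"
proof -
  have "(0, u) \<in> {(v, par v) | v. 0 < v \<and> v < n}\<^sup>* \<Longrightarrow> u = 0" for u
    by (erule converse_rtranclE) auto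
  then show ?thesis by (auto simp: anc_def)
qed

lemma anc_rec: "0 < v \<Longrightarrow> v < n \<Longrightarrow> anc v = insert v (anc (par v))"
proof -
  assume v: "0 < v" "v < n"
  let ?R = "{(v, par v) | v. 0 < v \<and> v < n}"
  have "(v, u) \<in> ?R\<^sup>* \<longleftrightarrow> u = v \<or> (par v, u) \<in> ?R\<^sup>*" for u
  proof
    assume "(v, u) \<in> ?R\<^sup>*"
    then show "u = v \<or> (par v, u) \<in> ?R\<^sup>*" by (cases rule: converse_rtranclE) auto
  next
    have "(v, par v) \<in> ?R" using v by auto
    moreover assume "u = v \<or> (par v, u) \<in> ?R\<^sup>*"
    ultimately show "(v, u) \<in> ?R\<^sup>*" by (auto intro: converse_rtrancl_into_rtrancl)
  qed
  then show ?thesis using v by (auto simp: anc_def)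
qed

lemma anc_sub: "anc v \<subseteq> {1..<n}" by (auto simp: anc_def)

lemma finite_anc: "finite (anc v)" by (rule finite_subset[OF anc_sub]) simp

lemma tree_induct [consumes 1, case_names root step]:
  assumes "v < n" "P 0" "\<And>v. 0 < v \<Longrightarrow> v < n \<Longrightarrow> P (par v) \<Longrightarrow> P v"
  shows "P v"
  using assms(1)
proof (induction "dep v" arbitrary: v rule: less_induct)
  case less
  then show ?case using assms(2,3) par_less dep_par by (cases "v = 0") auto
qed

lemma anc_dep: "v < n \<Longrightarrow> u \<in> anc v \<Longrightarrow> dep u \<le> dep v"
proof (induction v rule: tree_induct)
  case (step v)
  then show ?case using anc_rec dep_par[of v] by fastforce
qed (simp add: anc_0)

lemma notin_anc_par: "0 < v \<Longrightarrow> v < n \<Longrightarrow> v \<notin> anc (par v)"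
  using anc_dep[of "par v" v] dep_par[of v] par_less[of v] by auto

lemma self_anc: "0 < v \<Longrightarrow> v < n \<Longrightarrow> v \<in> anc v"
  by (simp add: anc_rec)

lemma anc_trans: "v < n \<Longrightarrow> u \<in> anc v \<Longrightarrow> anc u \<subseteq> anc v"
proof (induction v rule: tree_induct)
  case (step v)
  then show ?case using anc_rec by fastforce
qed (simp add: anc_0)

lemma anc_comparable: "v < n \<Longrightarrow> u \<in> anc v \<Longrightarrow> u' \<in> anc v \<Longrightarrow> dep u' \<le> dep u \<Longrightarrow> u' \<in> anc u"
proof (induction v rule: tree_induct)
  case (step v)
  show ?case
  proof (cases "u = v")
    case True
    then show ?thesis using step by simp
  next
    case False
    then have u: "u \<in> anc (par v)" using step.prems(1) step.hyps anc_rec by blast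
    have "dep u \<le> dep (par v)" using anc_dep[of "par v" u] u par_less[of v] step.hyps by blast
    also have "\<dots> < dep v" using dep_par step.hyps by blast
    finally have "dep u < dep v" .
    then have "u' \<noteq> v" using step.prems by auto
    then have "u' \<in> anc (par v)" using step.prems(2) anc_rec step.hyps by blast
    then show ?thesis using step.IH u step.prems(3) by blast
  qed
qed (simp add: anc_0)

lemma finite_sd: "finite (sd x y)" by (simp add: sd_def finite_anc)
lemma sd_sub: "sd x y \<subseteq> {1..<n}" using anc_sub by (auto simp: sd_def)
lemma sd_sym: "sd x y = sd y x" by (auto simp: sd_def)

lemma sd_step: "0 < x \<Longrightarrow> x < n \<Longrightarrow> x \<notin> anc y \<Longrightarrow> sd x y = insert x (sd (par x) y) \<and> x \<notin> sd (par x) y"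
  using anc_rec[of x] notin_anc_par[of x] by (auto simp: sd_def)

lemma dT_step: "0 < x \<Longrightarrow> x < n \<Longrightarrow> x \<notin> anc y \<Longrightarrow> dT x y = W x + dT (par x) y"
  using sd_step[of x y] by (simp add: dT_def finite_sd)

lemma dT_sym: "dT x y = dT y x" by (simp add: dT_def sd_sym)
lemma dT_self: "dT x x = 0" by (simp add: dT_def sd_def)
lemma dT_par: "0 < x \<Longrightarrow> x < n \<Longrightarrow> dT x (par x) = W x"
  by (simp add: dT_step notin_anc_par dT_self)

lemma dT_triangle: "dT x z \<le> dT x y + dT y z"
proof -
  have "dT x z \<le> (\<Sum>e\<in>sd x y \<union> sd y z. W e)"
    unfolding dT_def by (intro sum_mono2) (auto simp: finite_sd, auto simp: sd_def)
  also have "\<dots> \<le> dT x y + dT y z" unfolding dT_def by (simp add: finite_sd sum_Un_nat)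
  finally show ?thesis .
qed

lemma h_le_dT: "h a \<le> h x + dT x a"
proof -
  have "h a \<le> (\<Sum>e\<in>anc x \<union> sd x a. W e)"
    unfolding h_def by (intro sum_mono2) (auto simp: finite_anc finite_sd, auto simp: sd_def)
  also have "\<dots> \<le> h x + dT x a" unfolding h_def dT_def by (simp add: finite_sd finite_anc sum_Un_nat)
  finally show ?thesis .
qed

text \<open>Supplies the vertex that can be moved to its parent along the tree path, the step of
  inductions on \<open>dT\<close>.\<close>

lemma distinct_vertices:
  assumes "x < n" "y < n" "x \<noteq> y"
  shows "(0 < x \<and> x \<notin> anc y) \<or> (0 < y \<and> y \<notin> anc x)"
proof (rule ccontr)
  assume neg: "\<not> ?thesis"
  show False
  proof (cases "x = 0 \<or> y = 0")
    case True
    then show False using neg assms anc_0 by auto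
  next
    case False
    then have xy: "x \<in> anc y" "y \<in> anc x" using neg by auto
    have "x \<in> anc (par y)" using xy(1) assms False anc_rec[of y] by auto
    then have "dep x < dep y" using anc_dep[of "par y" x] par_less[of y] dep_par[of y] False assms by fastforce
    moreover have "dep y \<le> dep x" using anc_dep[of x y] xy assms by auto
    ultimately show False by simp
  qed
qed

lemma dT_pos: "x < n \<Longrightarrow> y < n \<Longrightarrow> x \<noteq> y \<Longrightarrow> 1 \<le> dT x y"
  using distinct_vertices[of x y] dT_step[of x y] dT_step[of y x] W_pos[of x] W_pos[of y] dT_sym[of x y] by auto

lemma metric_dT: "is_metric n dT"
  unfolding is_metric_def using dT_self dT_pos dT_sym dT_triangle by auto

lemma le_dT:
  assumes m: "is_metric n w" and wW: "\<And>e. 0 < e \<Longrightarrow> e < n \<Longrightarrow> w e (par e) = W e"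
  shows "x < n \<Longrightarrow> y < n \<Longrightarrow> w x y \<le> dT x y"
proof (induction "dep x + dep y" arbitrary: x y rule: less_induct)
  case less
  have st: "w x y \<le> dT x y" if "0 < x" "x \<notin> anc y" "x < n" "y < n"
      and IH: "w (par x) y \<le> dT (par x) y" for x y
  proof -
    have "w x y \<le> w x (par x) + w (par x) y" using m that par_less[of x] unfolding is_metric_def by blast
    then show ?thesis using IH that wW dT_step[of x y] by simp
  qed
  show ?case
  proof (cases "x = y")
    case True
    then show ?thesis using m less.prems by (simp add: is_metric_def)
  next
    case False
    then consider "0 < x" "x \<notin> anc y" | "0 < y" "y \<notin> anc x" using distinct_vertices less.prems by blast
    then show ?thesis
    proof cases
      case 1
      have "w (par x) y \<le> dT (par x) y" using less.prems 1 par_less dep_par by (intro less.hyps) auto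
      then show ?thesis using st 1 less.prems by blast
    next
      case 2
      have "w x (par y) \<le> dT x (par y)" using less.prems 2 par_less dep_par by (intro less.hyps) auto
      then have "w (par y) x \<le> dT (par y) x" using m less.prems par_less[of y] 2 dT_sym by (auto simp: is_metric_def)
      then have "w y x \<le> dT y x" using st 2 less.prems by blast
      then show ?thesis using m less.prems dT_sym by (simp add: is_metric_def)
    qed
  qed
qed

section \<open>Eulerian multigraphs from a tree and a set of links\<close>

definition crossings :: "('f \<Rightarrow> nat) \<Rightarrow> ('f \<Rightarrow> nat) \<Rightarrow> 'f set \<Rightarrow> nat \<Rightarrow> nat" where
  "crossings qa qb F e = card {f \<in> F. e \<in> sd (qa f) (qb f)}"

lemma anc_incidence: "x < n \<Longrightarrow> even ((\<Sum>e\<in>anc x. of_bool (e = v) + of_bool (par e = v)) + of_bool (x = v) + of_bool (0 = v) :: nat)"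
proof (induction x rule: tree_induct)
  case (step x)
  have "(\<Sum>e\<in>anc x. of_bool (e = v) + of_bool (par e = v) :: nat) + of_bool (x = v) + of_bool (0 = v)
     = 2 * of_bool (x = v) + ((\<Sum>e\<in>anc (par x). of_bool (e = v) + of_bool (par e = v)) + of_bool (par x = v) + of_bool (0 = v))"
    using step.hyps by (simp add: anc_rec notin_anc_par finite_anc)
  then show ?case using step.IH by (simp only: even_add even_mult_iff even_numeral simp_thms)
qed (simp add: anc_0)

text \<open>Each root path becomes even once its two ends are added; in the sum of two such paths
  the common part and the root cancel modulo 2.\<close>

lemma sd_incidence:
  assumes "x < n" "y < n"
  shows "even ((\<Sum>e\<in>sd x y. of_bool (e = v) + of_bool (par e = v)) + of_bool (x = v) + of_bool (y = v) :: nat)"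
proof -
  let ?i = "\<lambda>e. of_bool (e = v) + of_bool (par e = v) :: nat"
  have "sum ?i (anc x) = sum ?i (anc x - anc y) + sum ?i (anc x \<inter> anc y)"
    by (simp add: finite_anc sum.Int_Diff[of "anc x" _ "anc y"] add.commute)
  moreover have "sum ?i (anc y) = sum ?i (anc y - anc x) + sum ?i (anc x \<inter> anc y)"
    by (simp add: finite_anc sum.Int_Diff[of "anc y" _ "anc x"] add.commute Int_commute)
  moreover have "sum ?i (sd x y) = sum ?i (anc x - anc y) + sum ?i (anc y - anc x)"
    unfolding sd_def by (intro sum.union_disjoint) (auto simp: finite_anc)
  ultimately have "sum ?i (anc x) + sum ?i (anc y) = sum ?i (sd x y) + 2 * sum ?i (anc x \<inter> anc y)" by simp
  then have "even (sum ?i (anc x) + sum ?i (anc y)) \<longleftrightarrow> even (sum ?i (sd x y))" by simp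
  then show ?thesis using anc_incidence[OF assms(1), of v] anc_incidence[OF assms(2), of v]
    by (simp only: even_add) blast
qed

lemma deg_image: "finite A \<Longrightarrow> deg (image_mset (\<lambda>x. nrm (p x) (r x)) (mset_set A)) v = (\<Sum>x\<in>A. of_bool (p x = v) + of_bool (r x = v))"
proof (induction A rule: finite_induct)
  case (insert x A)
  have "deg (add_mset (nrm a b) H) v = of_bool (a = v) + of_bool (b = v) + deg H v" for a b H
    using deg_add_mset[of "nrm a b" H v] deg_nrm[of a b v] by simp
  then show ?case using insert by simp
qed (simp add: deg_def)

text \<open>A link and the tree path between its ends form a cycle, so the sum of these cycles has
  even degrees. A tree edge occurs 1 + [crossed evenly] times in \<open>G\<close>, which has the
  same parity as the number of cycles through it.\<close>

lemma TSP_le_cover: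
  fixes qa qb :: "'f \<Rightarrow> nat"
  assumes m: "is_metric n w" and wW: "\<And>e. 0 < e \<Longrightarrow> e < n \<Longrightarrow> w e (par e) = W e"
    and F: "finite F" "\<And>f. f \<in> F \<Longrightarrow> qa f < n \<and> qb f < n"
  shows "TSP n w \<le> M + (\<Sum>e\<in>{e\<in>{1..<n}. even (crossings qa qb F e)}. W e) + (\<Sum>f\<in>F. w (qa f) (qb f))"
proof -
  let ?E = "{1..<n}" and ?D = "{e\<in>{1..<n}. even (crossings qa qb F e)}"
  let ?t = "\<lambda>e. nrm e (par e)"
  define G where "G = image_mset ?t (mset_set ?E) + image_mset ?t (mset_set ?D) + image_mset (\<lambda>f. nrm (qa f) (qb f)) (mset_set F)"
  have ev: "even (deg G v)" for v
  proof -
    let ?i = "\<lambda>e. of_bool (e = v) + of_bool (par e = v) :: nat"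
    let ?c = "crossings qa qb F"
    have "deg G v = sum ?i ?E + sum ?i ?D + (\<Sum>f\<in>F. of_bool (qa f = v) + of_bool (qb f = v))"
      unfolding G_def deg_add using F(1) by (simp add: deg_image)
    moreover have "sum ?i ?E + sum ?i ?D = (\<Sum>e\<in>?E. (1 + of_bool (even (?c e))) * ?i e)"
    proof -
      have "sum ?i ?D = (\<Sum>e\<in>?E. of_bool (even (?c e)) * ?i e)"
      proof -
        have "sum ?i ?D = (\<Sum>e\<in>?E. if even (?c e) then ?i e else 0)" by (rule sum.inter_filter) simp
        also have "\<dots> = (\<Sum>e\<in>?E. of_bool (even (?c e)) * ?i e)" by (intro sum.cong refl) auto
        finally show ?thesis .
      qed
      then show ?thesis by (simp add: sum.distrib[symmetric] algebra_simps)
    qed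
    moreover have "even ((\<Sum>e\<in>?E. (1 + of_bool (even (?c e))) * ?i e) + (\<Sum>e\<in>?E. ?c e * ?i e))"
    proof -
      have "even ((1 + of_bool (even (?c e))) * ?i e + ?c e * ?i e)" for e by (cases "even (?c e)") auto
      then show ?thesis unfolding sum.distrib[symmetric] by (intro dvd_sum) blast
    qed
    moreover have "even ((\<Sum>e\<in>?E. ?c e * ?i e) + (\<Sum>f\<in>F. of_bool (qa f = v) + of_bool (qb f = v)))"
    proof -
      have "(\<Sum>e\<in>?E. ?c e * ?i e) = (\<Sum>e\<in>?E. \<Sum>f\<in>F. if e \<in> sd (qa f) (qb f) then ?i e else 0)"
      proof (intro sum.cong refl)
        fix e
        have "(\<Sum>f\<in>F. if e \<in> sd (qa f) (qb f) then ?i e else 0) = (\<Sum>f\<in>{f\<in>F. e \<in> sd (qa f) (qb f)}. ?i e)"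
          using F(1) by (rule sum.inter_filter[symmetric])
        then show "?c e * ?i e = (\<Sum>f\<in>F. if e \<in> sd (qa f) (qb f) then ?i e else 0)" by (simp add: crossings_def)
      qed
      also have "\<dots> = (\<Sum>f\<in>F. \<Sum>e\<in>?E. if e \<in> sd (qa f) (qb f) then ?i e else 0)" by (rule sum.swap)
      also have "\<dots> = (\<Sum>f\<in>F. sum ?i (sd (qa f) (qb f)))"
      proof (rule sum.cong[OF refl])
        fix f
        have "{e \<in> ?E. e \<in> sd (qa f) (qb f)} = sd (qa f) (qb f)" using sd_sub by blast
        then show "(\<Sum>e\<in>?E. if e \<in> sd (qa f) (qb f) then ?i e else 0) = sum ?i (sd (qa f) (qb f))"
          by (simp add: sum.inter_filter[symmetric])
      qed
      finally have "(\<Sum>e\<in>?E. ?c e * ?i e) + (\<Sum>f\<in>F. of_bool (qa f = v) + of_bool (qb f = v))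
         = (\<Sum>f\<in>F. sum ?i (sd (qa f) (qb f)) + of_bool (qa f = v) + of_bool (qb f = v))" by (simp add: sum.distrib)
      also have "even \<dots>" using F(2) by (intro dvd_sum sd_incidence) auto
      finally show ?thesis .
    qed
    ultimately show ?thesis by (simp only: even_add)
  qed
  have nr: "fst e \<le> snd e \<and> snd e < n" if "e \<in># G" for e
    using that F par_less by (auto simp: G_def nrm_def)
  have conn: "(0, v) \<in> (set_mset G \<union> (set_mset G)\<inverse>)\<^sup>*" if "v < n" for v
    using that
  proof (induction v rule: tree_induct)
    case (step v)
    have "?t v \<in># G" using step.hyps by (auto simp: G_def)
    then have "(par v, v) \<in> set_mset G \<union> (set_mset G)\<inverse>" by (auto simp: nrm_def min_def max_def split: if_splits)
    then show ?case using step.IH by (rule rtrancl_into_rtrancl[rotated])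
  qed simp
  have sym: "w (min a b) (max a b) = w a b" if "a < n" "b < n" for a b
    using m that by (auto simp: is_metric_def min_def max_def)
  have tr: "(\<Sum>e\<in>#image_mset ?t (mset_set A). w (fst e) (snd e)) = (\<Sum>e\<in>A. W e)" if "A \<subseteq> ?E" for A
    using that sym wW par_less by (auto simp: nrm_def sum_unfold_sum_mset[symmetric] multiset.map_comp o_def intro!: sum.cong)
  have "TSP n w \<le> (\<Sum>e\<in>#G. w (fst e) (snd e))"
    using euler_TSP[OF m _ ev nr conn] n2 by simp
  also have "\<dots> = (\<Sum>e\<in>?E. W e) + (\<Sum>e\<in>?D. W e) + (\<Sum>f\<in>F. w (qa f) (qb f))"
  proof -
    have "(\<Sum>e\<in>#image_mset (\<lambda>f. nrm (qa f) (qb f)) (mset_set F). w (fst e) (snd e)) = (\<Sum>f\<in>F. w (qa f) (qb f))"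
      using F(2) sym by (auto simp: nrm_def sum_unfold_sum_mset[symmetric] multiset.map_comp o_def intro!: sum.cong)
    moreover have "?D \<subseteq> ?E" by auto
    ultimately show ?thesis unfolding G_def image_mset_union sum_mset.union using tr[of ?E] tr[of ?D] by simp
  qed
  finally show ?thesis by (simp add: M_def)
qed

lemma TSP_le_double:
  assumes "is_metric n w" "\<And>e. 0 < e \<Longrightarrow> e < n \<Longrightarrow> w e (par e) = W e"
  shows "TSP n w \<le> 2 * M"
proof -
  have "TSP n w \<le> M + (\<Sum>e\<in>{e\<in>{1..<n}. even (crossings id id {} e)}. W e) + 0"
    using TSP_le_cover[OF assms, of "{}" id id] by simp
  moreover have "{e\<in>{1..<n}. even (crossings id id {} e)} = {1..<n}" by (auto simp: crossings_def)
  ultimately show ?thesis unfolding M_def by simp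
qed

text \<open>Doubling the tree in its own metric \<open>dT\<close> yields a tour of length at most 2
  M. Positions along it differ by at least the tree distance, so points with close positions are
  close in the tree.\<close>

lemma ex_pos: "\<exists>pos :: nat \<Rightarrow> nat. \<forall>x<n. pos x \<le> 2 * M \<and> (\<forall>y<n. real (dT x y) \<le> \<bar>real (pos x) - real (pos y)\<bar>)"
proof -
  obtain xs where xs: "distinct xs" "set xs = {0..<n}" "tour_cost dT xs \<le> 2 * M"
    using TSP_attained[of n dT] TSP_le_double[OF metric_dT dT_par] by auto
  have len: "length xs = n" using xs distinct_card by fastforce
  define P where "P i = (\<Sum>k<i. dT (xs ! k) (xs ! Suc k))" for i
  have Pm: "dT (xs ! i) (xs ! j) \<le> P j - P i \<and> P i \<le> P j" if "i \<le> j" for i j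
    using that
  proof (induction j rule: dec_induct)
    case (step j)
    have "P (Suc j) = P j + dT (xs ! j) (xs ! Suc j)" by (simp add: P_def)
    then show ?case using step.IH dT_triangle[of "xs ! i" "xs ! Suc j" "xs ! j"] by linarith
  qed (simp add: dT_self)
  have Pb: "P i \<le> 2 * M" if "i < n" for i
  proof -
    have "P i = (\<Sum>k<i. dT (xs ! k) (xs ! ((k + 1) mod length xs)))" unfolding P_def using that len by (intro sum.cong) auto
    also have "\<dots> \<le> tour_cost dT xs" unfolding tour_cost_def using that len by (intro sum_mono2) auto
    finally show ?thesis using xs(3) by simp
  qed
  have "\<exists>i<n. xs ! i = x" if "x < n" for x using that xs(2) len by (metis atLeastLessThan_iff in_set_conv_nth le0)
  then obtain ix where ix: "\<And>x. x < n \<Longrightarrow> ix x < n \<and> xs ! ix x = x" by metis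
  have "real (dT x y) \<le> \<bar>real (P (ix x)) - real (P (ix y))\<bar>" if "x < n" "y < n" for x y
    using Pm[of "ix x" "ix y"] Pm[of "ix y" "ix x"] ix[OF that(1)] ix[OF that(2)] dT_sym[of x y]
    by (cases "ix x \<le> ix y") auto
  then show ?thesis using Pb ix by (intro exI[of _ "\<lambda>x. P (ix x)"]) auto
qed

end

section \<open>Short tours force saturation\<close>

lemma sum_cyclic: fixes k :: nat shows "(\<Sum>i<k. f ((i + 1) mod k)) = (\<Sum>i<k. f i :: nat)"
proof (cases k)
  case (Suc l)
  have "(\<Sum>i<k. f ((i + 1) mod k)) = (\<Sum>i<l. f ((i + 1) mod k)) + f ((l + 1) mod k)" by (simp add: Suc)
  also have "(\<Sum>i<l. f ((i + 1) mod k)) = (\<Sum>i<l. f (Suc i))" by (intro sum.cong) (auto simp: Suc)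
  finally show ?thesis by (simp add: Suc sum.lessThan_Suc_shift del: sum.lessThan_Suc)
qed simp

context rooted_tree begin

definition seg :: "nat \<Rightarrow> nat \<Rightarrow> nat set" where "seg x e = {e' \<in> anc x. e \<in> anc e'}"

definition up :: "real \<Rightarrow> nat \<Rightarrow> nat set" where "up t x = {e \<in> anc x. real (h x) - real (h (par e)) \<le> t}"

definition near :: "real \<Rightarrow> nat \<Rightarrow> nat \<Rightarrow> nat set" where
  "near t x y = (up t x - anc y) \<union> (up t y - anc x)"

lemma near_sub: "near t x y \<subseteq> sd x y" by (auto simp: near_def up_def sd_def)
lemma finite_near: "finite (near t x y)" by (rule finite_subset[OF near_sub finite_sd])

lemma anc_range: "e \<in> anc x \<Longrightarrow> 0 < e \<and> e < n" using anc_sub by fastforce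

lemma seg_sum:
  assumes x: "x < n" and e: "e \<in> anc x"
  shows "h x = (\<Sum>e\<in>seg x e. W e) + h (par e)"
proof -
  have e0: "0 < e" "e < n" using anc_range[OF e] by auto
  have pe: "par e < n" using par_less e0 by blast
  have "e' \<in> seg x e \<or> e' \<in> anc (par e)" if "e' \<in> anc x" for e'
  proof (cases "dep e \<le> dep e'")
    case True
    then show ?thesis using anc_comparable[OF x that e] that by (simp add: seg_def)
  next
    case False
    then have "e' \<in> anc e" using anc_comparable[OF x e that] by simp
    moreover have "e' \<noteq> e" using False by auto
    ultimately show ?thesis using anc_rec e0 by blast
  qed
  moreover have "anc (par e) \<subseteq> anc x" using anc_trans[OF x e] anc_rec[OF e0] by blast
  ultimately have U: "anc x = seg x e \<union> anc (par e)" by (auto simp: seg_def)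
  have D: "seg x e \<inter> anc (par e) = {}"
  proof -
    have False if "e' \<in> anc (par e)" "e \<in> anc e'" for e'
    proof -
      have "dep e' \<le> dep (par e)" using anc_dep[OF pe that(1)] .
      moreover have "dep e \<le> dep e'" using anc_dep[OF _ that(2)] anc_range[OF that(1)] by blast
      ultimately show False using dep_par[OF e0] by simp
    qed
    then show ?thesis by (auto simp: seg_def)
  qed
  have fin: "finite (seg x e)" by (simp add: seg_def finite_anc)
  have "h x = (\<Sum>e\<in>seg x e \<union> anc (par e). W e)" by (simp add: h_def U[symmetric])
  also have "\<dots> = (\<Sum>e\<in>seg x e. W e) + h (par e)"
    unfolding h_def using D fin finite_anc by (intro sum.union_disjoint) auto
  finally show ?thesis .
qed

lemma h_le_M: "h x \<le> M"
  unfolding h_def M_def by (intro sum_mono2 anc_sub) auto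

lemma dT_le_M: "dT x y \<le> M"
  unfolding dT_def M_def by (intro sum_mono2 sd_sub) auto

text \<open>These edges lie on the vertical segment from x to the topmost of them, whose length is a
  difference of heights.\<close>

lemma up_mass:
  fixes t :: real
  assumes x: "x < n" and t: "0 \<le> t"
  shows "(\<Sum>e\<in>up t x. real (W e)) \<le> t"
proof (cases "up t x = {}")
  case False
  have fin: "finite (up t x)" by (simp add: up_def finite_anc)
  obtain e where e: "e \<in> up t x" "\<And>e'. e' \<in> up t x \<Longrightarrow> dep e \<le> dep e'"
  proof -
    have "Min (dep ` up t x) \<in> dep ` up t x" using fin False by (intro Min_in) auto
    then obtain e where "e \<in> up t x" "dep e = Min (dep ` up t x)" by auto
    then show ?thesis using fin by (intro that[of e]) auto
  qed
  have ex: "e \<in> anc x" using e(1) by (simp add: up_def)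
  have "up t x \<subseteq> seg x e"
    using anc_comparable[OF x _ ex] e(2) by (auto simp: seg_def up_def)
  then have "(\<Sum>e\<in>up t x. real (W e)) \<le> (\<Sum>e\<in>seg x e. real (W e))"
    by (intro sum_mono2) (auto simp: seg_def finite_anc)
  also have "\<dots> = real (h x) - real (h (par e))" using seg_sum[OF x ex] by simp
  also have "\<dots> \<le> t" using e(1) by (simp add: up_def)
  finally show ?thesis .
qed (use t in simp)

lemma near_mass:
  fixes t :: real
  assumes "x < n" "y < n" "0 \<le> t"
  shows "(\<Sum>e\<in>near t x y. real (W e)) \<le> 2 * t"
proof -
  have fin: "finite (up t x)" "finite (up t y)" by (auto simp: up_def finite_anc)
  have "(\<Sum>e\<in>near t x y. real (W e)) \<le> (\<Sum>e\<in>up t x \<union> up t y. real (W e))"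
    using fin by (intro sum_mono2) (auto simp: near_def)
  also have "\<dots> \<le> (\<Sum>e\<in>up t x. real (W e)) + (\<Sum>e\<in>up t y. real (W e))"
    using fin by (simp add: sum_Un sum_nonneg)
  also have "\<dots> \<le> t + t" using assms by (intro add_mono up_mass)
  finally show ?thesis by simp
qed

text \<open>Moving an end by d changes its height by at most d, and an edge that enters or leaves a
  root path lies between the old and the new end.\<close>

lemma near_shift:
  assumes "real (dT x a) \<le> d" "real (dT y b) \<le> d"
  shows "near t x y \<subseteq> near (t + d) a b \<union> sd x a \<union> sd y b"
proof -
  have *: "e \<in> up (t + d) a - anc b \<union> sd x a \<union> sd y b" if "e \<in> up t x - anc y" "real (dT x a) \<le> d" for e x y a b
  proof -
    have "real (h a) \<le> real (h x) + d" using h_le_dT[of a x] that(2) by linarith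
    then show ?thesis using that(1) by (auto simp: up_def sd_def)
  qed
  show ?thesis
  proof
    fix e assume "e \<in> near t x y"
    then consider "e \<in> up t x - anc y" | "e \<in> up t y - anc x" by (auto simp: near_def)
    then show "e \<in> near (t + d) a b \<union> sd x a \<union> sd y b"
    proof cases
      case 1 from *[OF 1 assms(1), of b] show ?thesis by (auto simp: near_def)
    next
      case 2 from *[OF 2 assms(2), of a] show ?thesis by (auto simp: near_def)
    qed
  qed
qed

lemma near_shift_sum:
  fixes X :: "nat \<Rightarrow> real" and d t :: real
  assumes "real (dT x a) \<le> d" "real (dT y b) \<le> d" and X: "\<And>e. 0 \<le> X e \<and> X e \<le> (1::real)"
  shows "(\<Sum>e\<in>near t x y - Bu. W e * X e) \<le> (\<Sum>e\<in>near (t + d) a b - Bu. W e * X e) + 2 * d"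
proof -
  have sdb: "(\<Sum>e\<in>sd x a. W e * X e) \<le> real (dT x a)" for x a
    unfolding dT_def of_nat_sum using X by (intro sum_mono) (simp add: mult_left_le)
  have nn: "0 \<le> (\<Sum>e\<in>A. W e * X e)" for A using X by (intro sum_nonneg) simp
  have un: "(\<Sum>e\<in>A \<union> B. W e * X e) \<le> (\<Sum>e\<in>A. W e * X e) + (\<Sum>e\<in>B. W e * X e)" if "finite A" "finite B" for A B
    using that nn[of "A \<inter> B"] by (simp add: sum_Un)
  have "(\<Sum>e\<in>near t x y - Bu. W e * X e) \<le> (\<Sum>e\<in>(near (t + d) a b - Bu) \<union> (sd x a \<union> sd y b). W e * X e)"
    using near_shift[OF assms(1,2), of t] X by (intro sum_mono2) (auto simp: finite_near finite_sd)
  also have "\<dots> \<le> (\<Sum>e\<in>near (t + d) a b - Bu. W e * X e) + (\<Sum>e\<in>sd x a \<union> sd y b. W e * X e)"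
    by (rule un) (auto simp: finite_near finite_sd)
  also have "(\<Sum>e\<in>sd x a \<union> sd y b. W e * X e) \<le> (\<Sum>e\<in>sd x a. W e * X e) + (\<Sum>e\<in>sd y b. W e * X e)"
    by (rule un) (auto simp: finite_sd)
  also have "\<dots> \<le> 2 * d" using sdb[of x a] sdb[of y b] assms(1,2) by linarith
  finally show ?thesis by simp
qed

lemma bushy_mass:
  fixes t :: real
  assumes R: "finite R" "R \<subseteq> {0..<n}" and t: "0 \<le> t"
  shows "(\<Sum>e\<in>{1..<n}. W e * real (card {a \<in> R. e \<in> up t a})) \<le> card R * t"
proof -
  have "(\<Sum>e\<in>{1..<n}. W e * real (card {a \<in> R. e \<in> up t a})) = (\<Sum>e\<in>{1..<n}. \<Sum>a\<in>R. if e \<in> up t a then real (W e) else 0)"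
    using R(1) by (intro sum.cong refl) (simp add: sum.inter_filter[symmetric] mult.commute)
  also have "\<dots> = (\<Sum>a\<in>R. \<Sum>e\<in>{1..<n}. if e \<in> up t a then real (W e) else 0)" by (rule sum.swap)
  also have "\<dots> = (\<Sum>a\<in>R. \<Sum>e\<in>up t a. real (W e))"
  proof (rule sum.cong[OF refl])
    fix a
    have "{e \<in> {1..<n}. e \<in> up t a} = up t a" using anc_sub[of a] by (auto simp: up_def)
    then show "(\<Sum>e\<in>{1..<n}. if e \<in> up t a then real (W e) else 0) = (\<Sum>e\<in>up t a. real (W e))"
      by (simp add: sum.inter_filter[symmetric])
  qed
  also have "\<dots> \<le> (\<Sum>a\<in>R. t)" using R(2) t by (intro sum_mono up_mass) auto
  finally show ?thesis by simp
qed

text \<open>Around a cycle the side of e changes an even number of times, and at least once, because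
  the root and the lower end of e are on different sides.\<close>

lemma tour_crosses_twice:
  assumes xs: "distinct xs" "set xs = {0..<n}" and e: "e \<in> {1..<n}"
  shows "2 \<le> card {i. i < n \<and> e \<in> sd (xs ! i) (xs ! ((i + 1) mod n))}"
proof -
  have len: "length xs = n" using xs distinct_card by fastforce
  define b :: "nat \<Rightarrow> nat" where "b i = of_bool (e \<in> anc (xs ! i))" for i
  let ?C = "{i. i < n \<and> e \<in> sd (xs ! i) (xs ! ((i + 1) mod n))}"
  have C: "?C = {i \<in> {..<n}. b i \<noteq> b ((i + 1) mod n)}" by (auto simp: b_def sd_def)
  have "card ?C = (\<Sum>i<n. of_bool (b i \<noteq> b ((i + 1) mod n)))"
  proof -
    have "card ?C = (\<Sum>i\<in>{i \<in> {..<n}. b i \<noteq> b ((i + 1) mod n)}. 1)" unfolding C by simp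
    also have "\<dots> = (\<Sum>i<n. if b i \<noteq> b ((i + 1) mod n) then 1 else 0)" by (rule sum.inter_filter) simp
    finally show ?thesis by (simp only: of_bool_def)
  qed
  moreover have "even ((\<Sum>i<n. of_bool (b i \<noteq> b ((i + 1) mod n)) :: nat) + (\<Sum>i<n. b i + b ((i + 1) mod n)))"
  proof -
    have "even (of_bool (b i \<noteq> b j) + (b i + b j))" for i j by (auto simp: b_def)
    then have "even (\<Sum>i<n. of_bool (b i \<noteq> b ((i + 1) mod n)) + (b i + b ((i + 1) mod n)))" by (intro dvd_sum) blast
    then show ?thesis by (simp only: sum.distrib)
  qed
  moreover have "(\<Sum>i<n. b i + b ((i + 1) mod n)) = 2 * (\<Sum>i<n. b i)"
    using sum_cyclic[of b n] by (simp add: sum.distrib)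
  ultimately have ev: "even (card ?C)" by (simp only: even_add even_mult_iff even_numeral simp_thms)
  have "?C \<noteq> {}"
  proof
    assume emp: "?C = {}"
    have const: "i < n \<Longrightarrow> b i = b 0" for i
    proof (induction i)
      case (Suc i)
      have "{i \<in> {..<n}. b i \<noteq> b ((i + 1) mod n)} = {}" using emp C by (simp only:)
      moreover have "i \<in> {..<n}" using Suc.prems by simp
      ultimately have "b i = b ((i + 1) mod n)" by blast
      moreover have "(i + 1) mod n = Suc i" using Suc.prems by simp
      moreover have "b i = b 0" using Suc by simp
      ultimately show ?case by simp
    qed simp
    have "e \<in> set xs" "0 \<in> set xs" using xs e n2 by auto
    then obtain i j where ij: "i < n" "xs ! i = e" "j < n" "xs ! j = 0"
      using len by (auto simp: in_set_conv_nth)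
    have "b i = 1" using ij e self_anc by (simp add: b_def)
    moreover have "b j = 0" using ij by (simp add: b_def anc_0)
    ultimately show False using const[OF ij(1)] const[OF ij(3)] by linarith
  qed
  then have "card ?C \<noteq> 0" by (simp add: card_eq_0_iff)
  moreover obtain k where "card ?C = 2 * k" using ev by blast
  moreover have "2 \<le> c" if "c \<noteq> 0" "c = 2 * k" for c k :: nat using that by arith
  ultimately show ?thesis by blast
qed

text \<open>Choosing the segments from the top down, a segment that meets an earlier one would have its top
  edge covered already.\<close>

lemma disjoint_segments:
  assumes "finite Z" "\<And>e. e \<in> Z \<Longrightarrow> e \<in> anc (f e) \<and> f e < n"
  shows "\<exists>Z'\<subseteq>Z. (\<forall>e\<in>Z'. \<forall>e'\<in>Z'. e \<noteq> e' \<longrightarrow> seg (f e) e \<inter> seg (f e') e' = {}) \<and> Z \<subseteq> (\<Union>e\<in>Z'. seg (f e) e)"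
  using assms
proof (induction "card Z" arbitrary: Z)
  case 0
  then show ?case by auto
next
  case (Suc k)
  then have "Z \<noteq> {}" by auto
  obtain e where e: "e \<in> Z" "\<And>e'. e' \<in> Z \<Longrightarrow> dep e' \<le> dep e"
  proof -
    have "Max (dep ` Z) \<in> dep ` Z" using Suc.prems \<open>Z \<noteq> {}\<close> by (intro Max_in) auto
    then obtain e where "e \<in> Z" "dep e = Max (dep ` Z)" by auto
    then show ?thesis using Suc.prems by (intro that[of e]) auto
  qed
  have "\<exists>Z'\<subseteq>Z - {e}. (\<forall>e\<in>Z'. \<forall>e'\<in>Z'. e \<noteq> e' \<longrightarrow> seg (f e) e \<inter> seg (f e') e' = {}) \<and> Z - {e} \<subseteq> (\<Union>e\<in>Z'. seg (f e) e)"
    using Suc.hyps(2) Suc.prems e(1) by (intro Suc.hyps(1)) auto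
  then obtain Z' where Z0: "Z' \<subseteq> Z - {e}" "\<forall>e\<in>Z'. \<forall>e'\<in>Z'. e \<noteq> e' \<longrightarrow> seg (f e) e \<inter> seg (f e') e' = {}"
    "Z - {e} \<subseteq> (\<Union>e\<in>Z'. seg (f e) e)" by (elim exE conjE) (rule that)
  have Z': "Z' \<subseteq> Z - {e}" "\<And>a b. a \<in> Z' \<Longrightarrow> b \<in> Z' \<Longrightarrow> a \<noteq> b \<Longrightarrow> seg (f a) a \<inter> seg (f b) b = {}"
    "Z - {e} \<subseteq> (\<Union>e\<in>Z'. seg (f e) e)" using Z0 by simp_all
  show ?case
  proof (cases "e \<in> (\<Union>e\<in>Z'. seg (f e) e)")
    case True
    then have "Z \<subseteq> (\<Union>e\<in>Z'. seg (f e) e)" using Z0(3) by blast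
    moreover have "Z' \<subseteq> Z" using Z0(1) by blast
    ultimately show ?thesis using Z0(2) by (intro exI[of _ Z'] conjI)
  next
    case False
    have dis: "seg (f e) e \<inter> seg (f a) a = {}" if a: "a \<in> Z'" for a
    proof (rule ccontr)
      assume "seg (f e) e \<inter> seg (f a) a \<noteq> {}"
      then obtain g where g: "e \<in> anc g" "a \<in> anc g" "g \<in> anc (f a)" by (auto simp: seg_def)
      have gn: "g < n" using anc_range[OF g(3)] by simp
      have "a \<in> Z" using a Z' by blast
      then have "a \<in> anc e" using anc_comparable[OF gn g(1,2)] e(2) by blast
      moreover have "e \<in> anc (f a)" using anc_trans[OF _ g(3)] g(1) Suc.prems(2)[OF \<open>a \<in> Z\<close>] by blast
      ultimately show False using False a by (auto simp: seg_def)
    qed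
    have "e \<in> seg (f e) e"
      using Suc.prems(2)[OF e(1)] self_anc anc_range by (auto simp: seg_def)
    then have cov: "Z \<subseteq> (\<Union>e\<in>insert e Z'. seg (f e) e)" using Z'(3) by blast
    have "seg (f a) a \<inter> seg (f b) b = {}" if "a \<in> insert e Z'" "b \<in> insert e Z'" "a \<noteq> b" for a b
      using that dis[of a] dis[of b] Z'(2)[of a b] by blast
    moreover have "insert e Z' \<subseteq> Z" using Z'(1) e(1) by blast
    ultimately show ?thesis using cov by (intro exI[of _ "insert e Z'"] conjI ballI impI)
  qed
qed

text \<open>Links shorter than s0 are treated as having length s0, at a total cost of n s0. Edges
  outside \<open>Z\<close> are near an end of every tour link that crosses them: such a link carries
  at most 132/100 * 113/100 < 150/100 of its length, and two crossings per edge halve this to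
  75/100. Edges in \<open>Z\<close> have a crossing far from both ends.\<close>

lemma short_tour_saturates:
  fixes X :: "nat \<Rightarrow> real" and s0 :: real and S :: "real set" and w :: "nat \<Rightarrow> nat \<Rightarrow> nat"
  assumes xs: "distinct xs" "set xs = {0..<n}"
    and X: "\<And>e. 0 \<le> X e \<and> X e \<le> (1::real)" and s0: "0 < s0"
    and wsym: "\<And>x y. x < n \<Longrightarrow> y < n \<Longrightarrow> w x y = w y x" and wM: "\<And>x y. x < n \<Longrightarrow> y < n \<Longrightarrow> w x y \<le> M" and s0M: "s0 \<le> M"
    and HP: "\<And>x y (s::real). x < n \<Longrightarrow> y < n \<Longrightarrow> s \<in> S \<Longrightarrow> real (w x y) \<le> 98/100 * s \<Longrightarrow>
        (\<Sum>e\<in>near (99 * s) x y - Bu. W e * X e) \<le> 132/100 * s"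
    and SC: "\<And>v::real. s0 \<le> v \<Longrightarrow> v \<le> M \<Longrightarrow> \<exists>s\<in>S. v \<le> 98/100 * s \<and> s \<le> 113/100 * v"
  shows "(\<Sum>e\<in>{1..<n} - Bu. W e * X e) \<le> 3/100 * M + 75/100 * (tour_cost w xs + n * s0)"
proof -
  have len: "length xs = n" using xs distinct_card by fastforce
  define u v where "u i = xs ! i" and "v i = xs ! ((i + 1) mod n)" for i
  have uv: "u i < n" "v i < n" if "i < n" for i
    using that xs len nth_mem[of i xs] nth_mem[of "(i + 1) mod n" xs] n2 by (auto simp: u_def v_def)
  define l where "l i = max (real (w (u i) (v i))) s0" for i
  have "\<exists>s\<in>S. l i \<le> 98/100 * s \<and> s \<le> 113/100 * l i" if "i < n" for i
  proof (rule SC)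
    show "s0 \<le> l i" "l i \<le> M" using wM[OF uv[OF that]] s0M by (auto simp: l_def)
  qed
  then obtain s where s: "\<And>i. i < n \<Longrightarrow> s i \<in> S \<and> l i \<le> 98/100 * s i \<and> s i \<le> 113/100 * l i" by metis
  define nr where "nr i = near (99 * s i) (u i) (v i)" for i
  have WX: "0 \<le> W e * X e" for e using X by simp
  have far: "\<exists>x. e \<in> anc x \<and> x < n \<and> (\<Sum>e\<in>seg x e - Bu. W e * X e) \<le> 3/100 * (\<Sum>e\<in>seg x e. real (W e))"
    if F: "x < n" "y < n" "e \<in> anc x - anc y" "e \<notin> up (99 * s) x" "max (real (w x y)) s0 \<le> 98/100 * s" for e x y s
  proof -
    have F5: "real (w x y) \<le> 98/100 * s" "s0 \<le> 98/100 * s" using F(5) by auto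
    define d where "d = real (h x) - real (h (par e))"
    have d: "d = (\<Sum>e\<in>seg x e. real (W e))" using seg_sum[of x e] F by (simp add: d_def)
    have dgt: "d > 99 * s" using F by (auto simp: up_def d_def)
    have "d \<le> M" using h_le_M[of x] by (simp add: d_def)
    \<comment> \<open>The segment from x up to e has length d > 99 s. At a scale near d/50 the link
      is still short, while 99 s' >= d, so the whole segment is near x. Its unsaturated weight is at
      most 132/100 * 113/100 * d/50, below 3/100 * d.\<close>
    then obtain s' where s': "s' \<in> S" "d / 50 \<le> 98/100 * s'" "s' \<le> 113/100 * (d / 50)"
      using SC[of "d / 50"] dgt F5 s0 by auto
    have "real (w x y) \<le> 98/100 * s'" using s' dgt F5 s0 by auto
    then have 1: "(\<Sum>e\<in>near (99 * s') x y - Bu. W e * X e) \<le> 132/100 * s'" using HP F s' by blast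
    have "seg x e \<subseteq> near (99 * s') x y"
    proof
      fix e' assume e': "e' \<in> seg x e"
      then have 2: "e' \<in> anc x" "e \<in> anc e'" by (auto simp: seg_def)
      have e'n: "e' < n" "0 < e'" using anc_range[OF 2(1)] by auto
      have "e' \<notin> anc y" using anc_trans[of y e'] F 2 by blast
      moreover have "h (par e) \<le> h (par e')"
      proof (cases "e' = e")
        case False
        then have "e \<in> anc (par e')" using 2(2) anc_rec[of e'] e'n by auto
        then show ?thesis using seg_sum[of "par e'" e] par_less e'n by simp
      qed simp
      then have "real (h x) - real (h (par e')) \<le> d" by (simp add: d_def)
      then have "e' \<in> up (99 * s') x" using 2 s' dgt F5 s0 by (auto simp: up_def)
      ultimately show "e' \<in> near (99 * s') x y" by (simp add: near_def)
    qed
    then have "(\<Sum>e\<in>seg x e - Bu. W e * X e) \<le> (\<Sum>e\<in>near (99 * s') x y - Bu. W e * X e)"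
      using WX by (intro sum_mono2) (auto simp: finite_near)
    also note 1
    also have "132/100 * s' \<le> 3/100 * d" using s' dgt F5 s0 by simp
    finally show ?thesis using F(1,3) unfolding d by blast
  qed
  define Z where "Z = {e \<in> {1..<n}. \<exists>i<n. e \<in> sd (u i) (v i) - nr i}"
  have "\<exists>x. e \<in> anc x \<and> x < n \<and> (\<Sum>e\<in>seg x e - Bu. W e * X e) \<le> 3/100 * (\<Sum>e\<in>seg x e. real (W e))" if eZ: "e \<in> Z" for e
  proof -
    obtain i where i: "i < n" "e \<in> sd (u i) (v i)" "e \<notin> nr i" using eZ unfolding Z_def by blast
    have ls: "max (real (w (u i) (v i))) s0 \<le> 98/100 * s i" using s[OF i(1)] by (simp add: l_def)
    then have ls': "max (real (w (v i) (u i))) s0 \<le> 98/100 * s i" using wsym[OF uv[OF i(1)]] by simp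
    consider "e \<in> anc (u i) - anc (v i)" "e \<notin> up (99 * s i) (u i)" | "e \<in> anc (v i) - anc (u i)" "e \<notin> up (99 * s i) (v i)"
      using i by (auto simp: sd_def nr_def near_def)
    then show ?thesis
    proof cases
      case 1 then show ?thesis using far[OF uv[OF i(1)] _ _ ls] by blast
    next
      case 2 then show ?thesis using far[OF uv(2,1)[OF i(1)] _ _ ls'] by blast
    qed
  qed
  then obtain f where f: "\<And>e. e \<in> Z \<Longrightarrow> e \<in> anc (f e) \<and> f e < n"
    "\<And>e. e \<in> Z \<Longrightarrow> (\<Sum>e\<in>seg (f e) e - Bu. W e * X e) \<le> 3/100 * (\<Sum>e\<in>seg (f e) e. real (W e))" by metis
  have finZ: "finite Z" by (simp add: Z_def)
  have "\<exists>Z'\<subseteq>Z. (\<forall>e\<in>Z'. \<forall>e'\<in>Z'. e \<noteq> e' \<longrightarrow> seg (f e) e \<inter> seg (f e') e' = {}) \<and> Z \<subseteq> (\<Union>e\<in>Z'. seg (f e) e)"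
    by (rule disjoint_segments[OF finZ]) (rule f(1))
  then obtain Z' where Z': "Z' \<subseteq> Z" "\<forall>e\<in>Z'. \<forall>e'\<in>Z'. e \<noteq> e' \<longrightarrow> seg (f e) e \<inter> seg (f e') e' = {}" "Z \<subseteq> (\<Union>e\<in>Z'. seg (f e) e)"
    by (elim exE conjE) (rule that)
  have finZ': "finite Z'" using Z'(1) finZ by (rule finite_subset)
  have fs: "finite (seg x e)" for x e by (simp add: seg_def finite_anc)
  have "(\<Sum>e\<in>Z - Bu. W e * X e) \<le> (\<Sum>e\<in>(\<Union>e\<in>Z'. seg (f e) e - Bu). W e * X e)"
    using Z'(3) WX finZ' fs by (intro sum_mono2) auto
  also have "\<dots> = (\<Sum>e\<in>Z'. \<Sum>g\<in>seg (f e) e - Bu. W g * X g)"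
    using Z'(2) finZ' fs by (intro sum.UNION_disjoint) auto
  also have "\<dots> \<le> (\<Sum>e\<in>Z'. 3/100 * (\<Sum>g\<in>seg (f e) e. real (W g)))"
    using Z'(1) f(2) by (intro sum_mono) blast
  also have "\<dots> = 3/100 * (\<Sum>g\<in>(\<Union>e\<in>Z'. seg (f e) e). real (W g))"
    using Z'(2) finZ' fs by (subst sum.UNION_disjoint) (auto simp: sum_distrib_left)
  also have "\<dots> \<le> 3/100 * M"
    unfolding M_def of_nat_sum using anc_sub by (intro mult_left_mono sum_mono2) (auto simp: seg_def)
  finally have ZB: "(\<Sum>e\<in>Z - Bu. W e * X e) \<le> 3/100 * M" .
  let ?R = "{1..<n} - Bu - Z"
  have "2 * (\<Sum>e\<in>?R. W e * X e) \<le> (\<Sum>e\<in>?R. \<Sum>i<n. if e \<in> nr i then W e * X e else 0)"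
    unfolding sum_distrib_left
  proof (rule sum_mono)
    fix e assume e: "e \<in> ?R"
    have "{i. i < n \<and> e \<in> sd (xs ! i) (xs ! ((i + 1) mod n))} \<subseteq> {i \<in> {..<n}. e \<in> nr i}"
      using e by (auto simp: Z_def u_def v_def)
    then have "2 \<le> card {i \<in> {..<n}. e \<in> nr i}"
      using e by (intro order_trans[OF tour_crosses_twice[OF xs, of e] card_mono]) auto
    then have "2 * (W e * X e) \<le> card {i \<in> {..<n}. e \<in> nr i} * (W e * X e)" using WX by (intro mult_right_mono) auto
    also have "\<dots> = (\<Sum>i<n. if e \<in> nr i then W e * X e else 0)" by (simp add: sum.inter_filter[symmetric])
    finally show "2 * (W e * X e) \<le> \<dots>" .
  qed
  also have "\<dots> = (\<Sum>i<n. \<Sum>e\<in>?R. if e \<in> nr i then W e * X e else 0)" by (rule sum.swap)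
  also have "\<dots> \<le> (\<Sum>i<n. 150/100 * (real (w (u i) (v i)) + s0))"
  proof (rule sum_mono)
    fix i assume "i \<in> {..<n}"
    then have i: "i < n" by simp
    have "(\<Sum>e\<in>?R. if e \<in> nr i then W e * X e else 0) = (\<Sum>e\<in>{e \<in> ?R. e \<in> nr i}. W e * X e)"
      by (rule sum.inter_filter[symmetric]) simp
    also have "\<dots> \<le> (\<Sum>e\<in>nr i - Bu. W e * X e)" using WX by (intro sum_mono2) (auto simp: nr_def finite_near)
    also have "\<dots> \<le> 132/100 * s i"
      unfolding nr_def using s[OF i] uv[OF i] by (intro HP) (auto simp: l_def)
    also have "\<dots> \<le> 150/100 * l i" using s[OF i] s0 by (auto simp: l_def)
    also have "\<dots> \<le> 150/100 * (real (w (u i) (v i)) + s0)" using s0 by (auto simp: l_def)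
    finally show "(\<Sum>e\<in>?R. if e \<in> nr i then W e * X e else 0) \<le> 150/100 * (real (w (u i) (v i)) + s0)" .
  qed
  also have "\<dots> = 150/100 * (tour_cost w xs + n * s0)"
  proof -
    have "(\<Sum>i<n. real (w (u i) (v i)) + s0) = tour_cost w xs + n * s0"
      by (simp add: tour_cost_def u_def v_def len sum.distrib)
    then show ?thesis by (simp only: sum_distrib_left[symmetric])
  qed
  finally have RB: "(\<Sum>e\<in>?R. W e * X e) \<le> 75/100 * (tour_cost w xs + n * s0)" by simp
  have "(\<Sum>e\<in>{1..<n} - Bu. W e * X e) = (\<Sum>e\<in>?R. W e * X e) + (\<Sum>e\<in>Z - Bu. W e * X e)"
  proof -
    have U: "{1..<n} - Bu = ?R \<union> (Z - Bu)" by (auto simp: Z_def)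
    have "(\<Sum>e\<in>?R \<union> (Z - Bu). W e * X e) = (\<Sum>e\<in>?R. W e * X e) + (\<Sum>e\<in>Z - Bu. W e * X e)"
      using finZ by (intro sum.union_disjoint) auto
    then show ?thesis using U by metis
  qed
  then show ?thesis using ZB RB by linarith
qed

end

section \<open>The estimation algorithm\<close>

text \<open>Depth is the distance from 0 in T. Since it drops towards the parent, no edge is the
  parent edge of two vertices, and the n - 1 parent edges exhaust T by counting.\<close>

lemma spanning_tree_parents:
  assumes T: "is_spanning_tree n T" and n: "2 \<le> n"
  shows "\<exists>par dep. (\<forall>v. 0 < v \<and> v < n \<longrightarrow> par v < n \<and> dep (par v) < (dep v :: nat)) \<and>
     bij_betw (\<lambda>v. nrm v (par v)) {1..<n} T"
proof -
  let ?R = "T \<union> T\<inverse>"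
  have Tsub: "T \<subseteq> {(u, v). u < v \<and> v < n}" and cT: "card T = n - 1"
    and conn: "\<And>u v. u < n \<Longrightarrow> v < n \<Longrightarrow> (u, v) \<in> ?R\<^sup>*" using T by (auto simp: is_spanning_tree_def)
  define dep where "dep v = (LEAST k. (0, v) \<in> ?R ^^ k)" for v
  have ex: "\<exists>u. u < n \<and> dep u < dep v \<and> nrm v u \<in> T" if v: "0 < v" "v < n" for v
  proof -
    have "(0, v) \<in> ?R\<^sup>*" using conn v n by auto
    then have "\<exists>k. (0, v) \<in> ?R ^^ k" by (simp add: rtrancl_power)
    then have d: "(0, v) \<in> ?R ^^ dep v" unfolding dep_def by (rule LeastI_ex)
    have "dep v \<noteq> 0"
    proof
      assume "dep v = 0"
      then show False using d v by simp
    qed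
    then obtain k where k: "dep v = Suc k" by (cases "dep v") auto
    then obtain u where u: "(0, u) \<in> ?R ^^ k" "(u, v) \<in> ?R" using d by auto
    have "dep u \<le> k" unfolding dep_def using u(1) by (rule Least_le)
    moreover have "u < n" using u(2) Tsub by auto
    moreover have "nrm v u \<in> T" using u(2) Tsub by (auto simp: nrm_def min_def max_def)
    ultimately show ?thesis using k by (intro exI[of _ u]) auto
  qed
  then obtain par where par: "\<And>v. 0 < v \<Longrightarrow> v < n \<Longrightarrow> par v < n \<and> dep (par v) < dep v \<and> nrm v (par v) \<in> T" by metis
  have inj: "inj_on (\<lambda>v. nrm v (par v)) {1..<n}"
  proof (rule inj_onI)
    fix v v' assume v: "v \<in> {1..<n}" "v' \<in> {1..<n}" and eq: "nrm v (par v) = nrm v' (par v')"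
    show "v = v'"
    proof (rule ccontr)
      assume "v \<noteq> v'"
      then have "v = par v'" "v' = par v" using eq by (auto simp: nrm_def min_def max_def split: if_splits)
      then show False using par[of v] par[of v'] v by auto
    qed
  qed
  have fin: "finite T" using Tsub by (rule finite_subset) (auto intro: finite_subset[of _ "{..<n} \<times> {..<n}"])
  have "(\<lambda>v. nrm v (par v)) ` {1..<n} = T"
  proof (rule card_subset_eq[OF fin])
    show "(\<lambda>v. nrm v (par v)) ` {1..<n} \<subseteq> T" using par by auto
    show "card ((\<lambda>v. nrm v (par v)) ` {1..<n}) = card T" using card_image[OF inj] cT by simp
  qed
  then show ?thesis using inj par by (intro exI[of _ par] exI[of _ dep]) (auto simp: bij_betw_def)
qed

text \<open>Dropping the closing edge of a tour leaves a Hamiltonian path, which is a spanning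
  tree.\<close>

lemma MST_le_tour:
  assumes mst: "is_MST n w T" and m: "is_metric n w" and n: "2 \<le> n" and xs: "distinct xs" "set xs = {0..<n}"
  shows "tree_weight w T \<le> tour_cost w xs"
proof -
  have len: "length xs = n" using xs distinct_card by fastforce
  define t where "t i = nrm (xs ! i) (xs ! Suc i)" for i
  have xn: "xs ! i < n" if "i < n" for i using that xs len nth_mem[of i xs] by auto
  have ne: "xs ! i \<noteq> xs ! j" if "i < n" "j < n" "i \<noteq> j" for i j using that xs(1) len by (simp add: nth_eq_iff_index_eq)
  have inj: "inj_on t {..<n - 1}"
  proof (rule inj_onI)
    fix i j assume ij: "i \<in> {..<n - 1}" "j \<in> {..<n - 1}" and eq: "t i = t j"
    have idx: "xs ! a = xs ! b \<longleftrightarrow> a = b" if "a < n" "b < n" for a b using that xs(1) len by (simp add: nth_eq_iff_index_eq)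
    have "(xs ! i = xs ! j \<and> xs ! Suc i = xs ! Suc j) \<or> (xs ! i = xs ! Suc j \<and> xs ! Suc i = xs ! j)"
      using eq by (auto simp: t_def nrm_def min_def max_def split: if_splits)
    then show "i = j" using ij idx[of i j] idx[of i "Suc j"] idx[of "Suc i" j] by auto
  qed
  let ?T = "t ` {..<n - 1}"
  have R: "(xs ! i, xs ! Suc i) \<in> ?T \<union> ?T\<inverse>" if "i < n - 1" for i
  proof -
    have "t i \<in> ?T" using that by auto
    then show ?thesis unfolding t_def nrm_def min_def max_def by (auto split: if_splits)
  qed
  have r0: "i < n \<Longrightarrow> (xs ! 0, xs ! i) \<in> (?T \<union> ?T\<inverse>)\<^sup>*" for i
  proof (induction i)
    case (Suc i)
    then have "(xs ! 0, xs ! i) \<in> (?T \<union> ?T\<inverse>)\<^sup>*" by simp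
    moreover have "(xs ! i, xs ! Suc i) \<in> ?T \<union> ?T\<inverse>" using Suc.prems by (intro R) simp
    ultimately show ?case by (rule rtrancl_into_rtrancl)
  qed simp
  have sym: "sym ((?T \<union> ?T\<inverse>)\<^sup>*)" by (intro sym_rtrancl) (auto simp: sym_def)
  have "(u, v) \<in> (?T \<union> ?T\<inverse>)\<^sup>*" if uv: "u < n" "v < n" for u v
  proof -
    have "u \<in> set xs" "v \<in> set xs" using uv xs by auto
    then obtain i j where ij: "i < n" "xs ! i = u" "j < n" "xs ! j = v" using len by (auto simp: in_set_conv_nth)
    have "(u, xs ! 0) \<in> (?T \<union> ?T\<inverse>)\<^sup>*" using r0[OF ij(1)] sym ij(2) by (auto dest: symD)
    moreover have "(xs ! 0, v) \<in> (?T \<union> ?T\<inverse>)\<^sup>*" using r0[OF ij(3)] ij(4) by simp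
    ultimately show ?thesis by (rule rtrancl_trans)
  qed
  moreover have "?T \<subseteq> {(u, v). u < v \<and> v < n}"
  proof
    fix p assume "p \<in> ?T"
    then obtain i where i: "i < n - 1" "p = t i" by auto
    have "xs ! i \<noteq> xs ! Suc i" "xs ! i < n" "xs ! Suc i < n" using i ne[of i "Suc i"] xn[of i] xn[of "Suc i"] by auto
    then show "p \<in> {(u, v). u < v \<and> v < n}" using i by (auto simp: t_def nrm_def)
  qed
  moreover have "card ?T = n - 1" using card_image[OF inj] by simp
  ultimately have "is_spanning_tree n ?T" by (auto simp: is_spanning_tree_def)
  then have "tree_weight w T \<le> tree_weight w ?T" using mst by (simp add: is_MST_def)
  also have "\<dots> = (\<Sum>i<n - 1. w (fst (t i)) (snd (t i)))" unfolding tree_weight_def by (subst sum.reindex[OF inj]) (simp add: o_def)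
  also have "\<dots> = (\<Sum>i<n - 1. w (xs ! i) (xs ! ((i + 1) mod length xs)))"
  proof (intro sum.cong refl)
    fix i assume "i \<in> {..<n - 1}"
    then have "xs ! i < n" "xs ! Suc i < n" "Suc i mod n = Suc i" using xn[of i] xn[of "Suc i"] by auto
    then show "w (fst (t i)) (snd (t i)) = w (xs ! i) (xs ! ((i + 1) mod length xs))"
      using m len by (auto simp: t_def nrm_def is_metric_def min_def max_def)
  qed
  also have "\<dots> \<le> tour_cost w xs" unfolding tour_cost_def using len by (intro sum_mono2) auto
  finally show ?thesis .
qed

definition wlist :: "('e \<Rightarrow> nat) \<Rightarrow> 'e list \<Rightarrow> 'e list" where
  "wlist W xs = concat (map (\<lambda>e. replicate (W e) e) xs)"

lemma sum_wlist: "(\<Sum>e\<leftarrow>wlist W xs. g e) = (\<Sum>e\<leftarrow>xs. real (W e) * g e)"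
  unfolding wlist_def by (induction xs) (auto simp: sum_list_replicate)

lemma length_wlist: "length (wlist W xs) = (\<Sum>e\<leftarrow>xs. W e)"
  unfolding wlist_def by (induction xs) auto

text \<open>An arbitrary enumeration; it is applied only to sets computed from the given tree and so
  costs no query.\<close>

definition list_of :: "'a set \<Rightarrow> 'a list" where "list_of A = (SOME l. set l = A \<and> distinct l)"

lemma list_of: "finite A \<Longrightarrow> set (list_of A) = A" "finite A \<Longrightarrow> distinct (list_of A)"
  unfolding list_of_def using someI_ex[OF finite_distinct_list, of A] by auto

lemma sum_bounded_UN:
  fixes g :: "'a \<Rightarrow> real"
  assumes "finite K" "\<And>k. finite (B k)" "\<And>e. 0 \<le> g e"
  shows "sum g (\<Union>k\<in>K. B k) \<le> (\<Sum>k\<in>K. sum g (B k))"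
  using assms(1)
proof (induction K rule: finite_induct)
  case (insert k K)
  have "sum g (B k \<union> (\<Union>k\<in>K. B k)) \<le> sum g (B k) + sum g (\<Union>k\<in>K. B k)"
    using assms(2,3) insert.hyps by (simp add: sum_Un sum_nonneg)
  then show ?case using insert by simp
qed simp

section \<open>Scales, representatives and candidate links\<close>

locale tsp_alg = rooted_tree n par dep W for n par dep W +
  fixes pos :: "nat \<Rightarrow> nat" and lg :: nat
  assumes pos_le: "x < n \<Longrightarrow> pos x \<le> 2 * M"
    and pos_dist: "x < n \<Longrightarrow> y < n \<Longrightarrow> real (dT x y) \<le> \<bar>real (pos x) - real (pos y)\<bar>"
    and lg: "n \<le> 2 ^ lg"
begin

text \<open>\<open>pos\<close> is the position along a closed walk around the tree, so that buckets of positions are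
  clusters of small tree diameter. \<open>Bu\<close> collects the tree edges below which some scale has too many
  representatives; removing these edges bounds the number of candidate links of every other edge.\<close>

definition s0 :: real where "s0 = M / (100 * n)"
text \<open>Scales start at s0 because n links of that length amount to only M / 100. Since
  (11/10)^8 >= 2, the last scale is at least 128 n s0, which exceeds M / (98/100).\<close>

definition kmax :: nat where "kmax = 56 + 8 * lg"
definition sk :: "nat \<Rightarrow> real" where "sk k = s0 * (11/10) ^ k"
definition Ks :: "nat set" where "Ks = {k. k \<le> kmax \<and> sk k \<le> 2 * M}"
definition bucket :: "nat \<Rightarrow> nat \<Rightarrow> nat" where "bucket k x = nat \<lfloor>pos x / (sk k / 100)\<rfloor>"
definition rep :: "nat \<Rightarrow> nat \<Rightarrow> nat" where "rep k x = (LEAST y. y < n \<and> bucket k y = bucket k x)"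
definition Rk :: "nat \<Rightarrow> nat set" where "Rk k = rep k ` {0..<n}"
text \<open>By double counting, the edges removed for one scale weigh at most 20200 M / \<beta>.
  Summed over kmax + 1 scales this is below M / 100.\<close>

definition \<beta> :: nat where "\<beta> = 2100000 * (kmax + 1)"
definition below :: "nat \<Rightarrow> nat \<Rightarrow> nat set" where "below k e = {a \<in> Rk k. e \<in> up (100 * sk k) a}"
definition Bu :: "nat set" where "Bu = {e \<in> {1..<n}. \<exists>k\<in>Ks. \<beta> < card (below k e)}"

fun tok :: "nat \<times> nat \<times> nat \<Rightarrow> nat set" where "tok (a, b, k) = near (100 * sk k) a b - Bu"
fun sc :: "nat \<times> nat \<times> nat \<Rightarrow> real" where "sc (a, b, k) = sk k"
text \<open>Links covering less than 12/10 of their scale meet the final bound of 13/10 from the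
  start and are left out.\<close>

definition I :: "(nat \<times> nat \<times> nat) set" where
  "I = {(a, b, k). k \<in> Ks \<and> a \<in> Rk k \<and> b \<in> Rk k \<and> 12/10 * sk k \<le> (\<Sum>e\<in>tok (a, b, k). real (W e))}"
definition toks :: "nat \<times> nat \<times> nat \<Rightarrow> nat list" where "toks f = wlist W (list_of (tok f))"
definition cand :: "nat \<Rightarrow> (nat \<times> nat \<times> nat) list" where "cand e = list_of {f \<in> I. e \<in> tok f}"
definition qa :: "nat \<times> nat \<times> nat \<Rightarrow> nat" where "qa f = fst f"
definition qb :: "nat \<times> nat \<times> nat \<Rightarrow> nat" where "qb f = fst (snd f)"
text \<open>If a link covers e at scale k, then e is near one of its ends: at most \<beta> choices
  for that end, n for the other, two orders and kmax + 1 scales.\<close>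

definition N :: nat where "N = 2 * \<beta> * n * (kmax + 1)"
definition m :: nat where "m = 2000000"
text \<open>The base 199/100 is 2 * (199/200): the weight doubles at each level and a reliable check
  fails with probability at most 1/200. At this depth a link that keeps passing reaches weight
  1000.\<close>

definition J :: nat where "J = (LEAST j. 1000 * real N \<le> (199/100) ^ j)"

lemma M_ge: "n - 1 \<le> M"
proof -
  have "(\<Sum>e\<in>{1..<n}. 1) \<le> M" unfolding M_def using W_pos by (intro sum_mono) auto
  then show ?thesis by simp
qed

lemma M_pos: "0 < M" using M_ge n2 by simp
lemma s0_pos: "0 < s0" using M_pos n2 by (simp add: s0_def)
lemma sk_pos: "0 < sk k" using s0_pos by (simp add: sk_def)
lemma finite_Ks: "finite Ks" by (rule finite_subset[of _ "{..kmax}"]) (auto simp: Ks_def)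
lemma card_Ks: "card Ks \<le> kmax + 1"
  using card_mono[of "{..kmax}" Ks] by (auto simp: Ks_def)

lemma rep_props: "x < n \<Longrightarrow> rep k x < n \<and> bucket k (rep k x) = bucket k x"
  unfolding rep_def by (rule LeastI[of _ x]) simp

lemma rep_dist:
  assumes "x < n" shows "real (dT x (rep k x)) \<le> sk k / 100"
proof -
  let ?d = "sk k / 100"
  have d: "?d > 0" using sk_pos by simp
  have fl: "real (bucket k y) \<le> pos y / ?d" "pos y / ?d < real (bucket k y) + 1" for y
  proof -
    have "0 \<le> \<lfloor>pos y / ?d\<rfloor>" using d by simp
    then have "real (bucket k y) = real_of_int \<lfloor>pos y / ?d\<rfloor>" unfolding bucket_def by (rule of_nat_nat)
    then show "real (bucket k y) \<le> pos y / ?d" "pos y / ?d < real (bucket k y) + 1" by linarith+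
  qed
  have "\<bar>pos x / ?d - pos (rep k x) / ?d\<bar> \<le> 1"
    using fl[of x] fl[of "rep k x"] rep_props[OF assms, of k] by (auto simp: abs_le_iff)
  then have "\<bar>(real (pos x) - real (pos (rep k x))) / ?d\<bar> \<le> 1" by (simp only: diff_divide_distrib)
  moreover have "\<bar>a / d\<bar> \<le> 1 \<Longrightarrow> d > 0 \<Longrightarrow> \<bar>a\<bar> \<le> d" for a d :: real by (simp add: abs_divide pos_divide_le_eq)
  ultimately have "\<bar>real (pos x) - real (pos (rep k x))\<bar> \<le> ?d" using d by blast
  then show ?thesis using pos_dist[of x "rep k x"] rep_props[OF assms, of k] assms by linarith
qed

lemma Rk_sub: "Rk k \<subseteq> {0..<n}" using rep_props by (auto simp: Rk_def)
lemma finite_Rk: "finite (Rk k)" by (simp add: Rk_def)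
lemma card_Rk_n: "card (Rk k) \<le> n" using card_mono[OF _ Rk_sub] by simp

lemma card_Rk: "real (card (Rk k)) \<le> 1 + 200 * M / sk k"
proof -
  let ?d = "sk k / 100"
  have "card (Rk k) \<le> card (bucket k ` {0..<n})"
  proof -
    have "Rk k \<subseteq> (\<lambda>b. LEAST y. y < n \<and> bucket k y = b) ` bucket k ` {0..<n}" by (auto simp: Rk_def rep_def)
    then show ?thesis by (intro surj_card_le) auto
  qed
  also have "bucket k ` {0..<n} \<subseteq> {..nat \<lfloor>2 * M / ?d\<rfloor>}"
  proof -
    have "pos x / ?d \<le> 2 * M / ?d" if "x < n" for x
      using pos_le[OF that] sk_pos[of k] by (intro divide_right_mono) auto
    then show ?thesis by (auto simp: bucket_def intro!: nat_mono floor_mono)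
  qed
  then have "card (bucket k ` {0..<n}) \<le> card {..nat \<lfloor>2 * M / ?d\<rfloor>}" by (intro card_mono) auto
  also have "\<dots> = nat \<lfloor>2 * M / ?d\<rfloor> + 1" by simp
  finally have "real (card (Rk k)) \<le> real (nat \<lfloor>2 * M / ?d\<rfloor>) + 1" by linarith
  also have "real (nat \<lfloor>2 * M / ?d\<rfloor>) \<le> 2 * M / ?d" using sk_pos[of k] by (intro of_nat_floor) auto
  finally show ?thesis by simp
qed

lemma Bu_mass: "(\<Sum>e\<in>Bu. real (W e)) \<le> M / 100"
proof -
  define Bk where "Bk k = {e \<in> {1..<n}. \<beta> < card (below k e)}" for k
  have bp: "real \<beta> > 0" by (simp add: \<beta>_def)
  have Bk: "real \<beta> * (\<Sum>e\<in>Bk k. real (W e)) \<le> 20200 * real M" if "k \<in> Ks" for k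
  proof -
    have "real \<beta> * (\<Sum>e\<in>Bk k. real (W e)) = (\<Sum>e\<in>Bk k. W e * real \<beta>)" by (simp add: sum_distrib_left mult.commute)
    also have "\<dots> \<le> (\<Sum>e\<in>Bk k. W e * real (card {a \<in> Rk k. e \<in> up (100 * sk k) a}))"
      by (intro sum_mono mult_left_mono) (auto simp: Bk_def below_def)
    also have "\<dots> \<le> (\<Sum>e\<in>{1..<n}. W e * real (card {a \<in> Rk k. e \<in> up (100 * sk k) a}))"
      by (intro sum_mono2) (auto simp: Bk_def)
    also have "\<dots> \<le> card (Rk k) * (100 * sk k)"
      using sk_pos[of k] by (intro bushy_mass finite_Rk Rk_sub) simp
    also have "\<dots> \<le> (1 + 200 * M / sk k) * (100 * sk k)"
      using sk_pos[of k] by (intro mult_right_mono card_Rk) simp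
    also have "\<dots> = 100 * sk k + 20000 * M" using sk_pos[of k] by (simp add: field_simps)
    also have "\<dots> \<le> 20200 * real M" using that by (simp add: Ks_def)
    finally show ?thesis .
  qed
  have "(\<Sum>e\<in>Bu. real (W e)) \<le> (\<Sum>k\<in>Ks. \<Sum>e\<in>Bk k. real (W e))"
  proof -
    have "Bu = (\<Union>k\<in>Ks. Bk k)" by (auto simp: Bu_def Bk_def)
    then show ?thesis using sum_bounded_UN[of Ks Bk "\<lambda>e. real (W e)"] finite_Ks by (simp add: Bk_def)
  qed
  then have "real \<beta> * (\<Sum>e\<in>Bu. real (W e)) \<le> (\<Sum>k\<in>Ks. \<beta> * (\<Sum>e\<in>Bk k. real (W e)))"
    using bp by (simp flip: sum_distrib_left)
  also have "\<dots> \<le> (\<Sum>k\<in>Ks. 20200 * real M)" by (intro sum_mono Bk)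
  also have "\<dots> \<le> (kmax + 1) * (20200 * real M)"
  proof -
    have "real (card Ks) \<le> kmax + 1" using card_Ks by linarith
    then show ?thesis by (simp add: mult_right_mono)
  qed
  also have "\<dots> \<le> \<beta> * (M / 100)" by (simp add: \<beta>_def algebra_simps)
  finally show ?thesis using bp by simp
qed

end

context tsp_alg begin

section \<open>Verification of the cover requirements\<close>

lemma N_pos: "N > 0" using n2 by (simp add: N_def \<beta>_def)

lemma finite_I: "finite I"
proof (rule finite_subset)
  show "I \<subseteq> {0..<n} \<times> {0..<n} \<times> Ks" using Rk_sub by (fastforce simp: I_def)
qed (simp add: finite_Ks)

lemma finite_tok: "finite (tok f)" by (cases f) (simp add: finite_near)
lemma tok_sub: "tok f \<subseteq> {1..<n}" using near_sub sd_sub by (cases f) fastforce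
lemma tok_sd: "tok f \<subseteq> sd (qa f) (qb f)" using near_sub by (cases f) (fastforce simp: qa_def qb_def)

lemma toks_sum: "(\<Sum>e\<leftarrow>toks f. g e) = (\<Sum>e\<in>tok f. real (W e) * g e)"
  unfolding toks_def sum_wlist
  using sum_list_distinct_conv_sum_set[OF list_of(2)[OF finite_tok], of "\<lambda>e. real (W e) * g e" f] list_of(1)[OF finite_tok]
  by simp

lemma length_toks: "real (length (toks f)) = (\<Sum>e\<in>tok f. real (W e))"
  using toks_sum[where g = "\<lambda>_. 1" and f = f] by (simp add: sum_list_triv)

lemma length_toks_le: "length (toks f) \<le> M"
proof -
  have "(\<Sum>e\<in>tok f. real (W e)) \<le> (\<Sum>e\<in>{1..<n}. real (W e))" by (intro sum_mono2 tok_sub) auto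
  then show ?thesis using length_toks[of f] by (simp add: M_def flip: of_nat_sum)
qed

lemma card_cand: "card {f \<in> I. e \<in> tok f} \<le> N"
proof (cases "e \<in> {1..<n} - Bu")
  case True
  have b: "card (below k e) \<le> \<beta>" if "k \<in> Ks" for k using True that by (auto simp: Bu_def not_less)
  have fb: "finite (below k e)" for k by (simp add: below_def finite_Rk)
  let ?P = "\<lambda>k. below k e \<times> Rk k \<union> Rk k \<times> below k e"
  have "{f \<in> I. e \<in> tok f} \<subseteq> (\<Union>k\<in>Ks. (\<lambda>(a, b). (a, b, k)) ` ?P k)"
  proof
    fix f assume f: "f \<in> {f \<in> I. e \<in> tok f}"
    obtain a b k where abk: "f = (a, b, k)" by (cases f) auto
    have k: "k \<in> Ks" "a \<in> Rk k" "b \<in> Rk k" "e \<in> near (100 * sk k) a b" using f by (auto simp: abk I_def)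
    then have "(a, b) \<in> ?P k" by (auto simp: near_def below_def)
    then show "f \<in> (\<Union>k\<in>Ks. (\<lambda>(a, b). (a, b, k)) ` ?P k)" using k(1) abk by force
  qed
  then have "card {f \<in> I. e \<in> tok f} \<le> card (\<Union>k\<in>Ks. (\<lambda>(a, b). (a, b, k)) ` ?P k)"
    using finite_Ks fb finite_Rk by (intro card_mono) auto
  also have "\<dots> \<le> (\<Sum>k\<in>Ks. card ((\<lambda>(a, b). (a, b, k)) ` ?P k))" by (rule card_UN_le[OF finite_Ks])
  also have "\<dots> \<le> (\<Sum>k\<in>Ks. 2 * \<beta> * n)"
  proof (rule sum_mono)
    fix k assume k: "k \<in> Ks"
    have "card ((\<lambda>(a, b). (a, b, k)) ` ?P k) \<le> card (?P k)" using fb finite_Rk by (intro card_image_le) auto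
    also have "\<dots> \<le> card (below k e \<times> Rk k) + card (Rk k \<times> below k e)" by (rule card_Un_le)
    also have "\<dots> \<le> \<beta> * n + n * \<beta>" unfolding card_cartesian_product
      using b[OF k] card_Rk_n by (intro add_mono mult_le_mono) auto
    finally show "card ((\<lambda>(a, b). (a, b, k)) ` ?P k) \<le> 2 * \<beta> * n" by (simp add: mult.commute)
  qed
  also have "\<dots> = card Ks * (2 * \<beta> * n)" by simp
  also have "\<dots> \<le> (kmax + 1) * (2 * \<beta> * n)" by (rule mult_le_mono1[OF card_Ks])
  also have "\<dots> = N" by (simp only: N_def mult_ac)
  finally show ?thesis .
next
  case False
  then have "{f \<in> I. e \<in> tok f} = {}" using tok_sub by (auto; force)
  then show ?thesis by (simp only: card.empty)
qed

lemma cand_props: "set (cand e) = {f \<in> I. e \<in> tok f}" "distinct (cand e)" "length (cand e) \<le> N"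
proof -
  have fin: "finite {f \<in> I. e \<in> tok f}" using finite_I by simp
  show 1: "set (cand e) = {f \<in> I. e \<in> tok f}" "distinct (cand e)" unfolding cand_def using list_of[OF fin] by auto
  show "length (cand e) \<le> N" using card_cand[of e] distinct_card[OF 1(2)] 1(1) by simp
qed

lemma sc_pos: "0 < sc f" by (cases f) (simp add: sk_pos)

lemma sc_le: "f \<in> I \<Longrightarrow> 12/10 * sc f \<le> length (toks f)"
  by (cases f) (auto simp: I_def length_toks)

lemma len_le: "f \<in> I \<Longrightarrow> length (toks f) \<le> 200 * sc f"
proof (cases f)
  case (fields a b k)
  assume "f \<in> I"
  then have ab: "a < n" "b < n" using Rk_sub by (fastforce simp: I_def fields)+
  have "(\<Sum>e\<in>tok f. real (W e)) \<le> (\<Sum>e\<in>near (100 * sk k) a b. real (W e))"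
    by (intro sum_mono2) (auto simp: fields finite_near)
  also have "\<dots> \<le> 2 * (100 * sk k)" using ab sk_pos[of k] by (intro near_mass) auto
  finally show ?thesis by (simp add: length_toks fields)
qed

lemma toks_ne: "f \<in> I \<Longrightarrow> toks f \<noteq> []"
  using sc_le[of f] sc_pos[of f] by auto

lemma J_prop: "1000 * real N \<le> (199/100) ^ J"
  unfolding J_def by (rule LeastI_ex) (use real_arch_pow[of "199/100" "1000 * real N"] in \<open>auto intro: less_imp_le\<close>)

lemma scales:
  assumes "s0 \<le> v" "v \<le> M"
  shows "\<exists>s\<in>sk ` Ks. v \<le> 98/100 * s \<and> s \<le> 113/100 * v"
proof -
  have big: "v \<le> 98/100 * sk kmax"
  proof -
    have "(2::real) \<le> (11/10) ^ 8" by (simp add: power_divide)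
    then have "(2::real) ^ (7 + lg) \<le> ((11/10) ^ 8) ^ (7 + lg)" by (intro power_mono) auto
    then have "128 * 2 ^ lg \<le> (11/10 :: real) ^ kmax" by (simp add: kmax_def power_add algebra_simps flip: power_mult)
    moreover have "real n \<le> 2 ^ lg" using lg by (metis of_nat_le_iff of_nat_numeral of_nat_power)
    ultimately have "128 * real n \<le> (11/10) ^ kmax" by linarith
    then have "s0 * (128 * real n) \<le> sk kmax" unfolding sk_def using s0_pos by (intro mult_left_mono) auto
    then have "128/100 * M \<le> sk kmax" using n2 by (simp add: s0_def)
    then show ?thesis using assms(2) by simp
  qed
  define k where "k = (LEAST k. v \<le> 98/100 * sk k)"
  have k: "v \<le> 98/100 * sk k" unfolding k_def using big by (rule LeastI)
  have kk: "k \<le> kmax" unfolding k_def using big by (rule Least_le)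
  have "k \<noteq> 0"
  proof
    assume "k = 0"
    then have "v \<le> 98/100 * s0" using k by (simp add: sk_def)
    then show False using assms(1) s0_pos by simp
  qed
  then obtain k' where k': "k = Suc k'" by (cases k) auto
  have "\<not> v \<le> 98/100 * sk k'" using not_less_Least[of k' "\<lambda>k. v \<le> 98/100 * sk k"] k' unfolding k_def by simp
  moreover have "sk k = 11/10 * sk k'" by (simp add: k' sk_def)
  \<comment> \<open>The previous scale was too small for v, so this one is at most (11/10) /
    (98/100) * v.\<close>
  ultimately have up: "sk k \<le> 113/100 * v" using s0_pos assms(1) by simp
  then have "k \<in> Ks" using kk assms(2) M_pos by (simp add: Ks_def)
  then show ?thesis using k up by auto
qed

end

lemma m_large: "exp (- real (2000000::nat) / 200000) \<le> (1 / 200 :: real)"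
proof -
  have "(1 + 5 + 5 ^ 2 / 2 :: real) \<le> exp 5" using exp_lower_Taylor_quadratic[of 5] by simp
  then have "(18::real) * 18 \<le> exp 5 * exp 5" by (intro mult_mono) auto
  then have "200 \<le> exp (10::real)" by (simp flip: exp_add)
  then have "inverse (exp (10::real)) \<le> inverse 200" by (rule le_imp_inverse_le) simp
  then show ?thesis by (simp add: exp_minus)
qed

section \<open>Completeness and soundness of the saturated fraction\<close>

locale tsp_run = tsp_alg n par dep W pos lg for n par dep W pos lg +
  fixes w :: "nat \<Rightarrow> nat \<Rightarrow> nat"
  assumes metric: "is_metric n w" and wW: "0 < e \<Longrightarrow> e < n \<Longrightarrow> w e (par e) = W e"
begin

sublocale lc: level_cover cand toks qa qb sc N m w "{1..<n}" W tok I
proof unfold_locales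
  show "distinct (cand e)" "length (cand e) \<le> N" for e using cand_props by auto
  show "toks f \<noteq> []" if "f \<in> set (cand e)" for f e using that toks_ne by (auto simp: cand_props)
  show "0 < N" by (rule N_pos)
  show "0 < m" by (simp add: m_def)
  show "finite {1..<n}" by simp
  show "finite I" by (rule finite_I)
  show "tok f \<subseteq> {1..<n}" for f by (rule tok_sub)
  show "(\<Sum>e\<leftarrow>toks f. g e) = (\<Sum>e\<in>tok f. real (W e) * g e)" for f g by (rule toks_sum)
  show "set (cand e) = {f \<in> I. e \<in> tok f}" for e by (rule cand_props)
  show "0 < sc f" for f by (rule sc_pos)
  show "12/10 * sc f \<le> length (toks f)" if "f \<in> I" for f using that by (rule sc_le)
  show "length (toks f) \<le> 200 * sc f" if "f \<in> I" for f using that by (rule len_le)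
  show "exp (- real m / 200000) \<le> 1 / 200" using m_large by (simp add: m_def)
qed

definition X :: "nat \<Rightarrow> real" where "X e = lc.X (Suc J) e"

lemma X_bounds: "0 \<le> X e \<and> X e \<le> 1" by (simp add: X_def lc.X_bounds)

lemma w_sym: "x < n \<Longrightarrow> y < n \<Longrightarrow> w x y = w y x" using metric by (simp add: is_metric_def)
lemma w_le_dT: "x < n \<Longrightarrow> y < n \<Longrightarrow> w x y \<le> dT x y" using le_dT[OF metric wW] by blast

text \<open>Passing to representatives moves each end by at most s/100. The distance becomes at most
  98/100 s + 2/100 s = s, so the link is valid; the radius stays below 100 s; and the bound on the
  weight grows from 13/10 s to 132/100 s.\<close>

lemma near_saturated:
  assumes x: "x < n" and y: "y < n" and k: "k \<in> Ks" and wxy: "real (w x y) \<le> 98/100 * sk k"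
  shows "(\<Sum>e\<in>near (99 * sk k) x y - Bu. W e * X e) \<le> 132/100 * sk k"
proof -
  let ?s = "sk k" and ?a = "rep k x" and ?b = "rep k y"
  have ab: "?a < n" "?b < n" using rep_props x y by auto
  have s: "0 < ?s" by (rule sk_pos)
  have da: "real (dT x ?a) \<le> ?s / 100" "real (dT y ?b) \<le> ?s / 100" using rep_dist x y by auto
  have "(\<Sum>e\<in>near (99 * ?s) x y - Bu. W e * X e) \<le> (\<Sum>e\<in>near (99 * ?s + ?s / 100) ?a ?b - Bu. W e * X e) + 2 * (?s / 100)"
    using da X_bounds by (rule near_shift_sum)
  also have "(\<Sum>e\<in>near (99 * ?s + ?s / 100) ?a ?b - Bu. W e * X e) \<le> (\<Sum>e\<in>near (100 * ?s) ?a ?b - Bu. W e * X e)"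
  proof (rule sum_mono2)
    show "near (99 * ?s + ?s / 100) ?a ?b - Bu \<subseteq> near (100 * ?s) ?a ?b - Bu"
      using s by (auto simp: near_def up_def)
  qed (auto simp: finite_near X_bounds)
  also have "(\<Sum>e\<in>near (100 * ?s) ?a ?b - Bu. W e * X e) \<le> 13/10 * ?s"
  proof (cases "(?a, ?b, k) \<in> I")
    case True
    have "w ?a ?b \<le> w ?a x + w x ?b" "w x ?b \<le> w x y + w y ?b"
      using metric ab x y unfolding is_metric_def by blast+
    moreover have "w ?a x \<le> dT x ?a" "w y ?b \<le> dT y ?b" using w_le_dT ab x y dT_sym[of x ?a] by auto
    ultimately have "real (w ?a ?b) \<le> real (dT x ?a) + real (w x y) + real (dT y ?b)" by linarith
    then have "real (w ?a ?b) \<le> ?s" using da wxy by linarith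
    then have "(?a, ?b, k) \<in> lc.IV" using True by (simp add: lc.IV_def qa_def qb_def)
    then have "lc.g (Suc J) (?a, ?b, k) \<le> 13/10 * sc (?a, ?b, k)" using J_prop by (rule lc.valid_item_saturated)
    then show ?thesis by (simp add: lc.g_def X_def)
  next
    case False
    then have *: "(\<Sum>e\<in>near (100 * ?s) ?a ?b - Bu. real (W e)) < 12/10 * ?s" using k x y by (auto simp: I_def Rk_def)
    have "(\<Sum>e\<in>near (100 * ?s) ?a ?b - Bu. W e * X e) \<le> (\<Sum>e\<in>near (100 * ?s) ?a ?b - Bu. real (W e))"
      using X_bounds by (intro sum_mono) (simp add: mult_left_le)
    then show ?thesis using * s by simp
  qed
  finally show ?thesis by simp
qed

text \<open>The budget is 3/100 + 75/100 * (101/100 + 1/100) + 1/100 = 805/1000: far edges, the tour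
  with its rounded-up short links, and the removed edges \<open>Bu\<close>.\<close>

lemma complete:
  assumes T: "real (TSP n w) \<le> 101/100 * M"
  shows "(\<Sum>e\<in>{1..<n}. W e * X e) \<le> 81/100 * M"
proof -
  obtain xs where xs: "distinct xs" "set xs = {0..<n}" "tour_cost w xs = TSP n w" using TSP_attained by blast
  have ns: "real n * s0 = M / 100" using n2 by (simp add: s0_def)
  have s0M: "s0 \<le> M"
  proof -
    have "1 * s0 \<le> real n * s0" using n2 s0_pos by (intro mult_right_mono) auto
    then show ?thesis using ns by simp
  qed
  have "(\<Sum>e\<in>{1..<n} - Bu. W e * X e) \<le> 3/100 * M + 75/100 * (tour_cost w xs + n * s0)"
  proof (rule short_tour_saturates[OF xs(1,2) X_bounds s0_pos, where S = "sk ` Ks"])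
    show "w x y = w y x" if "x < n" "y < n" for x y using that by (rule w_sym)
    show "w x y \<le> M" if "x < n" "y < n" for x y using w_le_dT[OF that] dT_le_M[of x y] by linarith
    show "s0 \<le> M" by (rule s0M)
    show "(\<Sum>e\<in>near (99 * s) x y - Bu. W e * X e) \<le> 132/100 * s"
      if "x < n" "y < n" "s \<in> sk ` Ks" "real (w x y) \<le> 98/100 * s" for x y s
      using that near_saturated by auto
    show "\<exists>s\<in>sk ` Ks. v \<le> 98/100 * s \<and> s \<le> 113/100 * v" if "s0 \<le> v" "v \<le> M" for v
      using that by (rule scales)
  qed
  also have "\<dots> = 3/100 * M + 75/100 * (TSP n w + M / 100)" using xs(3) ns by simp
  finally have 1: "(\<Sum>e\<in>{1..<n} - Bu. W e * X e) \<le> \<dots>" .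
  have "(\<Sum>e\<in>Bu. W e * X e) \<le> (\<Sum>e\<in>Bu. real (W e))" using X_bounds by (intro sum_mono) (simp add: mult_left_le)
  then have 2: "(\<Sum>e\<in>Bu. W e * X e) \<le> M / 100" using Bu_mass by linarith
  have eq: "(\<Sum>e\<in>{1..<n}. W e * X e) = (\<Sum>e\<in>{1..<n} - Bu. W e * X e) + (\<Sum>e\<in>Bu. W e * X e)"
    by (rule sum.subset_diff) (auto simp: Bu_def)
  have gen: "a \<le> 81/100 * c" if "a = p + r" "p \<le> 3/100 * c + 75/100 * (t + c / 100)" "r \<le> c / 100" "t \<le> 101/100 * c" "0 \<le> c"
    for a p r t c :: real using that by (simp add: field_simps)
  show ?thesis by (rule gen[OF eq 1 2 T of_nat_0_le_iff])
qed

text \<open>The probability that a tree edge drawn by weight is reported as saturated.\<close>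

definition phi :: real where "phi = (\<Sum>e\<in>{1..<n}. W e * (1 - X e)) / M"

lemma phi_eq: "phi = 1 - (\<Sum>e\<in>{1..<n}. W e * X e) / M"
proof -
  have "(\<Sum>e\<in>{1..<n}. W e * (1 - X e)) = M - (\<Sum>e\<in>{1..<n}. W e * X e)"
    by (simp add: M_def right_diff_distrib sum_subtractf)
  then show ?thesis using M_pos by (simp add: phi_def diff_divide_distrib)
qed

lemma complete_phi: "real (TSP n w) \<le> 101/100 * M \<Longrightarrow> 19/100 \<le> phi"
  using complete M_pos by (simp add: phi_eq field_simps)

text \<open>Saturated weight at least M/10 forces load at least M / (10 * 32 (8 m)^2), and 1/6875 of
  the load is gained over 2 M; 6875 * 10 * 32 = 2200000.\<close>

lemma sound:
  assumes "1/10 \<le> phi"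
  shows "real (TSP n w) \<le> (2 - 1 / (2200000 * (8 * real m) ^ 2)) * M"
proof -
  let ?C = "32 * (8 * real m) ^ 2"
  have C: "?C > 0" by (simp add: m_def)
  have "M / 10 \<le> (\<Sum>e\<in>{1..<n}. W e * (1 - X e))" using assms M_pos by (simp add: phi_def field_simps)
  also have "\<dots> \<le> (\<Sum>e\<in>{1..<n}. W e * (?C * lc.L (Suc J) e))"
    unfolding X_def by (intro sum_mono mult_left_mono lc.fail_le_L) auto
  also have "\<dots> = ?C * (\<Sum>e\<in>{1..<n}. W e * lc.L (Suc J) e)" by (simp add: sum_distrib_left mult_ac)
  finally have L: "M / 10 \<le> ?C * (\<Sum>e\<in>{1..<n}. W e * lc.L (Suc J) e)" .
  let ?V = "\<lambda>F. (\<Sum>e\<in>{1..<n}. W e * (1 - (\<Prod>f\<in>F. if e \<in> sd (qa f) (qb f) then (-1::real) else 1)) / 2) - (\<Sum>f\<in>F. real (w (qa f) (qb f)))"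
  have "\<exists>F\<subseteq>lc.IV. 1 / 6875 * (\<Sum>e\<in>{1..<n}. W e * lc.L (Suc J) e) \<le> ?V F"
    by (rule lc.rounding) (auto simp: lc.IV_def intro: subsetD[OF tok_sd])
  then obtain F where F: "F \<subseteq> lc.IV" "1 / 6875 * (\<Sum>e\<in>{1..<n}. W e * lc.L (Suc J) e) \<le> ?V F"
    by (elim exE conjE) (rule that)
  have finF: "finite F" using F(1) lc.finite_IV by (rule finite_subset)
  have Fn: "qa f < n \<and> qb f < n" if "f \<in> F" for f
  proof -
    have "f \<in> I" using that F(1) by (auto simp: lc.IV_def)
    then show ?thesis using Rk_sub by (cases f) (fastforce simp: I_def qa_def qb_def)
  qed
  let ?c = "crossings qa qb F"
  have pr: "(\<Prod>f\<in>F. if e \<in> sd (qa f) (qb f) then (-1::real) else 1) = (-1) ^ ?c e" for e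
    using finF by (simp add: crossings_def prod.inter_filter[symmetric])
  have "TSP n w \<le> M + (\<Sum>e\<in>{e\<in>{1..<n}. even (?c e)}. W e) + (\<Sum>f\<in>F. w (qa f) (qb f))"
    by (rule TSP_le_cover[OF metric wW finF Fn])
  then have "real (TSP n w) \<le> real (M + (\<Sum>e\<in>{e\<in>{1..<n}. even (?c e)}. W e) + (\<Sum>f\<in>F. w (qa f) (qb f)))"
    by (simp only: of_nat_le_iff)
  also have "\<dots> = M + (\<Sum>e\<in>{1..<n}. if even (?c e) then real (W e) else 0) + (\<Sum>f\<in>F. real (w (qa f) (qb f)))"
  proof -
    have "(\<Sum>e\<in>{e\<in>{1..<n}. even (?c e)}. real (W e)) = (\<Sum>e\<in>{1..<n}. if even (?c e) then real (W e) else 0)"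
      by (rule sum.inter_filter) simp
    then show ?thesis by (simp only: of_nat_add of_nat_sum)
  qed
  also have "(\<Sum>e\<in>{1..<n}. if even (?c e) then real (W e) else 0) = M - (\<Sum>e\<in>{1..<n}. W e * (1 - (-1::real) ^ ?c e) / 2)"
    unfolding M_def of_nat_sum sum_subtractf[symmetric] by (intro sum.cong) auto
  finally have "real (TSP n w) \<le> 2 * real M - 1 / 6875 * (\<Sum>e\<in>{1..<n}. W e * lc.L (Suc J) e)"
    using F(2) unfolding pr by linarith
  moreover have "M / 10 / ?C \<le> (\<Sum>e\<in>{1..<n}. W e * lc.L (Suc J) e)" using L C by (simp add: divide_le_eq mult.commute)
  ultimately have "real (TSP n w) \<le> 2 * real M - 1 / 6875 * (M / 10 / ?C)" by linarith
  also have "\<dots> = (2 - 1 / (2200000 * (8 * real m) ^ 2)) * M" by (simp add: m_def algebra_simps)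
  finally show ?thesis .
qed

end

section \<open>The sampling program and its error probability\<close>

definition eps :: real where "eps = 1 / (2200000 * (8 * 2000000) ^ 2)"

context tsp_alg begin

definition Rn :: nat where "Rn = nat \<lceil>10000 * ln (real n)\<rceil>"
definition elist :: "nat list" where "elist = wlist W [1..<n]"
definition sampler :: "nat prog" where
  "sampler = Rnd M (\<lambda>t. bindp (level_prog.alive cand toks qa qb sc N m (Suc J) (elist ! t)) (\<lambda>b. Ret (if b then 0 else 1)))"
text \<open>The threshold 12/10 * 29/240 = 145/1000 is the midpoint of 1/10, where soundness starts,
  and 19/100, which short tours guarantee. The uncertain range from 11/10 to 13/10 times 29/240 lies
  strictly between these.\<close>

definition tsp_prog :: "real prog" where
  "tsp_prog = bindp (repeatp Rn sampler)
     (\<lambda>s. Ret (if 12/10 * (29/240) * real Rn \<le> real s then (2 - eps) * real M else 2 * real M))"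
definition budget :: nat where "budget = Rn * (8 * 2 ^ Suc J)"

lemma length_elist: "length elist = M"
  unfolding elist_def length_wlist M_def by (simp add: sum_list_distinct_conv_sum_set)

end

context tsp_run begin

lemma sampler_bernoulli: "set_pmf (den w sampler) \<subseteq> {0, 1}" "pmf (den w sampler) 1 = phi"
proof -
  have ne: "{..<M} \<noteq> {}" using M_pos by (auto simp: lessThan_empty_iff)
  have d: "den w sampler = bind_pmf (pmf_of_set {..<M})
    (\<lambda>t. map_pmf (\<lambda>b. if b then 0 else 1) (den w (lc.alive (Suc J) (elist ! t))))"
    by (auto simp: sampler_def den_bindp map_pmf_def if_distrib[where f = "\<lambda>p. den w p"] if_distrib[where f = return_pmf] intro!: bind_pmf_cong)
  show "set_pmf (den w sampler) \<subseteq> {0, 1}" unfolding d by auto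
  have v: "(\<lambda>b. if b then 0 else 1) -` {1::nat} = {False}" by (auto split: if_splits)
  have F: "pmf (den w (lc.alive (Suc J) e)) False = 1 - X e" for e
    using sum_pmf_eq_1[OF finite subset_UNIV, of "den w (lc.alive (Suc J) e)"] by (simp add: UNIV_bool X_def lc.X_def)
  have "pmf (den w sampler) 1 = (\<Sum>t<M. 1 - X (elist ! t)) / M"
    unfolding d by (simp only: pmf_bind pmf_map v) (simp add: integral_pmf_of_set ne measure_pmf_single F)
  also have "(\<Sum>t<M. 1 - X (elist ! t)) = (\<Sum>e\<leftarrow>elist. 1 - X e)"
    by (simp add: sum_list_sum_nth length_elist atLeast0LessThan)
  also have "\<dots> = (\<Sum>e\<in>{1..<n}. W e * (1 - X e))"
    unfolding elist_def sum_wlist by (simp add: sum_list_distinct_conv_sum_set)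
  finally show "pmf (den w sampler) 1 = phi" by (simp add: phi_def)
qed

text \<open>Draws range over N slots, at most M tokens of a link, or M weighted tree edges, so N + M
  bounds every range.\<close>

lemma prog_cost: "wp (N + M) w tsp_prog (\<lambda>_ _. True) budget"
proof -
  have al: "costs (N + M) w (lc.alive (Suc J) e) (8 * (2 ^ Suc J - 1))" for e
    by (rule lc.costs_alive) (use length_toks_le in \<open>auto intro: trans_le_add2\<close>)
  have "costs (N + M) w sampler (Suc (8 * (2 ^ Suc J - 1) + 0))"
    unfolding sampler_def using M_pos by (intro costs_Rnd costs_bind al costs_Ret) auto
  then have "costs (N + M) w tsp_prog (Rn * Suc (8 * (2 ^ Suc J - 1) + 0) + 0)"
    unfolding tsp_prog_def by (intro costs_bind costs_repeatp costs_Ret)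
  moreover have "Rn * Suc (8 * (2 ^ Suc J - 1) + 0) + 0 \<le> budget"
  proof -
    have "Suc (8 * (2 ^ Suc J - 1)) \<le> 8 * 2 ^ Suc J" by (simp add: Suc_le_eq diff_mult_distrib2)
    then show ?thesis unfolding budget_def by (simp only: add_0_right mult_le_mono2)
  qed
  ultimately show ?thesis by (intro wp_costs) auto
qed

text \<open>If the optimum exceeds 101/100 M, the answer 2 M is good, because (2 - 1/100) * 101/100
  > 2. The smaller answer is then at risk only if phi < 1/10, where it is improbable; for phi above
  11/10 * 29/240 both answers are good.\<close>

lemma prog_correct:
  assumes MT: "M \<le> TSP n w"
  shows "measure_pmf.prob (den w tsp_prog) {v. real (TSP n w) \<le> v \<and> v \<le> (2 - eps) * real (TSP n w)} \<ge> 1 - 1 / real n"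
proof -
  let ?t = "12/10 * (29/240) * real Rn" and ?S = "isum Rn (den w sampler)"
  let ?out = "\<lambda>s. if ?t \<le> real s then (2 - eps) * real M else 2 * real M"
  let ?G = "{v. real (TSP n w) \<le> v \<and> v \<le> (2 - eps) * real (TSP n w)}"
  have e: "0 < eps" "eps \<le> 1/100" by (simp_all add: eps_def)
  have d: "den w tsp_prog = map_pmf ?out ?S"
    by (simp add: tsp_prog_def den_bindp den_repeatp map_pmf_def if_distrib[where f = return_pmf])
  have pr: "measure_pmf.prob (den w tsp_prog) ?G = measure_pmf.prob ?S {s. ?out s \<in> ?G}"
    unfolding d measure_map_pmf vimage_def by simp
  have ln: "real n * exp (- (1/1000) * (29/240) * Rn) \<le> 1"
  proof -
    have "10000 * ln (real n) \<le> Rn" using n2 unfolding Rn_def by linarith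
    \<comment> \<open>The factor 10000 in \<open>Rn\<close> gives 10 * 29/240 > 1.\<close>
    then have "ln (real n) \<le> (1/1000) * (29/240) * Rn" using n2 by (simp add: ln_ge_zero)
    then have "exp (- (1/1000) * (29/240) * Rn) \<le> exp (- ln (real n))" by simp
    also have "\<dots> = 1 / real n" using n2 by (simp add: exp_minus inverse_eq_divide)
    finally show ?thesis using n2 by (simp add: field_simps)
  qed
  then have err: "exp (- (1/1000) * (29/240) * Rn) \<le> 1 / real n" using n2 by (simp add: field_simps)
  have "real (TSP n w) \<le> real (2 * M)" using TSP_le_double[OF metric wW] by (simp only: of_nat_le_iff)
  then have le2: "real (TSP n w) \<le> 2 * real M" by simp
  have low: "(2 - eps) * M \<le> (2 - eps) * real (TSP n w)" using MT e by (intro mult_left_mono) auto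
  have good1: "(2 - eps) * M \<in> ?G" if "1/10 \<le> phi"
    using sound[OF that] low by (simp add: eps_def m_def)
  have good2: "2 * real M \<in> ?G" if "101/100 * M < real (TSP n w)"
  proof -
    have "(2 - 1/100) * (101/100 * real M) \<le> (2 - eps) * real (TSP n w)" using that e by (intro mult_mono) auto
    then show ?thesis using le2 by simp
  qed
  note B = sampler_bernoulli
  show ?thesis
  proof (cases "real (TSP n w) \<le> 101/100 * M")
    case True
    then have phi: "19/100 \<le> phi" by (rule complete_phi)
    have "measure_pmf.prob ?S {s. real s < ?t} \<le> exp (- (1/1000) * (29/240) * Rn)"
      using phi B by (intro isum_bernoulli_lower) auto
    moreover have "UNIV - {s. real s < ?t} \<subseteq> {s. ?out s \<in> ?G}" using good1 phi by auto
    then have "measure_pmf.prob ?S (UNIV - {s. real s < ?t}) \<le> measure_pmf.prob ?S {s. ?out s \<in> ?G}"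
      by (intro measure_pmf.finite_measure_mono) auto
    moreover have "measure_pmf.prob ?S (UNIV - {s. real s < ?t}) = 1 - measure_pmf.prob ?S {s. real s < ?t}"
      using measure_pmf.prob_compl[of "{s. real s < ?t}" ?S] by simp
    ultimately show ?thesis unfolding pr using err by linarith
  next
    case False
    then have g2: "2 * real M \<in> ?G" by (intro good2) simp
    show ?thesis
    proof (cases "phi \<le> 11/10 * (29/240)")
      case True
      have "measure_pmf.prob ?S {s. ?t \<le> real s} \<le> exp (- (1/1000) * (29/240) * Rn)"
        using True B by (intro isum_bernoulli_upper) auto
      moreover have "UNIV - {s. ?t \<le> real s} \<subseteq> {s. ?out s \<in> ?G}" using g2 by auto
      then have "measure_pmf.prob ?S (UNIV - {s. ?t \<le> real s}) \<le> measure_pmf.prob ?S {s. ?out s \<in> ?G}"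
        by (intro measure_pmf.finite_measure_mono) auto
      moreover have "measure_pmf.prob ?S (UNIV - {s. ?t \<le> real s}) = 1 - measure_pmf.prob ?S {s. ?t \<le> real s}"
        using measure_pmf.prob_compl[of "{s. ?t \<le> real s}" ?S] by simp
      ultimately show ?thesis unfolding pr using err by linarith
    next
      case False
      then have "{s. ?out s \<in> ?G} = UNIV" using good1 g2 by auto
      then show ?thesis unfolding pr by simp
    qed
  qed
qed

end

section \<open>Bound on the number of queries\<close>

definition query_const :: real where
  "query_const = 10001 * 32 * (23 * 10 ^ 12) powr (5/4) / ln 2 ^ 5"

context tsp_alg begin

lemma depth_bound: "2 ^ Suc J \<le> 4 * (1000 * real N) powr (5/4)"
proof (cases J)
  case 0
  have "1 \<le> 1000 * real N" using N_pos by simp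
  then have "1 \<le> (1000 * real N) powr (5/4)" by (intro ge_one_powr_ge_zero) auto
  then show ?thesis using 0 by simp
next
  case (Suc j)
  have "\<not> 1000 * real N \<le> (199/100) ^ j"
    using not_less_Least[of j "\<lambda>j. 1000 * real N \<le> (199/100) ^ j"] Suc unfolding J_def by simp
  then have lt: "(199/100 :: real) ^ j \<le> 1000 * real N" by simp
  have "(2::real) \<le> (199/100) powr (5/4)"
  proof -
    \<comment> \<open>Raised to the fourth power, the claim is 16 <= (199/100)^5.\<close>
    have "(2::real) powr 4 \<le> ((199/100) powr (5/4)) powr 4" by (simp add: powr_powr power_divide)
    then show ?thesis using powr_less_mono2[of 4 "(199/100) powr (5/4)" "2::real"] by force
  qed
  then have "(2::real) ^ j \<le> ((199/100) powr (5/4)) ^ j" by (intro power_mono) auto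
  also have "\<dots> = ((199/100) ^ j) powr (5/4)"
    by (simp add: powr_power powr_realpow[symmetric] powr_powr mult.commute)
  also have "\<dots> \<le> (1000 * real N) powr (5/4)" using lt by (intro powr_mono2) auto
  finally show ?thesis using Suc by simp
qed

text \<open>All factors are bounded in terms of \<open>log 2 (real n)\<close>, which is at least 1,
  so that exponents may be rounded up: (5/4) * 2 to 4 for the depth, plus one factor for
  \<open>Rn\<close>. Division by ln 2 ^ 5 converts to natural logarithms.\<close>

lemma budget_bound:
  assumes lgd: "lg = nat \<lceil>log 2 (real n)\<rceil>"
  shows "real budget \<le> query_const * real n powr 1.5 * ln (real n) ^ 5"
proof -
  define y where "y = log 2 (real n)"
  have y1: "1 \<le> y" using n2 by (simp add: y_def)
  have ly: "ln (real n) = y * ln 2" by (simp add: y_def log_def)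
  have "real lg \<le> y + 1" using y1 unfolding lgd y_def[symmetric] by linarith
  \<comment> \<open>The left side is 57 + 8 lg, at most 65 + 8 y.\<close>
  then have k: "real kmax + 1 \<le> 73 * y" using y1 by (simp add: kmax_def)
  have "1000 * real N = 4200000000 * n * (real kmax + 1) ^ 2" by (simp add: N_def \<beta>_def power2_eq_square algebra_simps)
  also have "\<dots> \<le> 4200000000 * n * (73 * y) ^ 2" using k by (intro mult_left_mono power_mono) auto
  also have "\<dots> \<le> (23 * 10 ^ 12) * n * y ^ 2" using y1 by (simp add: power2_eq_square mult_right_mono)
  finally have "(1000 * real N) powr (5/4) \<le> ((23 * 10 ^ 12) * n * y ^ 2) powr (5/4)" by (intro powr_mono2) auto
  also have "\<dots> = (23 * 10 ^ 12) powr (5/4) * real n powr (5/4) * (y ^ 2) powr (5/4)"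
    by (simp add: powr_mult)
  also have "\<dots> \<le> (23 * 10 ^ 12) powr (5/4) * real n powr 1.5 * y ^ 4"
  proof (intro mult_mono)
    show "real n powr (5/4) \<le> real n powr 1.5" using n2 by (intro powr_mono) auto
    have "(y ^ 2) powr (5/4) \<le> (y ^ 2) powr 2" using y1 by (intro powr_mono) auto
    also have "\<dots> = (y ^ 2) ^ 2" using y1 by (simp add: powr_numeral)
    also have "\<dots> = y ^ 4" by (simp flip: power_mult)
    finally show "(y ^ 2) powr (5/4) \<le> y ^ 4" .
  qed auto
  finally have P: "(1000 * real N) powr (5/4) \<le> (23 * 10 ^ 12) powr (5/4) * real n powr 1.5 * y ^ 4" .
  have "ln (2::real) \<le> 1" using ln_le_minus_one[of 2] by simp
  then have "ln (real n) \<le> y" unfolding ly using y1 by (simp add: mult_left_le)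
  moreover have "0 \<le> ln (real n)" using n2 by simp
  ultimately have R: "real Rn \<le> 10001 * y" using y1 unfolding Rn_def by linarith
  have "real budget = real Rn * (8 * 2 ^ Suc J)" by (simp add: budget_def)
  also have "\<dots> \<le> (10001 * y) * (8 * (4 * ((23 * 10 ^ 12) powr (5/4) * real n powr 1.5 * y ^ 4)))"
    using R y1 order_trans[OF depth_bound mult_left_mono[OF P, of 4]] by (intro mult_mono) auto
  also have "\<dots> = 10001 * 32 * (23 * 10 ^ 12) powr (5/4) * real n powr 1.5 * y ^ 5"
    by (simp add: power_def numeral_eq_Suc mult_ac)
  also have "\<dots> = query_const * real n powr 1.5 * ln (real n) ^ 5"
    unfolding query_const_def ly by (simp add: power_mult_distrib)
  finally show ?thesis .
qed

end

section \<open>From the program to a single randomised algorithm\<close>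

lemma nrm_weight: "is_metric n w \<Longrightarrow> a < n \<Longrightarrow> b < n \<Longrightarrow> w (fst (nrm a b)) (snd (nrm a b)) = w a b"
  by (auto simp: nrm_def is_metric_def min_def max_def)

text \<open>The algorithm sees only n, T and the tree weights, so one distribution has to serve all
  metrics that agree with them.\<close>

definition good_alg :: "nat \<Rightarrow> (nat \<times> nat) set \<Rightarrow> (nat \<times> nat \<Rightarrow> nat) \<Rightarrow> qalg pmf \<Rightarrow> bool" where
  "good_alg n T tw P \<longleftrightarrow> (\<forall>w. is_metric n w \<longrightarrow> is_MST n w T \<longrightarrow> tree_weights w T = tw \<longrightarrow>
     (\<forall>alg\<in>set_pmf P. real (snd (run w alg)) \<le> query_const * real n powr 1.5 * ln (real n) ^ 5) \<and>
     measure_pmf.prob P {alg. real (TSP n w) \<le> fst (run w alg) \<and> fst (run w alg) \<le> (2 - eps) * real (TSP n w)} \<ge> 1 - 1 / real n)"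

lemma algorithm_exists:
  assumes n: "2 \<le> n"
  shows "\<exists>P. good_alg n T tw P"
proof (cases "\<exists>w. is_metric n w \<and> is_MST n w T \<and> tree_weights w T = tw")
  case True
  \<comment> \<open>\<open>w0\<close> witnesses that T is a spanning tree with positive weights; if
    no such metric exists, every distribution qualifies vacuously.\<close>
  then obtain w0 where w0: "is_metric n w0" "is_MST n w0 T" "tree_weights w0 T = tw" by blast
  obtain par dep where pd: "\<And>v. 0 < v \<Longrightarrow> v < n \<Longrightarrow> par v < n \<and> dep (par v) < (dep v :: nat)"
    and bij: "bij_betw (\<lambda>v. nrm v (par v)) {1..<n} T"
    using spanning_tree_parents[OF _ n, of T] w0(2) by (auto simp: is_MST_def)
  \<comment> \<open>Read off the given weights, so that the program below does not depend on the
    metric it is run on.\<close>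
  define W where "W v = tw (nrm v (par v))" for v
  have W: "w v (par v) = W v" if "is_metric n w" "tree_weights w T = tw" "0 < v" "v < n" for w v
  proof -
    have "nrm v (par v) \<in> T" using bij that by (auto simp: bij_betw_def)
    then show ?thesis using nrm_weight[OF that(1), of v "par v"] pd[of v] that by (auto simp: W_def tree_weights_def)
  qed
  interpret rt: rooted_tree n par dep W
  proof
    show "1 \<le> W v" if v: "0 < v" "v < n" for v
    proof -
      have "par v \<noteq> v" using pd[OF v] by auto
      then have "1 \<le> w0 v (par v)" using w0(1) v pd[OF v] unfolding is_metric_def by metis
      then show ?thesis using W[OF w0(1,3) v] by simp
    qed
  qed (use n pd in auto)
  obtain pos where pos: "\<forall>x<n. pos x \<le> 2 * rt.M \<and> (\<forall>y<n. real (rt.dT x y) \<le> \<bar>real (pos x) - real (pos y)\<bar>)"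
    using rt.ex_pos by blast
  define lg where "lg = nat \<lceil>log 2 (real n)\<rceil>"
  interpret al: tsp_alg n par dep W pos lg
  proof
    have "real n = 2 powr log 2 (real n)" using n by simp
    also have "\<dots> \<le> 2 powr real lg" unfolding lg_def by (intro powr_mono) (auto intro: real_nat_ceiling_ge)
    also have "\<dots> = 2 ^ lg" by (simp add: powr_realpow)
    finally show "n \<le> 2 ^ lg" by (metis of_nat_le_iff of_nat_numeral of_nat_power)
  qed (use pos in auto)
  define P where "P = map_pmf (det al.tsp_prog) (replicate_pmf al.budget (seed_pmf (al.N + rt.M)))"
  show ?thesis unfolding good_alg_def
  proof (intro exI[of _ P] allI impI conjI ballI)
    fix w assume w: "is_metric n w" "is_MST n w T" "tree_weights w T = tw"
    interpret tr: tsp_run n par dep W pos lg w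
      by unfold_locales (use w W in auto)
    show "real (snd (run w alg)) \<le> query_const * real n powr 1.5 * ln (real n) ^ 5" if "alg \<in> set_pmf P" for alg
    proof -
      have "snd (run w alg) \<le> al.budget" using that run_det_queries[OF tr.prog_cost] by (auto simp: P_def)
      then show ?thesis using al.budget_bound[OF lg_def] by linarith
    qed
    obtain xs where xs: "distinct xs" "set xs = {0..<n}" "tour_cost w xs = TSP n w"
      using TSP_attained[of n w] by blast
    have "rt.M = tree_weight w T"
    proof -
      have "tree_weight w T = (\<Sum>v\<in>{1..<n}. w (fst (nrm v (par v))) (snd (nrm v (par v))))"
        unfolding tree_weight_def by (rule sum.reindex_bij_betw[OF bij, symmetric])
      also have "\<dots> = (\<Sum>v\<in>{1..<n}. W v)"
        using nrm_weight[OF w(1)] pd W[OF w(1,3)] by (intro sum.cong) auto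
      finally show ?thesis by (simp add: rt.M_def)
    qed
    then have MT: "rt.M \<le> TSP n w" using MST_le_tour[OF w(2,1) n xs(1,2)] xs(3) by simp
    have "measure_pmf.prob P {alg. real (TSP n w) \<le> fst (run w alg) \<and> fst (run w alg) \<le> (2 - eps) * real (TSP n w)}
       = measure_pmf.prob (map_pmf (\<lambda>rs. fst (run w (det al.tsp_prog rs))) (replicate_pmf al.budget (seed_pmf (al.N + rt.M))))
           {v. real (TSP n w) \<le> v \<and> v \<le> (2 - eps) * real (TSP n w)}"
      by (simp add: P_def measure_map_pmf vimage_def)
    also have "\<dots> = measure_pmf.prob (den w al.tsp_prog) {v. real (TSP n w) \<le> v \<and> v \<le> (2 - eps) * real (TSP n w)}"
      by (simp only: run_det_distr[OF tr.prog_cost])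
    also have "\<dots> \<ge> 1 - 1 / real n" by (rule tr.prog_correct[OF MT])
    finally show "measure_pmf.prob P {alg. real (TSP n w) \<le> fst (run w alg) \<and> fst (run w alg) \<le> (2 - eps) * real (TSP n w)} \<ge> 1 - 1 / real n" .
  qed
qed (auto simp: good_alg_def)

theorem theorem1p8:
  shows "\<exists>\<epsilon>0::real. \<epsilon>0 > 0 \<and> (\<exists>(A::rand_alg) (C::real) (k::nat).
     \<forall>n \<ge> 2. \<forall>w T. is_metric n w \<longrightarrow> is_MST n w T \<longrightarrow>
       (\<forall>alg \<in> set_pmf (A n T (tree_weights w T)).
          real (snd (run w alg)) \<le> C * real n powr 1.5 * (ln (real n)) ^ k) \<and>
       measure_pmf.prob (A n T (tree_weights w T))
         {alg. real (TSP n w) \<le> fst (run w alg) \<and>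
               fst (run w alg) \<le> (2 - \<epsilon>0) * real (TSP n w)}
         \<ge> 1 - 1 / real n)"
proof -
  define A :: rand_alg where "A n T tw = (SOME P. good_alg n T tw P)" for n T tw
  have "good_alg n T tw (A n T tw)" if "2 \<le> n" for n T tw
    unfolding A_def using algorithm_exists[OF that] by (rule someI_ex)
  then have "\<forall>n \<ge> 2. \<forall>w T. is_metric n w \<longrightarrow> is_MST n w T \<longrightarrow>
       (\<forall>alg \<in> set_pmf (A n T (tree_weights w T)).
          real (snd (run w alg)) \<le> query_const * real n powr 1.5 * (ln (real n)) ^ 5) \<and>
       measure_pmf.prob (A n T (tree_weights w T))
         {alg. real (TSP n w) \<le> fst (run w alg) \<and>
               fst (run w alg) \<le> (2 - eps) * real (TSP n w)}
         \<ge> 1 - 1 / real n"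
    unfolding good_alg_def by blast
  moreover have "0 < eps" by (simp add: eps_def)
  ultimately show ?thesis by (intro exI[of _ eps] conjI exI[of _ A] exI[of _ query_const] exI[of _ "5::nat"])
qed

end
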